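(* The \textsc{co-$\ell$-Median} problem (uncapacitated), in its exact decision/optimization form parameterized by $\ell$, is W[1]-hard.
   Context: \textsc{co-$\ell$-Median} (uncapacitated): the input is a finite set of facilities $F$, a finite set of clients $C$, a metric $d$ on $F\cup C$, and an integer $\ell$ (the parameter). A solution is a set of open facilities of size at most $|F|-\ell$ (equivalently, at least $\ell$ facilities are closed), each client being served by an open facility; the goal is to minimize the total distance from clients to the facilities serving them. W[1]-hardness is with respect to parameterized reductions. *)

theory Defs
  imports "HOL-Analysis.Abstract_Metric_Spaces"
begin

section \<open>Machine model\<close>

text \<open>
  The machine model is the language WHILE over binary trees of N. D. Jones (Computability and
  Complexity from a Programming Perspective, 1997). Trees play the role of strings; the length of
  an input is the number of nodes of the tree. An assignment is charged with the size of the value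
  it stores, so all values occurring in a run have size linear in the input size plus the time, and
  the model and multi-tape Turing machines simulate each other with polynomial overhead.
\<close>

datatype tree = Atom | Pair tree tree

fun tree_size :: "tree \<Rightarrow> nat" where
  "tree_size Atom = 1"
| "tree_size (Pair a b) = 1 + tree_size a + tree_size b"

datatype expr = Var nat | Nil_E | Cons_E expr expr | Hd_E expr | Tl_E expr

datatype cmd = Assign nat expr | Seq cmd cmd | If expr cmd cmd | While expr cmd

type_synonym store = "nat \<Rightarrow> tree"

fun hd_tree :: "tree \<Rightarrow> tree" where
  "hd_tree Atom = Atom"
| "hd_tree (Pair a b) = a"

fun tl_tree :: "tree \<Rightarrow> tree" where
  "tl_tree Atom = Atom"
| "tl_tree (Pair a b) = b"

fun eval_expr :: "expr \<Rightarrow> store \<Rightarrow> tree" where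
  "eval_expr (Var x) s = s x"
| "eval_expr Nil_E s = Atom"
| "eval_expr (Cons_E e1 e2) s = Pair (eval_expr e1 s) (eval_expr e2 s)"
| "eval_expr (Hd_E e) s = hd_tree (eval_expr e s)"
| "eval_expr (Tl_E e) s = tl_tree (eval_expr e s)"

text \<open>
  \<open>exec p s t s'\<close>: started in store \<open>s\<close>, the program \<open>p\<close> halts after time \<open>t\<close> in store \<open>s'\<close>.
  In tests, \<^const>\<open>Atom\<close> is false and every other tree is true.
\<close>

inductive exec :: "cmd \<Rightarrow> store \<Rightarrow> nat \<Rightarrow> store \<Rightarrow> bool" where
  assign: "exec (Assign x e) s (1 + tree_size (eval_expr e s)) (s(x := eval_expr e s))"
| seq: "exec p s t s' \<Longrightarrow> exec q s' u s'' \<Longrightarrow> exec (Seq p q) s (t + u) s''"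
| if_true: "eval_expr e s \<noteq> Atom \<Longrightarrow> exec p s t s' \<Longrightarrow> exec (If e p q) s (1 + t) s'"
| if_false: "eval_expr e s = Atom \<Longrightarrow> exec q s t s' \<Longrightarrow> exec (If e p q) s (1 + t) s'"
| while_false: "eval_expr e s = Atom \<Longrightarrow> exec (While e p) s 1 s"
| while_true: "eval_expr e s \<noteq> Atom \<Longrightarrow> exec p s t s' \<Longrightarrow> exec (While e p) s' u s''
    \<Longrightarrow> exec (While e p) s (1 + t + u) s''"

text \<open>Variable 0 holds the input and the output; all other variables are initially \<^const>\<open>Atom\<close>.\<close>

definition computes_in :: "cmd \<Rightarrow> tree \<Rightarrow> nat \<Rightarrow> tree \<Rightarrow> bool" where
  "computes_in p x t y \<longleftrightarrow> (\<exists>s. exec p ((\<lambda>_. Atom)(0 := x)) t s \<and> s 0 = y)"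

fun enc_list :: "tree list \<Rightarrow> tree" where
  "enc_list [] = Atom"
| "enc_list (x # xs) = Pair x (enc_list xs)"

definition enc_unary :: "nat \<Rightarrow> tree" where
  "enc_unary n = enc_list (replicate n Atom)"

definition computable :: "(nat \<Rightarrow> nat) \<Rightarrow> bool" where
  "computable f \<longleftrightarrow> (\<exists>p. \<forall>n. \<exists>t. computes_in p (enc_unary n) t (enc_unary (f n)))"


section \<open>Parameterized problems and reductions\<close>

type_synonym param_problem = "(tree \<times> nat) set"

text \<open>
  The parameter is handed over in unary; since running times may depend on it by an arbitrary
  computable factor, this is no restriction.
\<close>

definition fpt_reducible :: "param_problem \<Rightarrow> param_problem \<Rightarrow> bool" (infix \<open>\<le>\<^sub>f\<^sub>p\<^sub>t\<close> 50) where
  "A \<le>\<^sub>f\<^sub>p\<^sub>t B \<longleftrightarrow> (\<exists>p f g c. computable f \<and> computable g \<and>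
     (\<forall>x k. \<exists>x' k' t.
        computes_in p (Pair x (enc_unary k)) t (Pair x' (enc_unary k')) \<and>
        t \<le> f k * tree_size x ^ c \<and>
        k' \<le> g k \<and>
        ((x, k) \<in> A \<longleftrightarrow> (x', k') \<in> B)))"


section \<open>Weighted circuit satisfiability and the W-hierarchy\<close>

text \<open>
  A circuit is the list of its gates in a topological order; a gate refers to its in-neighbours by
  their positions. The output node is the last one.
\<close>

datatype gate = Input | Not_Gate nat | And_Gate "nat list" | Or_Gate "nat list"

type_synonym circuit = "gate list"

fun preds :: "gate \<Rightarrow> nat list" where
  "preds Input = []"
| "preds (Not_Gate j) = [j]"
| "preds (And_Gate js) = js"
| "preds (Or_Gate js) = js"

fun arity_ok :: "gate \<Rightarrow> bool" where
  "arity_ok Input = True"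
| "arity_ok (Not_Gate j) = True"
| "arity_ok (And_Gate js) = (2 \<le> length js \<and> distinct js)"
| "arity_ok (Or_Gate js) = (2 \<le> length js \<and> distinct js)"

definition circuit :: "circuit \<Rightarrow> bool" where
  "circuit C \<longleftrightarrow> C \<noteq> [] \<and> (\<forall>i<length C. arity_ok (C ! i) \<and> (\<forall>j\<in>set (preds (C ! i)). j < i))"

definition input_output_path :: "circuit \<Rightarrow> nat list \<Rightarrow> bool" where
  "input_output_path C ps \<longleftrightarrow> ps \<noteq> [] \<and> set ps \<subseteq> {..<length C} \<and>
     C ! hd ps = Input \<and> last ps = length C - 1 \<and>
     successively (\<lambda>j i. j \<in> set (preds (C ! i))) ps"

definition depth_at_most :: "nat \<Rightarrow> circuit \<Rightarrow> bool" where
  "depth_at_most d C \<longleftrightarrow> (\<forall>ps. input_output_path C ps \<longrightarrow> length ps - 1 \<le> d)"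

definition large :: "gate \<Rightarrow> bool" where
  "large g \<longleftrightarrow> length (preds g) > 2"

definition weft_at_most :: "nat \<Rightarrow> circuit \<Rightarrow> bool" where
  "weft_at_most w C \<longleftrightarrow>
     (\<forall>ps. input_output_path C ps \<longrightarrow> length (filter (\<lambda>i. large (C ! i)) ps) \<le> w)"

fun gate_value :: "gate \<Rightarrow> nat \<Rightarrow> (nat \<Rightarrow> bool) \<Rightarrow> bool" where
  "gate_value Input i v = v i"
| "gate_value (Not_Gate j) i v = (\<not> v j)"
| "gate_value (And_Gate js) i v = (\<forall>j\<in>set js. v j)"
| "gate_value (Or_Gate js) i v = (\<exists>j\<in>set js. v j)"

text \<open>
  \<open>v\<close> assigns a truth value to every node. By acyclicity it is determined by its values at the
  input nodes, on which there is no constraint.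
\<close>

definition valuation :: "circuit \<Rightarrow> (nat \<Rightarrow> bool) \<Rightarrow> bool" where
  "valuation C v \<longleftrightarrow> (\<forall>i<length C. v i = gate_value (C ! i) i v)"

definition has_weighted_sat :: "circuit \<Rightarrow> nat \<Rightarrow> bool" where
  "has_weighted_sat C k \<longleftrightarrow> (\<exists>v. valuation C v \<and> v (length C - 1) \<and>
     card {i. i < length C \<and> C ! i = Input \<and> v i} = k)"

fun enc_gate :: "gate \<Rightarrow> tree" where
  "enc_gate Input = Pair (enc_unary 0) Atom"
| "enc_gate (Not_Gate j) = Pair (enc_unary 1) (enc_unary j)"
| "enc_gate (And_Gate js) = Pair (enc_unary 2) (enc_list (map enc_unary js))"
| "enc_gate (Or_Gate js) = Pair (enc_unary 3) (enc_list (map enc_unary js))"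

definition enc_circuit :: "circuit \<Rightarrow> tree" where
  "enc_circuit C = enc_list (map enc_gate C)"

definition weighted_circuit_sat :: "nat \<Rightarrow> nat \<Rightarrow> param_problem" where
  "weighted_circuit_sat w d = {(enc_circuit C, k) | C k.
     circuit C \<and> weft_at_most w C \<and> depth_at_most d C \<and> has_weighted_sat C k}"

definition W_class :: "nat \<Rightarrow> param_problem set" where
  "W_class w = {A. \<exists>d. A \<le>\<^sub>f\<^sub>p\<^sub>t weighted_circuit_sat w d}"

definition W_hard :: "nat \<Rightarrow> param_problem \<Rightarrow> bool" where
  "W_hard w L \<longleftrightarrow> (\<forall>A\<in>W_class w. A \<le>\<^sub>f\<^sub>p\<^sub>t L)"


section \<open>The uncapacitated co-median problem\<close>

text \<open>
  \<open>S\<close> is the set of open facilities, \<open>a\<close> maps a client to the facility serving it. The size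
  bound is written additively because natural-number subtraction truncates: if \<open>\<ell>\<close> exceeds the
  number of facilities there is no solution.
\<close>

definition co_median_solution :: "'a set \<Rightarrow> 'a set \<Rightarrow> nat \<Rightarrow> 'a set \<Rightarrow> ('a \<Rightarrow> 'a) \<Rightarrow> bool" where
  "co_median_solution F C l S a \<longleftrightarrow> S \<subseteq> F \<and> card S + l \<le> card F \<and> (\<forall>c\<in>C. a c \<in> S)"

definition median_cost :: "'a set \<Rightarrow> ('a \<Rightarrow> 'a \<Rightarrow> real) \<Rightarrow> ('a \<Rightarrow> 'a) \<Rightarrow> real" where
  "median_cost C d a = (\<Sum>c\<in>C. d c (a c))"

fun enc_binary :: "nat \<Rightarrow> tree" where
  "enc_binary n = (if n = 0 then Atom else Pair (enc_unary (n mod 2)) (enc_binary (n div 2)))"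

declare enc_binary.simps [simp del]

definition enc_int :: "int \<Rightarrow> tree" where
  "enc_int z = Pair (enc_unary (if z < 0 then 1 else 0)) (enc_binary (nat \<bar>z\<bar>))"

definition enc_rat :: "rat \<Rightarrow> tree" where
  "enc_rat r = Pair (enc_int (fst (quotient_of r))) (enc_int (snd (quotient_of r)))"

text \<open>
  Instances carry rational distances and a rational cost bound, written in binary. Points are named
  by natural numbers, where a point may be both a facility and a client. Only the distances between
  points of the instance are encoded.
\<close>

definition enc_median :: "nat list \<Rightarrow> nat list \<Rightarrow> (nat \<Rightarrow> nat \<Rightarrow> rat) \<Rightarrow> rat \<Rightarrow> tree" where
  "enc_median Fs Cs d B = enc_list
     [enc_list (map enc_unary Fs),
      enc_list (map enc_unary Cs),
      enc_list (map (\<lambda>x. enc_list (map (\<lambda>y. enc_rat (d x y)) (Fs @ Cs))) (Fs @ Cs)),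
      enc_rat B]"

definition co_median :: param_problem where
  "co_median = {(enc_median Fs Cs d B, l) | Fs Cs d B l.
     distinct Fs \<and> distinct Cs \<and>
     Metric_space (set Fs \<union> set Cs) (\<lambda>x y. real_of_rat (d x y)) \<and>
     (\<exists>S a. co_median_solution (set Fs) (set Cs) l S a \<and>
        median_cost (set Cs) (\<lambda>x y. real_of_rat (d x y)) a \<le> real_of_rat B)}"


section \<open>The encodings are injective\<close>

lemma enc_list_inject [simp]: "enc_list xs = enc_list ys \<longleftrightarrow> xs = ys"
proof (induction xs arbitrary: ys)
  case Nil then show ?case by (cases ys) auto
next
  case (Cons x xs) then show ?case by (cases ys) auto
qed

lemma enc_unary_inject [simp]: "enc_unary m = enc_unary n \<longleftrightarrow> m = n"
  by (auto simp: enc_unary_def dest: arg_cong [where f = length])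

lemma map_enc_unary_inject [simp]: "map enc_unary xs = map enc_unary ys \<longleftrightarrow> xs = ys"
  by (simp add: inj_def inj_map_eq_map)

lemma enc_gate_inject [simp]: "enc_gate g = enc_gate h \<longleftrightarrow> g = h"
  by (cases g; cases h) auto

lemma enc_circuit_inject: "enc_circuit C = enc_circuit D \<longleftrightarrow> C = D"
  by (simp add: enc_circuit_def inj_def inj_map_eq_map)

lemma enc_binary_inject [simp]: "enc_binary m = enc_binary n \<longleftrightarrow> m = n"
proof (induction m arbitrary: n rule: less_induct)
  case (less m)
  show ?case
  proof (cases "m = 0 \<or> n = 0")
    case True
    then show ?thesis by (auto simp: enc_binary.simps [of m] enc_binary.simps [of n])
  next
    case False
    then have "enc_binary m = enc_binary n \<longleftrightarrow> m mod 2 = n mod 2 \<and> m div 2 = n div 2"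
      using less [of "m div 2" "n div 2"]
      by (simp add: enc_binary.simps [of m] enc_binary.simps [of n])
    then show ?thesis by (metis div_mult_mod_eq)
  qed
qed

lemma enc_rat_inject [simp]: "enc_rat q = enc_rat r \<longleftrightarrow> q = r"
proof -
  have int: "enc_int a = enc_int b \<longleftrightarrow> a = b" for a b
    by (auto simp: enc_int_def split: if_splits)
  show ?thesis
    by (auto simp: enc_rat_def int intro: quotient_of_inject prod_eqI)
qed

lemma enc_median_inject:
  "enc_median Fs Cs d B = enc_median Fs' Cs' d' B' \<longleftrightarrow>
     Fs = Fs' \<and> Cs = Cs' \<and> B = B' \<and> (\<forall>x\<in>set Fs \<union> set Cs. \<forall>y\<in>set Fs \<union> set Cs. d x y = d' x y)"
  (is "?L \<longleftrightarrow> ?R")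
proof -
  have "enc_list (map (\<lambda>x. enc_list (map (\<lambda>y. enc_rat (d x y)) P)) P) =
        enc_list (map (\<lambda>x. enc_list (map (\<lambda>y. enc_rat (d' x y)) P)) P) \<longleftrightarrow>
        (\<forall>x\<in>set P. \<forall>y\<in>set P. d x y = d' x y)" for P
    by simp
  from this [of "Fs @ Cs"] show ?thesis
    unfolding enc_median_def enc_list_inject list.inject map_enc_unary_inject enc_rat_inject
      set_append by blast
qed

end

theory Submission
  imports Defs
begin

text \<open>
  Weighted satisfiability of circuits of weft \<open>1\<close> and depth \<open>d\<close> is reduced to the following selection
  problem: from a list of choices, select at least \<open>l\<close> such that no tuple from a given list is
  selected entirely. This is co-median: facilities are the choices, the closed ones are selected,
  and every tuple becomes a client at distance \<open>1\<close> from its members and \<open>2\<close> from everything else.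
  With the number of clients as budget each client needs an open facility in its tuple.

  The choices describe a weight-\<open>k\<close> assignment by its true inputs in increasing order, so that two
  consecutive true inputs certify that all inputs between them are false. They also guess the value
  of each of the at most \<open>2 ^ d\<close> large gates reachable from the output through small gates, together
  with an in-neighbour that forces this value if a single one can do so. Since there is one large gate
  on a path at most, every wrong guess and every wrong output is then exposed by a number of choices
  that depends on \<open>d\<close> only; these sets of choices are the forbidden tuples. The parameter becomes
  \<open>k\<close> plus the number of guessed gates.

  Everything is a composition of folds over lists and recursions of constant depth \<open>d\<close>, so it runs in
  polynomial time. For this, programs are written so as to reset their work variables, which makes
  them compose.
\<close>

section \<open>Self-cleaning programs\<close>

text \<open>Forbidden tuples are listed exhaustively, so their size has to be bounded by
  \<open>d\<close> alone and must not involve \<open>k\<close>. Naming the \<open>k\<close> true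
  inputs without their ranks fails here: that an input is false would follow only from all
  \<open>k\<close> choices together. Likewise a large Or gate guessed true would be refuted only by
  certifying all its in-neighbours false; a named witness leaves a single in-neighbour to test, and
  dually for a large And gate guessed false. The guessed gate has used up the weft of every path
  through it, so its in-neighbours have only small gates below them and depend on at most
  \<open>2 ^ d\<close> inputs.

  The selection problem only asks for many choices, never for a particular one. Forbidding
  conflicting pairs leaves at most one choice per rank and per guessed gate; the threshold equals
  the number of these slots and so fills each of them.

  A reduction must also be total on trees. Hence the codes of circuits have to be recognized,
  including the conditions on depth and weft; these speak of all paths and are replaced by
  recursions over in-neighbours.\<close>

definition exec_le :: "cmd \<Rightarrow> store \<Rightarrow> nat \<Rightarrow> store \<Rightarrow> bool" where
  "exec_le p s T s' \<longleftrightarrow> (\<exists>t\<le>T. exec p s t s')"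

lemma exec_le_mono: "exec_le p s T s' \<Longrightarrow> T \<le> U \<Longrightarrow> exec_le p s U s'"
  unfolding exec_le_def by (meson le_trans)

lemma exec_le_assign:
  assumes "s' = s(x := eval_expr e s)" "1 + tree_size (eval_expr e s) \<le> T"
  shows "exec_le (Assign x e) s T s'"
  unfolding exec_le_def using assms exec.assign by blast

lemma exec_le_seq:
  assumes "exec_le p s T s'" "exec_le q s' U s''" "T + U \<le> V"
  shows "exec_le (Seq p q) s V s''"
proof -
  from assms obtain t u where "t \<le> T" "u \<le> U" "exec p s t s'" "exec q s' u s''"
    unfolding exec_le_def by blast
  then show ?thesis
    unfolding exec_le_def using assms(3) exec.seq [of p s t s' q u s''] by (intro exI [of _ "t + u"]) auto
qed

lemma exec_le_if:
  assumes "exec_le (if eval_expr e s \<noteq> Atom then p else q) s T s'" "1 + T \<le> V"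
  shows "exec_le (If e p q) s V s'"
proof -
  from assms obtain t where t: "t \<le> T" "exec (if eval_expr e s \<noteq> Atom then p else q) s t s'"
    unfolding exec_le_def by blast
  then have "exec (If e p q) s (1 + t) s'"
    by (cases "eval_expr e s = Atom") (auto intro: exec.if_true [simplified] exec.if_false [simplified])
  then show ?thesis
    unfolding exec_le_def using assms(2) t(1) by (intro exI [of _ "1 + t"]) auto
qed

lemma exec_le_while_false:
  "eval_expr e s = Atom \<Longrightarrow> 1 \<le> T \<Longrightarrow> exec_le (While e p) s T s"
  unfolding exec_le_def using exec.while_false by blast

lemma exec_le_while_true:
  assumes "eval_expr e s \<noteq> Atom" "exec_le p s T s'" "exec_le (While e p) s' U s''" "1 + T + U \<le> V"
  shows "exec_le (While e p) s V s''"
proof -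
  from assms obtain t u where "t \<le> T" "u \<le> U" "exec p s t s'" "exec (While e p) s' u s''"
    unfolding exec_le_def by blast
  then show ?thesis
    unfolding exec_le_def using assms(1,4) exec.while_true [of e s p t s' u s'']
    by (intro exI [of _ "1 + t + u"]) auto
qed

text \<open>Variables from \<open>N\<close> on are arbitrary and survive the run, so a caller may
  park its own data there. Variables strictly between \<open>0\<close> and \<open>N\<close> are work
  space, \<open>Atom\<close> before and after. Enlarging \<open>N\<close> only strengthens the
  precondition, which lets two programs agree on a common \<open>N\<close>.\<close>

definition runs :: "cmd \<Rightarrow> nat \<Rightarrow> tree \<Rightarrow> nat \<Rightarrow> tree \<Rightarrow> bool" where
  "runs p N x T y \<longleftrightarrow> 0 < N \<and>
     (\<forall>s. s 0 = x \<longrightarrow> (\<forall>i. 0 < i \<and> i < N \<longrightarrow> s i = Atom) \<longrightarrow> exec_le p s T (s(0 := y)))"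

lemma runsD:
  "runs p N x T y \<Longrightarrow> s 0 = x \<Longrightarrow> (\<And>i. 0 < i \<Longrightarrow> i < N \<Longrightarrow> s i = Atom) \<Longrightarrow> exec_le p s T (s(0 := y))"
  unfolding runs_def by blast

lemma runs_mono: "runs p N x T y \<Longrightarrow> N \<le> M \<Longrightarrow> T \<le> U \<Longrightarrow> runs p M x U y"
  unfolding runs_def by (auto intro!: exec_le_mono [of p _ T _ U])

lemma tree_size_pos [simp]: "0 < tree_size t"
  by (cases t) auto

lemma tree_size_ge1 [simp]: "Suc 0 \<le> tree_size t"
  using tree_size_pos [of t] by linarith

lemma tree_size_hd_tl: "tree_size (hd_tree t) \<le> tree_size t" "tree_size (tl_tree t) \<le> tree_size t"
  by (cases t; simp)+

lemma runs_expr: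
  assumes "\<And>s. s 0 = x \<Longrightarrow> eval_expr e s = y"
  shows "runs (Assign 0 e) 1 x (1 + tree_size y) y"
  unfolding runs_def using assms by (auto intro!: exec_le_assign)

lemma runs_seq:
  assumes "runs p N x T y" "runs q N y U z"
  shows "runs (Seq p q) N x (T + U) z"
  unfolding runs_def
proof (intro conjI allI impI)
  show "0 < N" using assms(1) by (simp add: runs_def)
  fix s :: store
  assume s: "s 0 = x" "\<forall>i. 0 < i \<and> i < N \<longrightarrow> s i = Atom"
  have "exec_le q (s(0 := y)) U ((s(0 := y))(0 := z))"
    by (rule runsD [OF assms(2)]) (use s in auto)
  then show "exec_le (Seq p q) s (T + U) (s(0 := z))"
    by (intro exec_le_seq [OF runsD [OF assms(1)]]) (use s in auto)
qed

text \<open>\<open>N\<close> keeps the input for \<open>q\<close>, and \<open>N + 1\<close> keeps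
  the result of \<open>p\<close> while \<open>q\<close> runs.\<close>

definition pair_cmd :: "cmd \<Rightarrow> cmd \<Rightarrow> nat \<Rightarrow> cmd" where
  "pair_cmd p q N =
     Seq (Assign N (Var 0)) (Seq p (Seq (Assign (N + 1) (Var 0)) (Seq (Assign 0 (Var N))
     (Seq (Assign N Nil_E) (Seq q (Seq (Assign 0 (Cons_E (Var (N + 1)) (Var 0))) (Assign (N + 1) Nil_E)))))))"

lemma runs_pair:
  assumes p: "runs p N x T y" and q: "runs q N x U z"
  shows "runs (pair_cmd p q N) (N + 2) x (T + U + 2 * tree_size x + 2 * tree_size y + tree_size z + 20) (Pair y z)"
  unfolding runs_def pair_cmd_def
proof (intro conjI allI impI)
  have N: "0 < N" using assms by (simp add: runs_def)
  show "0 < N + 2" by simp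
  fix s :: store
  assume s: "s 0 = x" "\<forall>i. 0 < i \<and> i < N + 2 \<longrightarrow> s i = Atom"
  show "exec_le (Seq (Assign N (Var 0)) (Seq p (Seq (Assign (N + 1) (Var 0)) (Seq (Assign 0 (Var N))
     (Seq (Assign N Nil_E) (Seq q (Seq (Assign 0 (Cons_E (Var (N + 1)) (Var 0))) (Assign (N + 1) Nil_E))))))))
     s (T + U + 2 * tree_size x + 2 * tree_size y + tree_size z + 20) (s(0 := Pair y z))"
    apply (rule exec_le_seq [OF exec_le_assign [OF refl order.refl]])
     apply (rule exec_le_seq [OF runsD [OF p]])
        apply (use s N in simp)
       apply (use s N in simp)
      apply (rule exec_le_seq [OF exec_le_assign [OF refl order.refl]])
       apply (rule exec_le_seq [OF exec_le_assign [OF refl order.refl]])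
        apply (rule exec_le_seq [OF exec_le_assign [OF refl order.refl]])
         apply (rule exec_le_seq [OF runsD [OF q]])
            apply (use s N in simp)
           apply (use s N in simp)
          apply (rule exec_le_seq [OF exec_le_assign [OF refl order.refl]])
           apply (rule exec_le_assign [OF _ order.refl])
           apply (use s N in \<open>auto simp: fun_eq_iff\<close>)
    done
qed

definition if_cmd :: "cmd \<Rightarrow> cmd \<Rightarrow> cmd \<Rightarrow> nat \<Rightarrow> cmd" where
  "if_cmd c p q N =
     Seq (Assign N (Var 0)) (Seq c (Seq (Assign (N + 1) (Var 0)) (Seq (Assign 0 (Var N))
     (Seq (Assign N Nil_E) (If (Var (N + 1)) (Seq (Assign (N + 1) Nil_E) p) (Seq (Assign (N + 1) Nil_E) q))))))"

lemma runs_if: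
  assumes c: "runs c N x T b" and pq: "runs (if b \<noteq> Atom then p else q) N x U z"
  shows "runs (if_cmd c p q N) (N + 2) x (T + U + 2 * tree_size x + tree_size b + 20) z"
  unfolding runs_def if_cmd_def
proof (intro conjI allI impI)
  have N: "0 < N" using assms by (simp add: runs_def)
  show "0 < N + 2" by simp
  fix s :: store
  assume s: "s 0 = x" "\<forall>i. 0 < i \<and> i < N + 2 \<longrightarrow> s i = Atom"
  have pq': "exec_le (Seq (Assign (N + 1) Nil_E) (if b \<noteq> Atom then p else q)) (s(N + 1 := b)) (U + 2) (s(0 := z))"
    apply (rule exec_le_seq [OF exec_le_assign [OF refl order.refl]])
    apply (rule exec_le_mono)
      apply (subgoal_tac "s(0 := z) = (s(N + 1 := b, N + 1 := eval_expr Nil_E (s(N + 1 := b))))(0 := z)")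
       apply (erule ssubst, rule runsD [OF pq])
        apply (use s N in \<open>auto simp: fun_eq_iff\<close>)
    done
  show "exec_le (Seq (Assign N (Var 0)) (Seq c (Seq (Assign (N + 1) (Var 0)) (Seq (Assign 0 (Var N))
     (Seq (Assign N Nil_E) (If (Var (N + 1)) (Seq (Assign (N + 1) Nil_E) p) (Seq (Assign (N + 1) Nil_E) q)))))))
     s (T + U + 2 * tree_size x + tree_size b + 20) (s(0 := z))"
    apply (rule exec_le_seq [OF exec_le_assign [OF refl order.refl]])
     apply (rule exec_le_seq [OF runsD [OF c]])
        apply (use s N in simp)
       apply (use s N in simp)
      apply (rule exec_le_seq [OF exec_le_assign [OF refl order.refl]])
       apply (rule exec_le_seq [OF exec_le_assign [OF refl order.refl]])
        apply (rule exec_le_seq [OF exec_le_assign [OF _ order.refl], where s' = "s(N + 1 := b)"])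
          apply (use s N in \<open>auto simp: fun_eq_iff\<close>)[1]
         apply (rule exec_le_if [OF _ order.refl, where T = "U + 2"])
         apply (use pq' in \<open>simp split: if_splits\<close>)
        apply (use s N in \<open>auto simp: fun_eq_iff\<close>)
    done
qed

text \<open>\<open>N\<close> holds the context \<open>x\<close>, \<open>N + 1\<close> the rest of
  the list and \<open>0\<close> the accumulator; in each round \<open>p\<close> is given all of
  context, accumulator and list head.\<close>

definition loop_cmd :: "cmd \<Rightarrow> nat \<Rightarrow> cmd" where
  "loop_cmd p N =
     While (Var (N + 1)) (Seq (Assign 0 (Cons_E (Var N) (Cons_E (Var 0) (Hd_E (Var (N + 1))))))
       (Seq p (Assign (N + 1) (Tl_E (Var (N + 1))))))"

definition fold_cmd :: "cmd \<Rightarrow> nat \<Rightarrow> cmd" where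
  "fold_cmd p N =
     Seq (Assign N (Hd_E (Var 0))) (Seq (Assign (N + 1) (Tl_E (Tl_E (Var 0))))
     (Seq (Assign 0 (Hd_E (Tl_E (Var 0)))) (Seq (loop_cmd p N) (Assign N Nil_E))))"

text \<open>Both \<open>p\<close> and the size bound are required only for accumulators that the
  fold reaches on a prefix, because the time of \<open>p\<close> depends on the accumulator and has
  no bound over all of them. A round costs \<open>T\<close> for \<open>p\<close> and about
  \<open>B\<close> for each of the two assignments.\<close>

lemma loop_cmd_exec:
  fixes ea :: "'a \<Rightarrow> tree" and eb :: "'b \<Rightarrow> tree"
  assumes N: "0 < N"
    and p: "\<And>zs y ws. ys = zs @ y # ws \<Longrightarrow>
      runs p N (Pair x (Pair (ea (foldl f a zs)) (eb y))) T (ea (f (foldl f a zs) y))"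
    and B: "\<And>zs ws. ys = zs @ ws \<Longrightarrow>
      tree_size x + tree_size (ea (foldl f a zs)) + tree_size (enc_list (map eb ys)) \<le> B"
    and s: "s 0 = ea a" "s N = x" "s (N + 1) = enc_list (map eb ys)"
      "\<And>i. 0 < i \<Longrightarrow> i < N \<Longrightarrow> s i = Atom"
  shows "exec_le (loop_cmd p N) s (1 + length ys * (T + 2 * B + 10))
    (s(0 := ea (foldl f a ys), N + 1 := Atom))"
  using p B s
proof (induction ys arbitrary: a s)
  case Nil
  have eq: "s(0 := ea (foldl f a []), N + 1 := Atom) = s" using Nil.prems by auto
  show ?case
    unfolding loop_cmd_def eq by (rule exec_le_while_false) (use Nil.prems in auto)
next
  case (Cons y ys)
  let ?s1 = "s(0 := Pair x (Pair (ea a) (eb y)))"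
  let ?s3 = "s(0 := ea (f a y), N + 1 := enc_list (map eb ys))"
  have IH: "exec_le (loop_cmd p N) ?s3 (1 + length ys * (T + 2 * B + 10))
    (?s3(0 := ea (foldl f (f a y) ys), N + 1 := Atom))"
  proof (rule Cons.IH)
    show "runs p N (Pair x (Pair (ea (foldl f (f a y) zs)) (eb y'))) T (ea (f (foldl f (f a y) zs) y'))"
      if "ys = zs @ y' # ws" for zs y' ws
      using Cons.prems(1) [of "y # zs" y' ws] that by simp
    show "tree_size x + tree_size (ea (foldl f (f a y) zs)) + tree_size (enc_list (map eb ys)) \<le> B"
      if "ys = zs @ ws" for zs ws
      using Cons.prems(2) [of "y # zs" ws] that by simp
  qed (use N Cons.prems in auto)
  have p1: "exec_le p ?s1 T (?s1(0 := ea (f a y)))"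
    by (rule runsD [OF Cons.prems(1) [of "[]" y ys, simplified]]) (use Cons.prems in auto)
  have B': "tree_size x + tree_size (ea a) + tree_size (enc_list (map eb (y # ys))) \<le> B"
    using Cons.prems(2) [of "[]"] by simp
  have body: "exec_le (Seq (Assign 0 (Cons_E (Var N) (Cons_E (Var 0) (Hd_E (Var (N + 1))))))
       (Seq p (Assign (N + 1) (Tl_E (Var (N + 1)))))) s (T + 2 * B + 9) ?s3"
    apply (rule exec_le_seq [OF exec_le_assign [OF _ order.refl], where s' = ?s1])
      apply (use Cons.prems N in simp)
     apply (rule exec_le_seq [OF p1])
      apply (rule exec_le_assign [OF _ order.refl])
      apply (use Cons.prems N B' in \<open>auto simp: fun_eq_iff\<close>)
    done
  have eq: "s(0 := ea (foldl f a (y # ys)), N + 1 := Atom) = ?s3(0 := ea (foldl f (f a y) ys), N + 1 := Atom)"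
    using N by (auto simp: fun_eq_iff)
  show ?case
    unfolding eq
    unfolding loop_cmd_def
    apply (rule exec_le_while_true [OF _ body IH [unfolded loop_cmd_def]])
    using Cons.prems by (auto simp: algebra_simps)
qed

lemma runs_fold:
  fixes ea :: "'a \<Rightarrow> tree" and eb :: "'b \<Rightarrow> tree"
  assumes N: "0 < N"
    and p: "\<And>zs y ws. ys = zs @ y # ws \<Longrightarrow>
      runs p N (Pair x (Pair (ea (foldl f a zs)) (eb y))) T (ea (f (foldl f a zs) y))"
    and B: "\<And>zs ws. ys = zs @ ws \<Longrightarrow>
      tree_size x + tree_size (ea (foldl f a zs)) + tree_size (enc_list (map eb ys)) \<le> B"
  shows "runs (fold_cmd p N) (N + 2) (Pair x (Pair (ea a) (enc_list (map eb ys))))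
    (4 * B + 20 + length ys * (T + 2 * B + 10)) (ea (foldl f a ys))"
  unfolding runs_def fold_cmd_def
proof (intro conjI allI impI)
  show "0 < N + 2" by simp
  fix s :: store
  assume s: "s 0 = Pair x (Pair (ea a) (enc_list (map eb ys)))" "\<forall>i. 0 < i \<and> i < N + 2 \<longrightarrow> s i = Atom"
  let ?s1 = "s(0 := ea a, N := x, N + 1 := enc_list (map eb ys))"
  have l: "exec_le (loop_cmd p N) ?s1 (1 + length ys * (T + 2 * B + 10))
    (?s1(0 := ea (foldl f a ys), N + 1 := Atom))"
    by (rule loop_cmd_exec [where ea = ea and eb = eb, OF N p B]) (use s N in auto)
  have B': "tree_size x + tree_size (ea a) + tree_size (enc_list (map eb ys)) \<le> B"
    using B [of "[]" ys] by simp
  show "exec_le (Seq (Assign N (Hd_E (Var 0))) (Seq (Assign (N + 1) (Tl_E (Tl_E (Var 0))))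
     (Seq (Assign 0 (Hd_E (Tl_E (Var 0)))) (Seq (loop_cmd p N) (Assign N Nil_E)))))
     s (4 * B + 20 + length ys * (T + 2 * B + 10)) (s(0 := ea (foldl f a ys)))"
    apply (rule exec_le_seq [OF exec_le_assign [OF refl order.refl]])
     apply (rule exec_le_seq [OF exec_le_assign [OF refl order.refl]])
      apply (rule exec_le_seq [OF exec_le_assign [OF _ order.refl], where s' = ?s1])
        apply (use s N in \<open>auto simp: fun_eq_iff\<close>)[1]
       apply (rule exec_le_seq [OF l exec_le_assign [OF _ order.refl] order.refl])
       apply (use s N B' in \<open>auto simp: fun_eq_iff\<close>)
    done
qed

subsection \<open>Arbitrary programs\<close>

fun expr_bound :: "expr \<Rightarrow> nat" where
  "expr_bound (Var x) = Suc x"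
| "expr_bound Nil_E = 0"
| "expr_bound (Cons_E e1 e2) = max (expr_bound e1) (expr_bound e2)"
| "expr_bound (Hd_E e) = expr_bound e"
| "expr_bound (Tl_E e) = expr_bound e"

fun cmd_bound :: "cmd \<Rightarrow> nat" where
  "cmd_bound (Assign x e) = max (Suc x) (expr_bound e)"
| "cmd_bound (Seq p q) = max (cmd_bound p) (cmd_bound q)"
| "cmd_bound (If e p q) = max (expr_bound e) (max (cmd_bound p) (cmd_bound q))"
| "cmd_bound (While e p) = max (expr_bound e) (cmd_bound p)"

lemma eval_expr_cong:
  "expr_bound e \<le> N \<Longrightarrow> (\<And>i. i < N \<Longrightarrow> s i = r i) \<Longrightarrow> eval_expr e s = eval_expr e r"
  by (induction e) auto

text \<open>A run neither sees nor changes variables that the program does not mention. This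
  transfers a run from the all-\<open>Atom\<close> initial store, the only one that
  \<open>computes_in\<close> describes, to stores that carry a caller's data.\<close>

lemma exec_frame:
  assumes "exec p s t s'" "cmd_bound p \<le> N" "\<And>i. i < N \<Longrightarrow> s i = r i"
  shows "exec p r t (\<lambda>i. if i < N then s' i else r i)"
  using assms
proof (induction arbitrary: r rule: exec.induct)
  case (assign x e s)
  have e: "eval_expr e s = eval_expr e r"
    using assign by (intro eval_expr_cong [of e N]) auto
  have "(\<lambda>i. if i < N then (s(x := eval_expr e s)) i else r i) = r(x := eval_expr e r)"
    using assign e by (auto simp: fun_eq_iff)
  then show ?case using exec.assign [of x e r] e by simp
next
  case (seq p s t s' q u s'')
  let ?r' = "\<lambda>i. if i < N then s' i else r i"
  have "exec q ?r' u (\<lambda>i. if i < N then s'' i else ?r' i)"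
    using seq by (intro seq.IH) auto
  moreover have "(\<lambda>i. if i < N then s'' i else ?r' i) = (\<lambda>i. if i < N then s'' i else r i)" by auto
  ultimately show ?case
    using seq.IH(1) [of r] seq.prems exec.seq by simp
next
  case (if_true e s p t s' q)
  have "eval_expr e s = eval_expr e r"
    using if_true by (intro eval_expr_cong [of e N]) auto
  then show ?case using if_true exec.if_true by simp
next
  case (if_false e s q t s' p)
  have "eval_expr e s = eval_expr e r"
    using if_false by (intro eval_expr_cong [of e N]) auto
  then show ?case using if_false exec.if_false by simp
next
  case (while_false e s p)
  have "eval_expr e s = eval_expr e r"
    using while_false by (intro eval_expr_cong [of e N]) auto
  moreover have "(\<lambda>i. if i < N then s i else r i) = r" using while_false by auto
  ultimately show ?case using while_false exec.while_false by simp
next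
  case (while_true e s p t s' u s'')
  have e: "eval_expr e s = eval_expr e r"
    using while_true by (intro eval_expr_cong [of e N]) auto
  let ?r' = "\<lambda>i. if i < N then s' i else r i"
  have "exec (While e p) ?r' u (\<lambda>i. if i < N then s'' i else ?r' i)"
    using while_true by (intro while_true.IH) auto
  moreover have "(\<lambda>i. if i < N then s'' i else ?r' i) = (\<lambda>i. if i < N then s'' i else r i)" by auto
  ultimately show ?case
    using while_true.IH(1) [of r] while_true.prems while_true.hyps e exec.while_true by simp
qed

lemma tree_size_exec: "exec p s t s' \<Longrightarrow> tree_size (s' i) \<le> tree_size (s i) + t"
proof (induction rule: exec.induct)
  case (seq p s t s' q u s'') then show ?case by linarith
next
  case (while_true e s p t s' u s'') then show ?case by linarith
qed auto

text \<open>Variable \<open>0\<close> keeps the output, so the base case has to do nothing; a loop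
  that is never entered stands in for the missing skip command.\<close>

fun clear_cmd :: "nat \<Rightarrow> cmd" where
  "clear_cmd 0 = While Nil_E (Assign 0 Nil_E)"
| "clear_cmd (Suc n) = Seq (Assign (Suc n) Nil_E) (clear_cmd n)"

lemma clear_cmd_exec:
  "exec_le (clear_cmd n) s (2 * n + 1) (\<lambda>i. if 0 < i \<and> i \<le> n then Atom else s i)"
proof (induction n arbitrary: s)
  case 0
  have "(\<lambda>i. if 0 < i \<and> i \<le> 0 then Atom else s i) = s" by auto
  then show ?case using exec_le_while_false [of Nil_E s] by simp
next
  case (Suc n)
  have eq: "(\<lambda>i. if 0 < i \<and> i \<le> Suc n then Atom else s i) =
    (\<lambda>i. if 0 < i \<and> i \<le> n then Atom else (s(Suc n := Atom)) i)" by (auto simp: fun_eq_iff)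
  have 1: "exec_le (Assign (Suc n) Nil_E) s 2 (s(Suc n := Atom))"
    by (rule exec_le_assign) auto
  show ?case
    unfolding eq clear_cmd.simps by (rule exec_le_seq [OF 1 Suc.IH]) simp
qed

text \<open>Makes a given program self-cleaning: all variables that it can mention are wiped at the
  end. The surcharge \<open>K\<close> depends on the program only.\<close>

lemma computes_in_runs:
  obtains q N K where "\<And>x t y. computes_in p x t y \<Longrightarrow> runs q N x (t + K) y"
proof
  fix x t y
  let ?N = "Suc (cmd_bound p)"
  assume "computes_in p x t y"
  then obtain s' where s': "exec p ((\<lambda>_. Atom)(0 := x)) t s'" "s' 0 = y"
    unfolding computes_in_def by blast
  show "runs (Seq p (clear_cmd (cmd_bound p))) ?N x (t + (2 * cmd_bound p + 1)) y"
    unfolding runs_def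
  proof (intro conjI allI impI)
    fix s :: store
    assume s: "s 0 = x" "\<forall>i. 0 < i \<and> i < ?N \<longrightarrow> s i = Atom"
    have "exec p s t (\<lambda>i. if i < ?N then s' i else s i)"
      by (rule exec_frame [OF s'(1)]) (use s in auto)
    then have 1: "exec_le p s t (\<lambda>i. if i < ?N then s' i else s i)"
      unfolding exec_le_def by blast
    have eq: "s(0 := y) = (\<lambda>i. if 0 < i \<and> i \<le> cmd_bound p then Atom
        else (\<lambda>i. if i < ?N then s' i else s i) i)"
      using s s' by (auto simp: fun_eq_iff)
    show "exec_le (Seq p (clear_cmd (cmd_bound p))) s (t + (2 * cmd_bound p + 1)) (s(0 := y))"
      unfolding eq by (rule exec_le_seq [OF 1 clear_cmd_exec order.refl])
  qed simp
qed

lemma runs_computes_in: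
  assumes "runs p N x T y"
  shows "\<exists>t\<le>T. computes_in p x t y"
proof -
  have "exec_le p ((\<lambda>_. Atom)(0 := x)) T (((\<lambda>_. Atom)(0 := x))(0 := y))"
    by (rule runsD [OF assms]) auto
  then show ?thesis unfolding exec_le_def computes_in_def by fastforce
qed

text \<open>Assignments are charged with the size of the stored value, so no variable can outgrow
  the input by more than the time spent. Polynomial time thereby yields polynomial output
  size.\<close>

lemma runs_size: "runs p N x T y \<Longrightarrow> tree_size y \<le> tree_size x + T"
  using runs_computes_in [of p N x T y] tree_size_exec [where i = 0]
  unfolding computes_in_def by (metis (mono_tags, lifting) add_left_mono fun_upd_same le_trans)

section \<open>Polynomial-time functions on encoded data\<close>

text \<open>The base \<open>n + 2\<close> is at least 2 even for \<open>n = 0\<close>, so constants,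
  coefficients and sums can all be absorbed by the exponent.\<close>

definition poly_bounded :: "(nat \<Rightarrow> nat) \<Rightarrow> bool" where
  "poly_bounded P \<longleftrightarrow> (\<exists>c. \<forall>n. P n \<le> (n + 2) ^ c)"

named_theorems poly_bounded_intros

lemma poly_boundedE:
  assumes "poly_bounded P"
  obtains c where "\<And>n. P n \<le> (n + 2) ^ c"
  using assms unfolding poly_bounded_def by blast

lemma poly_bounded_id [poly_bounded_intros]: "poly_bounded (\<lambda>n. n)"
  unfolding poly_bounded_def by (intro exI [of _ 1]) auto

lemma poly_bounded_const [poly_bounded_intros]: "poly_bounded (\<lambda>_. k)"
  unfolding poly_bounded_def
proof (intro exI allI)
  fix n :: nat
  have "k \<le> 2 ^ k" by (simp add: less_imp_le)
  also have "\<dots> \<le> (n + 2) ^ k" by (simp add: power_mono)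
  finally show "k \<le> (n + 2) ^ k" .
qed

lemma poly_bounded_add [poly_bounded_intros]:
  assumes "poly_bounded P" "poly_bounded Q"
  shows "poly_bounded (\<lambda>n. P n + Q n)"
proof -
  obtain a b where a: "\<And>n. P n \<le> (n + 2) ^ a" and b: "\<And>n. Q n \<le> (n + 2) ^ b"
    using poly_boundedE [OF assms(1)] poly_boundedE [OF assms(2)] by metis
  show ?thesis
    unfolding poly_bounded_def
  proof (intro exI allI)
    fix n
    have "P n + Q n \<le> (n + 2) ^ max a b + (n + 2) ^ max a b"
      using a [of n] b [of n] power_increasing [of a "max a b" "n + 2"]
        power_increasing [of b "max a b" "n + 2"] by linarith
    also have "\<dots> \<le> (n + 2) ^ Suc (max a b)" by simp
    finally show "P n + Q n \<le> (n + 2) ^ Suc (max a b)" .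
  qed
qed

lemma poly_bounded_mult [poly_bounded_intros]:
  assumes "poly_bounded P" "poly_bounded Q"
  shows "poly_bounded (\<lambda>n. P n * Q n)"
proof -
  obtain a b where "\<And>n. P n \<le> (n + 2) ^ a" and "\<And>n. Q n \<le> (n + 2) ^ b"
    using poly_boundedE [OF assms(1)] poly_boundedE [OF assms(2)] by metis
  then show ?thesis
    unfolding poly_bounded_def by (intro exI [of _ "a + b"]) (simp add: power_add mult_mono)
qed

lemma poly_bounded_power [poly_bounded_intros]: "poly_bounded P \<Longrightarrow> poly_bounded (\<lambda>n. P n ^ c)"
  by (induction c) (auto intro: poly_bounded_intros)

lemma poly_bounded_Suc [poly_bounded_intros]: "poly_bounded P \<Longrightarrow> poly_bounded (\<lambda>n. Suc (P n))"
  using poly_bounded_add [of P "\<lambda>_. 1"] by (simp add: poly_bounded_const)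

text \<open>No law is imposed, and different types may share codes. A number is the list of as many
  \<open>Atom\<close>s and a nonempty list is the pair of its head and tail, so such conversions
  cost nothing; \<open>polytime_recast\<close> exploits this.\<close>

class enc =
  fixes enc :: "'a \<Rightarrow> tree"

instantiation tree :: enc begin
definition [simp]: "enc (t :: tree) = t"
instance ..
end

instantiation bool :: enc begin
definition "enc b = (if b then Pair Atom Atom else Atom)"
instance ..
end

instantiation nat :: enc begin
definition [simp]: "enc n = enc_unary n"
instance ..
end

instantiation prod :: (enc, enc) enc begin
definition [simp]: "enc p = Pair (enc (fst p)) (enc (snd p))"
instance ..
end

instantiation list :: (enc) enc begin
definition [simp]: "enc xs = enc_list (map enc xs)"
instance ..
end

instantiation gate :: enc begin
definition [simp]: "enc g = enc_gate g"
instance ..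
end

abbreviation enc_size :: "'a::enc \<Rightarrow> nat" where
  "enc_size a \<equiv> tree_size (enc a)"

definition polytime :: "('a::enc \<Rightarrow> 'b::enc) \<Rightarrow> bool" where
  "polytime f \<longleftrightarrow> (\<exists>p N c. \<forall>a. runs p N (enc a) ((enc_size a + 2) ^ c) (enc (f a)))"

lemma polytime_I:
  assumes "poly_bounded P" "\<And>a. runs p N (enc a) (P (enc_size a)) (enc (f a))"
  shows "polytime f"
proof -
  obtain c where "\<And>n. P n \<le> (n + 2) ^ c" by (rule poly_boundedE [OF assms(1)]) (rule that)
  then show ?thesis unfolding polytime_def using runs_mono [OF assms(2)] by blast
qed

lemma polytime_E:
  assumes "polytime f"
  obtains p N c where "\<And>a M. N \<le> M \<Longrightarrow> runs p M (enc a) ((enc_size a + 2) ^ c) (enc (f a))"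
  using assms unfolding polytime_def using runs_mono by blast

lemma polytime_size:
  assumes "polytime f"
  obtains c where "\<And>a. enc_size (f a) \<le> (enc_size a + 2) ^ c"
proof -
  obtain p N c where p: "\<And>a M. N \<le> M \<Longrightarrow> runs p M (enc a) ((enc_size a + 2) ^ c) (enc (f a))"
    by (rule polytime_E [OF assms]) (rule that)
  have "poly_bounded (\<lambda>n. n + (n + 2) ^ c)" by (intro poly_bounded_intros)
  then obtain b where b: "\<And>n :: nat. n + (n + 2) ^ c \<le> (n + 2) ^ b" by (rule poly_boundedE) (rule that)
  show thesis
  proof
    fix a
    show "enc_size (f a) \<le> (enc_size a + 2) ^ b"
      using runs_size [OF p [OF order.refl, of a]] b [of "enc_size a"] by linarith
  qed
qed

lemma polytime_comp:
  assumes "polytime f" "polytime g"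
  shows "polytime (\<lambda>x. g (f x))"
proof -
  obtain p N c where p: "\<And>a M. N \<le> M \<Longrightarrow> runs p M (enc a) ((enc_size a + 2) ^ c) (enc (f a))"
    by (rule polytime_E [OF assms(1)]) (rule that)
  obtain q M d where q: "\<And>a K. M \<le> K \<Longrightarrow> runs q K (enc a) ((enc_size a + 2) ^ d) (enc (g a))"
    by (rule polytime_E [OF assms(2)]) (rule that)
  obtain e where e: "\<And>a. enc_size (f a) \<le> (enc_size a + 2) ^ e"
    by (rule polytime_size [OF assms(1)]) (rule that)
  show ?thesis
  proof (rule polytime_I)
    show "poly_bounded (\<lambda>n. (n + 2) ^ c + ((n + 2) ^ e + 2) ^ d)" by (intro poly_bounded_intros)
    show "runs (Seq p q) (max N M) (enc a) ((enc_size a + 2) ^ c + ((enc_size a + 2) ^ e + 2) ^ d) (enc (g (f a)))" for a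
      by (rule runs_seq [OF p runs_mono [OF q [of "max N M" "f a"]]]) (use e [of a] in \<open>auto intro!: power_mono\<close>)
  qed
qed

lemma polytime_expr:
  assumes "\<And>a s. s 0 = enc a \<Longrightarrow> eval_expr e s = enc (f a)"
    and "\<And>a. enc_size (f a) \<le> enc_size a + k"
  shows "polytime f"
proof (rule polytime_I)
  show "poly_bounded (\<lambda>n. 1 + (n + k))" by (intro poly_bounded_intros)
  show "runs (Assign 0 e) 1 (enc a) (1 + (enc_size a + k)) (enc (f a))" for a
    by (rule runs_mono [OF runs_expr [OF assms(1)]]) (use assms(2) in auto)
qed

lemma polytime_cast: "(\<And>a. enc (f a) = enc a) \<Longrightarrow> polytime f"
  by (rule polytime_expr [of "Var 0" _ 0]) auto

lemma polytime_recast: "polytime f \<Longrightarrow> (\<And>a. enc (g a) = enc (f a)) \<Longrightarrow> polytime g"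
  unfolding polytime_def by simp

fun const_expr :: "tree \<Rightarrow> expr" where
  "const_expr Atom = Nil_E"
| "const_expr (Pair a b) = Cons_E (const_expr a) (const_expr b)"

lemma eval_const_expr [simp]: "eval_expr (const_expr t) s = t"
  by (induction t) auto

named_theorems polytime_intros

lemma polytime_const [polytime_intros]: "polytime (\<lambda>_. c)"
  by (rule polytime_expr [of "const_expr (enc c)" _ "enc_size c"]) auto

lemma polytime_id [polytime_intros]: "polytime (\<lambda>x. x)"
  by (rule polytime_cast) simp

lemma polytime_fst [polytime_intros]: "polytime f \<Longrightarrow> polytime (\<lambda>x. fst (f x))"
  by (rule polytime_comp [of f], assumption, rule polytime_expr [of "Hd_E (Var 0)" _ 0]) auto

lemma polytime_snd [polytime_intros]: "polytime f \<Longrightarrow> polytime (\<lambda>x. snd (f x))"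
  by (rule polytime_comp [of f], assumption, rule polytime_expr [of "Tl_E (Var 0)" _ 0]) auto

lemma polytime_pair [polytime_intros]:
  assumes "polytime f" "polytime g"
  shows "polytime (\<lambda>x. (f x, g x))"
proof -
  obtain p N c where p: "\<And>a M. N \<le> M \<Longrightarrow> runs p M (enc a) ((enc_size a + 2) ^ c) (enc (f a))"
    by (rule polytime_E [OF assms(1)]) (rule that)
  obtain q M d where q: "\<And>a K. M \<le> K \<Longrightarrow> runs q K (enc a) ((enc_size a + 2) ^ d) (enc (g a))"
    by (rule polytime_E [OF assms(2)]) (rule that)
  obtain e where e: "\<And>a. enc_size (f a) \<le> (enc_size a + 2) ^ e"
    by (rule polytime_size [OF assms(1)]) (rule that)
  obtain e' where e': "\<And>a. enc_size (g a) \<le> (enc_size a + 2) ^ e'"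
    by (rule polytime_size [OF assms(2)]) (rule that)
  show ?thesis
  proof (rule polytime_I)
    show "poly_bounded (\<lambda>n. (n + 2) ^ c + (n + 2) ^ d + 2 * n + 2 * (n + 2) ^ e + (n + 2) ^ e' + 20)"
      by (intro poly_bounded_intros)
    show "runs (pair_cmd p q (max N M)) (max N M + 2) (enc a)
      ((enc_size a + 2) ^ c + (enc_size a + 2) ^ d + 2 * enc_size a + 2 * (enc_size a + 2) ^ e
        + (enc_size a + 2) ^ e' + 20) (enc (f a, g a))" for a
      unfolding enc_prod_def fst_conv snd_conv
      by (rule runs_mono [OF runs_pair [OF p [of "max N M"] q [of "max N M"]]])
        (use e [of a] e' [of a] in auto)
  qed
qed

lemma polytime_comp2: "polytime (\<lambda>z. h (fst z) (snd z)) \<Longrightarrow> polytime a \<Longrightarrow> polytime b \<Longrightarrow> polytime (\<lambda>x. h (a x) (b x))"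
  using polytime_comp [OF polytime_pair [of a b], of "\<lambda>z. h (fst z) (snd z)"] by simp

text \<open>Stated on codes: the test value may have any type and counts as true unless its code is
  \<open>Atom\<close>. Besides conditionals this yields the tests for empty lists and for
  \<open>Atom\<close>.\<close>

lemma polytime_branch:
  assumes "polytime c" "polytime f" "polytime g"
    and t: "\<And>x. b x \<Longrightarrow> enc (c x) \<noteq> Atom \<and> enc (h x) = enc (f x)"
    and f: "\<And>x. \<not> b x \<Longrightarrow> enc (c x) = Atom \<and> enc (h x) = enc (g x)"
  shows "polytime h"
proof -
  obtain r L e where r: "\<And>a M. L \<le> M \<Longrightarrow> runs r M (enc a) ((enc_size a + 2) ^ e) (enc (c a))"
    by (rule polytime_E [OF assms(1)]) (rule that)
  obtain p N k where p: "\<And>a M. N \<le> M \<Longrightarrow> runs p M (enc a) ((enc_size a + 2) ^ k) (enc (f a))"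
    by (rule polytime_E [OF assms(2)]) (rule that)
  obtain q M d where q: "\<And>a K. M \<le> K \<Longrightarrow> runs q K (enc a) ((enc_size a + 2) ^ d) (enc (g a))"
    by (rule polytime_E [OF assms(3)]) (rule that)
  obtain e' where e': "\<And>a. enc_size (c a) \<le> (enc_size a + 2) ^ e'"
    by (rule polytime_size [OF assms(1)]) (rule that)
  let ?N = "max L (max N M)"
  show ?thesis
  proof (rule polytime_I)
    show "poly_bounded (\<lambda>n. (n + 2) ^ e + ((n + 2) ^ k + (n + 2) ^ d) + 2 * n + (n + 2) ^ e' + 20)"
      by (intro poly_bounded_intros)
    fix a
    have "runs (if enc (c a) \<noteq> Atom then p else q) ?N (enc a)
        ((enc_size a + 2) ^ k + (enc_size a + 2) ^ d) (enc (h a))"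
    proof (cases "b a")
      case True
      then show ?thesis using t [of a] runs_mono [OF p [of ?N a], of ?N "(enc_size a + 2) ^ k + (enc_size a + 2) ^ d"] by simp
    next
      case False
      then show ?thesis using f [of a] runs_mono [OF q [of ?N a], of ?N "(enc_size a + 2) ^ k + (enc_size a + 2) ^ d"] by simp
    qed
    from runs_if [OF r this]
    show "runs (if_cmd r p q ?N) (?N + 2) (enc a) ((enc_size a + 2) ^ e
        + ((enc_size a + 2) ^ k + (enc_size a + 2) ^ d) + 2 * enc_size a + (enc_size a + 2) ^ e' + 20)
        (enc (h a))"
      by (rule runs_mono) (use e' [of a] in auto)
  qed
qed

lemma polytime_if [polytime_intros]: "polytime b \<Longrightarrow> polytime f \<Longrightarrow> polytime g \<Longrightarrow> polytime (\<lambda>x. if b x then f x else g x)"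
  by (rule polytime_branch [of b f g b]) (auto simp: enc_bool_def)

lemma polytime_not [polytime_intros]: "polytime b \<Longrightarrow> polytime (\<lambda>x. \<not> b x)"
  by (rule polytime_recast [of "\<lambda>x. if b x then False else True"], (intro polytime_intros; assumption), simp)

lemma polytime_conj [polytime_intros]: "polytime b \<Longrightarrow> polytime c \<Longrightarrow> polytime (\<lambda>x. b x \<and> c x)"
  by (rule polytime_recast [of "\<lambda>x. if b x then c x else False"], (intro polytime_intros; assumption), simp)

lemma polytime_disj [polytime_intros]: "polytime b \<Longrightarrow> polytime c \<Longrightarrow> polytime (\<lambda>x. b x \<or> c x)"
  by (rule polytime_recast [of "\<lambda>x. if b x then True else c x"], (intro polytime_intros; assumption), simp)

lemma polytime_imp [polytime_intros]: "polytime b \<Longrightarrow> polytime c \<Longrightarrow> polytime (\<lambda>x. b x \<longrightarrow> c x)"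
  by (rule polytime_recast [of "\<lambda>x. if b x then c x else True"], (intro polytime_intros; assumption), simp)

lemma polytime_bool_eq [polytime_intros]: "polytime b \<Longrightarrow> polytime c \<Longrightarrow> polytime (\<lambda>x. b x \<longleftrightarrow> c x)"
  by (rule polytime_recast [of "\<lambda>x. if b x then c x else \<not> c x"], (intro polytime_intros; assumption), simp)

lemma polytime_prod_eq [polytime_intros]:
  "polytime (\<lambda>x. fst (a x) = fst (b x)) \<Longrightarrow> polytime (\<lambda>x. snd (a x) = snd (b x)) \<Longrightarrow> polytime (\<lambda>x. a x = b x)"
  unfolding prod_eq_iff by (intro polytime_intros)

lemma enc_list_eq_Atom [simp]: "enc_list xs = Atom \<longleftrightarrow> xs = []"
  by (cases xs) auto

lemma polytime_null [polytime_intros]: "polytime L \<Longrightarrow> polytime (\<lambda>x. L x = [])"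
  by (rule polytime_branch [of L "\<lambda>_. False" "\<lambda>_. True" "\<lambda>x. L x \<noteq> []"])
    (auto intro: polytime_const)

lemma polytime_not_atom [polytime_intros]: "polytime f \<Longrightarrow> polytime (\<lambda>x. f x \<noteq> Atom)"
  by (rule polytime_branch [of f "\<lambda>_. True" "\<lambda>_. False" "\<lambda>x. f x \<noteq> Atom"]) (auto intro: polytime_intros)

lemma polytime_atom [polytime_intros]: "polytime f \<Longrightarrow> polytime (\<lambda>x. f x = Atom)"
  using polytime_not [OF polytime_not_atom [of f]] by simp

lemma polytime_Pair [polytime_intros]: "polytime f \<Longrightarrow> polytime g \<Longrightarrow> polytime (\<lambda>x. Pair (f x) (g x))"
  by (rule polytime_recast [of "\<lambda>x. (f x, g x)"]) (auto intro: polytime_intros)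

lemma polytime_hd_tree [polytime_intros]: "polytime f \<Longrightarrow> polytime (\<lambda>x. hd_tree (f x))"
  by (rule polytime_comp [of f], assumption, rule polytime_expr [of "Hd_E (Var 0)" _ 0]) (auto simp: tree_size_hd_tl)

lemma polytime_tl_tree [polytime_intros]: "polytime f \<Longrightarrow> polytime (\<lambda>x. tl_tree (f x))"
  by (rule polytime_comp [of f], assumption, rule polytime_expr [of "Tl_E (Var 0)" _ 0]) (auto simp: tree_size_hd_tl)

lemma polytime_Cons [polytime_intros]: "polytime f \<Longrightarrow> polytime g \<Longrightarrow> polytime (\<lambda>x. f x # g x)"
  by (rule polytime_recast [of "\<lambda>x. (f x, g x)"]) (auto intro: polytime_intros)

lemma tl_tree_enc_list: "tl_tree (enc_list xs) = enc_list (tl xs)"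
  by (cases xs) auto

lemma polytime_tl [polytime_intros]: "polytime f \<Longrightarrow> polytime (\<lambda>x. tl (f x))"
  by (rule polytime_comp [of f], assumption, rule polytime_expr [of "Tl_E (Var 0)" _ 0])
    (auto simp: tl_tree_enc_list map_tl simp flip: tl_tree_enc_list intro: tree_size_hd_tl)

text \<open>For \<open>L x = y # ys\<close> the values \<open>(x, L x)\<close> and
  \<open>(x, y, ys)\<close> have the same code, so the branch for nonempty lists can be run directly
  on \<open>(x, L x)\<close>.\<close>

lemma polytime_case_list [polytime_intros]:
  fixes L :: "'a::enc \<Rightarrow> 'b::enc list"
  assumes "polytime L" "polytime d" "polytime (\<lambda>z. g (fst z) (fst (snd z)) (snd (snd z)))"
  shows "polytime (\<lambda>x. case L x of [] \<Rightarrow> d x | y # ys \<Rightarrow> g x y ys)"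
proof -
  let ?g = "\<lambda>z. g (fst z) (fst (snd z)) (snd (snd z))"
  obtain r K e where r: "\<And>a M. K \<le> M \<Longrightarrow> runs r M (enc a) ((enc_size a + 2) ^ e) (enc (L a))"
    by (rule polytime_E [OF assms(1)]) (rule that)
  obtain p N k where p: "\<And>a M. N \<le> M \<Longrightarrow> runs p M (enc a) ((enc_size a + 2) ^ k) (enc (d a))"
    by (rule polytime_E [OF assms(2)]) (rule that)
  obtain e' where e': "\<And>a. enc_size (L a) \<le> (enc_size a + 2) ^ e'"
    by (rule polytime_size [OF assms(1)]) (rule that)
  have "polytime (\<lambda>x. (x, L x))" using assms(1) by (intro polytime_intros)
  then obtain s J l where s: "\<And>a M. J \<le> M \<Longrightarrow> runs s M (enc a) ((enc_size a + 2) ^ l) (enc (a, L a))"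
    by (rule polytime_E) (rule that)
  obtain q M m where q: "\<And>a K. M \<le> K \<Longrightarrow> runs q K (enc a) ((enc_size a + 2) ^ m) (enc (?g a))"
    by (rule polytime_E [OF assms(3)]) (rule that)
  let ?N = "max K (max N (max J M))"
  show ?thesis
  proof (rule polytime_I)
    show "poly_bounded (\<lambda>n. (n + 2) ^ e + ((n + 2) ^ k + ((n + 2) ^ l + (n + (n + 2) ^ e' + 3) ^ m))
        + 2 * n + (n + 2) ^ e' + 20)"
      by (intro poly_bounded_intros)
    fix a :: 'a
    let ?n = "enc_size a"
    have "runs (if enc (L a) \<noteq> Atom then Seq s q else p) ?N (enc a)
        ((?n + 2) ^ k + ((?n + 2) ^ l + (?n + (?n + 2) ^ e' + 3) ^ m))
        (enc (case L a of [] \<Rightarrow> d a | y # ys \<Rightarrow> g a y ys))"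
    proof (cases "L a")
      case Nil
      then show ?thesis
        using runs_mono [OF p [of ?N a], of ?N "(?n + 2) ^ k + ((?n + 2) ^ l + (?n + (?n + 2) ^ e' + 3) ^ m)"]
        by simp
    next
      case (Cons y ys)
      have "runs q ?N (enc (a, L a)) ((?n + (?n + 2) ^ e' + 3) ^ m) (enc (g a y ys))"
        using runs_mono [OF q [of ?N "(a, y, ys)"], of ?N "(?n + (?n + 2) ^ e' + 3) ^ m"] e' [of a]
        by (simp add: Cons power_mono)
      then have "runs (Seq s q) ?N (enc a) ((?n + 2) ^ l + (?n + (?n + 2) ^ e' + 3) ^ m) (enc (g a y ys))"
        by (intro runs_seq [OF s]) auto
      then show ?thesis
        using Cons runs_mono [OF _ order.refl, of "Seq s q" ?N "enc a" _ _
          "(?n + 2) ^ k + ((?n + 2) ^ l + (?n + (?n + 2) ^ e' + 3) ^ m)"] by simp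
    qed
    from runs_if [OF r this]
    show "runs (if_cmd r (Seq s q) p ?N) (?N + 2) (enc a) ((?n + 2) ^ e
        + ((?n + 2) ^ k + ((?n + 2) ^ l + (?n + (?n + 2) ^ e' + 3) ^ m))
        + 2 * ?n + (?n + 2) ^ e' + 20) (enc (case L a of [] \<Rightarrow> d a | y # ys \<Rightarrow> g a y ys))"
      by (rule runs_mono) (use e' [of a] in auto)
  qed
qed

section \<open>Folds and the list functions obtained from them\<close>

lemma tree_size_enc_list_append:
  "tree_size (enc_list (xs @ ys)) + 1 = tree_size (enc_list xs) + tree_size (enc_list ys)"
  by (induction xs) auto

lemma length_le_tree_size: "length xs < tree_size (enc_list xs)"
  by (induction xs) (auto simp: add.commute intro: less_trans)

text \<open>A polynomial-time step alone is not enough, since iterating it may produce exponentially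
  large accumulators. With a polynomial bound on every intermediate accumulator, each round is
  polynomial in the input.\<close>

lemma polytime_foldl_bounded:
  fixes s :: "'a::enc \<Rightarrow> 'b::enc \<Rightarrow> 'c::enc \<Rightarrow> 'b"
  assumes "polytime i" "polytime L" "polytime (\<lambda>z. s (fst z) (fst (snd z)) (snd (snd z)))"
    and B: "poly_bounded B"
      "\<And>x ys zs. L x = ys @ zs \<Longrightarrow> enc_size (foldl (s x) (i x) ys) \<le> B (enc_size x)"
  shows "polytime (\<lambda>x. foldl (s x) (i x) (L x))"
proof -
  let ?s = "\<lambda>z. s (fst z) (fst (snd z)) (snd (snd z))"
  have "polytime (\<lambda>x. (x, i x, L x))" using assms(1,2) by (intro polytime_intros)
  then obtain p N c where p: "\<And>a M. N \<le> M \<Longrightarrow> runs p M (enc a) ((enc_size a + 2) ^ c) (enc (a, i a, L a))"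
    by (rule polytime_E) (rule that)
  obtain q M d where q: "\<And>a K. M \<le> K \<Longrightarrow> runs q K (enc a) ((enc_size a + 2) ^ d) (enc (?s a))"
    by (rule polytime_E [OF assms(3)]) (rule that)
  obtain e where e: "\<And>a. enc_size (L a) \<le> (enc_size a + 2) ^ e"
    by (rule polytime_size [OF assms(2)]) (rule that)
  let ?N = "max N M"
  let ?T = "\<lambda>n. (n + B n + (n + 2) ^ e + 4) ^ d"
  let ?B = "\<lambda>n. n + B n + (n + 2) ^ e"
  show ?thesis
  proof (rule polytime_I)
    show "poly_bounded (\<lambda>n. (n + 2) ^ c + (4 * ?B n + 20 + (n + 2) ^ e * (?T n + 2 * ?B n + 10)))"
      using B(1) by (intro poly_bounded_intros)
    fix x :: 'a
    let ?n = "enc_size x"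
    have q': "runs q ?N (Pair (enc x) (Pair (enc (foldl (s x) (i x) zs)) (enc y))) (?T ?n)
        (enc (s x (foldl (s x) (i x) zs) y))" if "L x = zs @ y # ws" for zs y ws
    proof -
      have "tree_size (enc y) \<le> enc_size (L x)"
        using tree_size_enc_list_append [of "map enc zs" "map enc (y # ws)"] that
        by (auto simp: Suc_le_eq)
      then have "enc_size (x, foldl (s x) (i x) zs, y) + 2 \<le> ?n + B ?n + (?n + 2) ^ e + 4"
        using B(2) [OF that] e [of x] by simp
      then show ?thesis
        using runs_mono [OF q [of ?N "(x, foldl (s x) (i x) zs, y)"], of ?N "?T ?n"]
        by (simp add: power_mono)
    qed
    have 0: "0 < ?N" using p [of "?N" x] by (auto simp: runs_def)
    have "runs (fold_cmd q ?N) (?N + 2) (Pair (enc x) (Pair (enc (i x)) (enc_list (map enc (L x)))))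
      (4 * ?B ?n + 20 + length (L x) * (?T ?n + 2 * ?B ?n + 10)) (enc (foldl (s x) (i x) (L x)))"
    proof (rule runs_fold [where ea = enc and eb = enc, OF 0 q'])
      show "tree_size (enc x) + enc_size (foldl (s x) (i x) zs) + tree_size (enc_list (map enc (L x))) \<le> ?B ?n"
        if "L x = zs @ ws" for zs ws
        using B(2) [OF that] e [of x] by simp
    qed
    moreover have "length (L x) \<le> (?n + 2) ^ e"
      using length_le_tree_size [of "map enc (L x)"] e [of x] by simp
    ultimately have "runs (fold_cmd q ?N) (?N + 2) (enc (x, i x, L x))
      (4 * ?B ?n + 20 + (?n + 2) ^ e * (?T ?n + 2 * ?B ?n + 10)) (enc (foldl (s x) (i x) (L x)))"
      by (auto elim!: runs_mono)
    from runs_seq [OF p [of "?N + 2" x] this]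
    show "runs (Seq p (fold_cmd q ?N)) (?N + 2) (enc x)
      ((?n + 2) ^ c + (4 * ?B ?n + 20 + (?n + 2) ^ e * (?T ?n + 2 * ?B ?n + 10))) (enc (foldl (s x) (i x) (L x)))"
      by simp
  qed
qed

text \<open>The growth allowance \<open>G\<close> does not see the accumulator, so the growth of the
  rounds adds up, to at most the list length times a polynomial.\<close>

lemma polytime_foldl:
  fixes s :: "'a::enc \<Rightarrow> 'b::enc \<Rightarrow> 'c::enc \<Rightarrow> 'b"
  assumes "polytime i" "polytime L" "polytime (\<lambda>z. s (fst z) (fst (snd z)) (snd (snd z)))"
    and G: "\<And>x a y. enc_size (s x a y) \<le> enc_size a + G (enc_size x + enc_size y)"
    and pG: "poly_bounded G"
  shows "polytime (\<lambda>x. foldl (s x) (i x) (L x))"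
proof -
  obtain g where g: "\<And>n. G n \<le> (n + 2) ^ g" by (rule poly_boundedE [OF pG]) (rule that)
  obtain c where c: "\<And>a. enc_size (i a) \<le> (enc_size a + 2) ^ c"
    by (rule polytime_size [OF assms(1)]) (rule that)
  obtain e where e: "\<And>a. enc_size (L a) \<le> (enc_size a + 2) ^ e"
    by (rule polytime_size [OF assms(2)]) (rule that)
  show ?thesis
  proof (rule polytime_foldl_bounded [OF assms(1-3)])
    show "poly_bounded (\<lambda>n. (n + 2) ^ c + (n + 2) ^ e * (n + (n + 2) ^ e + 2) ^ g)" by (intro poly_bounded_intros)
    fix x :: 'a and ys zs
    assume L: "L x = ys @ zs"
    let ?n = "enc_size x"
    have "tree_size (enc_list (map enc (L x))) + 1
        = tree_size (enc_list (map enc ys)) + tree_size (enc_list (map enc zs))"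
      unfolding L map_append by (rule tree_size_enc_list_append)
    then have "enc_size ys \<le> enc_size (L x)"
      using tree_size_pos [of "enc_list (map enc zs)"] by (simp del: tree_size_pos)
    with e [of x] have L': "enc_size ys \<le> (?n + 2) ^ e" by linarith
    have gen: "enc_size (foldl (s x) a us) \<le> enc_size a + length us * (?n + (?n + 2) ^ e + 2) ^ g"
      if "enc_size us \<le> (?n + 2) ^ e" for a us
      using that
    proof (induction us arbitrary: a)
      case (Cons u us)
      have "enc_size (foldl (s x) a (u # us)) \<le> enc_size (s x a u) + length us * (?n + (?n + 2) ^ e + 2) ^ g"
        using Cons.IH [of "s x a u"] Cons.prems by simp
      moreover have "G (?n + enc_size u) \<le> (?n + (?n + 2) ^ e + 2) ^ g"
        by (rule order.trans [OF g power_mono]) (use Cons.prems in auto)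
      ultimately show ?case using G [of x a u] by simp
    qed simp
    have "length ys \<le> (?n + 2) ^ e"
      using length_le_tree_size [of "map enc ys"] L' by simp
    then have "length ys * (?n + (?n + 2) ^ e + 2) ^ g \<le> (?n + 2) ^ e * (?n + (?n + 2) ^ e + 2) ^ g"
      by (rule mult_right_mono) simp
    then show "enc_size (foldl (s x) (i x) ys) \<le> (?n + 2) ^ c + (?n + 2) ^ e * (?n + (?n + 2) ^ e + 2) ^ g"
      using gen [OF L', of "i x"] c [of x] by linarith
  qed
qed

lemma foldl_Cons_rev: "foldl (\<lambda>acc y. h y # acc) zs xs = rev (map h xs) @ zs"
  by (induction xs arbitrary: zs) auto

text \<open>A fold that conses onto its accumulator reverses the list. The tail \<open>i x\<close>
  makes this one fold sufficient for reversal, for mapping and, applied twice, for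
  appending.\<close>

lemma polytime_rev_map:
  assumes "polytime L" "polytime i" "polytime (\<lambda>z. h (fst z) (snd z))"
  shows "polytime (\<lambda>x. rev (map (h x) (L x)) @ i x)"
proof -
  obtain c where c: "\<And>a. enc_size (h (fst a) (snd a)) \<le> (enc_size a + 2) ^ c"
    using polytime_size [OF assms(3)] by blast
  have "polytime (\<lambda>x. foldl (\<lambda>acc y. h x y # acc) (i x) (L x))"
  proof (rule polytime_foldl [where G = "\<lambda>n. (n + 3) ^ c + 1"])
    show "polytime (\<lambda>z. h (fst z) (snd (snd z)) # fst (snd z))"
      by (intro polytime_intros polytime_comp2 [OF assms(3)])
    show "enc_size (h x y # a) \<le> enc_size a + ((enc_size x + enc_size y + 3) ^ c + 1)" for x y a
      using c [of "(x, y)"] by (simp add: add.commute numeral_3_eq_3)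
  qed (use assms in \<open>auto intro!: poly_bounded_intros\<close>)
  then show ?thesis by (simp add: foldl_Cons_rev)
qed

lemma polytime_append [polytime_intros]:
  assumes "polytime f" "polytime g"
  shows "polytime (\<lambda>x. f x @ g x)"
proof -
  have "polytime (\<lambda>x. rev (map (\<lambda>y. y) (f x)) @ [])"
    by (rule polytime_rev_map) (use assms in \<open>auto intro: polytime_intros\<close>)
  then have "polytime (\<lambda>x. rev (map (\<lambda>y. y) (rev (f x))) @ g x)"
    by (intro polytime_rev_map) (use assms in \<open>auto intro: polytime_intros\<close>)
  then show ?thesis by simp
qed

lemma polytime_rev [polytime_intros]: "polytime f \<Longrightarrow> polytime (\<lambda>x. rev (f x))"
  using polytime_rev_map [of f "\<lambda>_. []" "\<lambda>_ y. y"] by (simp add: polytime_intros)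

lemma polytime_map [polytime_intros]:
  assumes "polytime L" "polytime (\<lambda>z. h (fst z) (snd z))"
  shows "polytime (\<lambda>x. map (h x) (L x))"
  using polytime_rev [OF polytime_rev_map [OF assms(1) _ assms(2), of "\<lambda>_. []"]] by (simp add: polytime_const)

lemma polytime_concat [polytime_intros]:
  fixes L :: "'a::enc \<Rightarrow> 'b::enc list list"
  assumes "polytime L"
  shows "polytime (\<lambda>x. concat (L x))"
proof -
  have "polytime (\<lambda>x. foldl (\<lambda>acc y. acc @ y) [] (L x))"
  proof (rule polytime_foldl [where G = "\<lambda>n. n"])
    show "enc_size (a @ y) \<le> enc_size a + (enc_size x + enc_size y)" for x :: 'a and a y :: "'b list"
      using tree_size_enc_list_append [of "map enc a" "map enc y"] by simp
  qed (use assms in \<open>auto intro!: polytime_intros poly_bounded_intros\<close>)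
  moreover have "foldl (\<lambda>acc y. acc @ y) zs ys = zs @ concat ys" for zs :: "'b list" and ys
    by (induction ys arbitrary: zs) auto
  ultimately show ?thesis by simp
qed

lemma polytime_bex [polytime_intros]:
  assumes "polytime L" "polytime (\<lambda>z. P (fst z) (snd z))"
  shows "polytime (\<lambda>x. \<exists>y\<in>set (L x). P x y)"
proof -
  have "polytime (\<lambda>x. foldl (\<lambda>a y. P x y \<or> a) False (L x))"
  proof (rule polytime_foldl [where G = "\<lambda>n. 3"])
    show "polytime (\<lambda>z. P (fst z) (snd (snd z)) \<or> fst (snd z))"
      by (intro polytime_intros polytime_comp2 [OF assms(2)])
  qed (use assms in \<open>auto intro!: polytime_intros poly_bounded_intros simp: enc_bool_def\<close>)
  moreover have "foldl (\<lambda>a y. P x y \<or> a) b ys \<longleftrightarrow> b \<or> (\<exists>y\<in>set ys. P x y)" for x b ys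
    by (induction ys arbitrary: b) auto
  ultimately show ?thesis by simp
qed

lemma polytime_ball [polytime_intros]:
  assumes "polytime L" "polytime (\<lambda>z. P (fst z) (snd z))"
  shows "polytime (\<lambda>x. \<forall>y\<in>set (L x). P x y)"
  using polytime_not [OF polytime_bex [OF assms(1), of "\<lambda>x y. \<not> P x y"]] assms(2) by (simp add: polytime_not)

lemma filter_conv_concat: "filter P xs = concat (map (\<lambda>x. if P x then [x] else []) xs)"
  by (induction xs) auto

lemma polytime_filter [polytime_intros]:
  assumes "polytime L" "polytime (\<lambda>z. P (fst z) (snd z))"
  shows "polytime (\<lambda>x. filter (P x) (L x))"
  unfolding filter_conv_concat by (intro polytime_intros assms)

subsection \<open>Numbers\<close>

lemma polytime_length [polytime_intros]: "polytime L \<Longrightarrow> polytime (\<lambda>x. length (L x))"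
  by (rule polytime_recast [of "\<lambda>x. map (\<lambda>_. Atom) (L x)"], (intro polytime_intros; assumption))
    (simp add: enc_unary_def map_replicate_const)

lemma polytime_units: "polytime n \<Longrightarrow> polytime (\<lambda>x. replicate (n x) Atom)"
  by (rule polytime_recast [of n]) (auto simp: enc_unary_def)

lemma polytime_enc_tree: "polytime f \<Longrightarrow> polytime (\<lambda>x. enc (f x))"
  by (rule polytime_recast [of f]) auto

lemma polytime_Suc [polytime_intros]: "polytime n \<Longrightarrow> polytime (\<lambda>x. Suc (n x))"
  by (rule polytime_recast [of "\<lambda>x. Pair Atom (enc (n x))"], (intro polytime_intros polytime_enc_tree; assumption))
    (simp add: enc_unary_def)

lemma polytime_add [polytime_intros]: "polytime m \<Longrightarrow> polytime n \<Longrightarrow> polytime (\<lambda>x. m x + (n x :: nat))"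
  by (rule polytime_recast [of "\<lambda>x. length (replicate (m x) Atom @ replicate (n x) Atom)"],
      (intro polytime_intros polytime_units; assumption)) simp

lemma foldl_tl: "foldl (\<lambda>acc _. tl acc) ys xs = drop (length xs) ys"
  by (induction xs arbitrary: ys) (auto simp: drop_Suc)

lemma polytime_drop [polytime_intros]:
  assumes "polytime n" "polytime L"
  shows "polytime (\<lambda>x. drop (n x) (L x))"
proof -
  have "polytime (\<lambda>x. foldl (\<lambda>acc _. tl acc) (L x) (replicate (n x) Atom))"
  proof (rule polytime_foldl [where G = "\<lambda>n. n"])
    show "enc_size (tl a) \<le> enc_size a + (enc_size x + enc_size y)"
      for x :: 'a and a :: "'b list" and y :: tree
      by (cases a) auto
  qed (use assms in \<open>auto intro!: polytime_intros polytime_units poly_bounded_intros\<close>)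
  then show ?thesis by (simp add: foldl_tl)
qed

lemma polytime_minus [polytime_intros]: "polytime m \<Longrightarrow> polytime n \<Longrightarrow> polytime (\<lambda>x. m x - (n x :: nat))"
  by (rule polytime_recast [of "\<lambda>x. length (drop (n x) (replicate (m x) Atom))"],
      (intro polytime_intros polytime_units; assumption)) simp

lemma polytime_less [polytime_intros]: "polytime m \<Longrightarrow> polytime n \<Longrightarrow> polytime (\<lambda>x. m x < (n x :: nat))"
  by (rule polytime_recast [of "\<lambda>x. \<not> (drop (m x) (replicate (n x) Atom) = [])"],
      (intro polytime_intros polytime_units; assumption)) (simp add: linorder_not_le)

lemma polytime_le [polytime_intros]: "polytime m \<Longrightarrow> polytime n \<Longrightarrow> polytime (\<lambda>x. m x \<le> (n x :: nat))"
  unfolding linorder_not_less [symmetric] by (intro polytime_intros)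

lemma polytime_nat_eq [polytime_intros]: "polytime m \<Longrightarrow> polytime n \<Longrightarrow> polytime (\<lambda>x. m x = (n x :: nat))"
  unfolding order.eq_iff [where 'a = nat] by (intro polytime_intros)

lemma polytime_upt [polytime_intros]:
  assumes "polytime n"
  shows "polytime (\<lambda>x. [0..<n x])"
proof -
  \<comment> \<open>The redundant test bounds the growth of the accumulator in terms of \<open>x\<close> alone.\<close>
  let ?s = "\<lambda>x acc (_ :: tree). acc @ [if length acc < n x then length acc else n x]"
  obtain c where c: "\<And>a. enc_size (n a) \<le> (enc_size a + 2) ^ c"
    by (rule polytime_size [OF assms]) (rule that)
  have "polytime (\<lambda>x. foldl (?s x) [] (replicate (n x) Atom))"
  proof (rule polytime_foldl [where G = "\<lambda>m. (m + 2) ^ c + 1"])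
    show "polytime (\<lambda>z. ?s (fst z) (fst (snd z)) (snd (snd z)))"
      by (intro polytime_intros polytime_comp [OF _ assms])
    show "enc_size (?s x a y) \<le> enc_size a + ((enc_size x + enc_size y + 2) ^ c + 1)" for x a y
    proof -
      let ?m = "if length a < n x then length a else n x"
      have *: "tree_size (enc_unary m) = 2 * m + 1" for m
        by (induction m) (auto simp: enc_unary_def)
      have "(enc_size x + 2) ^ c \<le> (enc_size x + enc_size y + 2) ^ c"
        by (rule power_mono) auto
      with c [of x] have "tree_size (enc_unary ?m) \<le> (enc_size x + enc_size y + 2) ^ c"
        by (auto simp: *)
      then show ?thesis
        using tree_size_enc_list_append [of "map enc a" "[enc ?m]"] by simp
    qed
  qed (use assms in \<open>auto intro!: polytime_intros polytime_units poly_bounded_intros\<close>)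
  moreover have "foldl (?s x) [] (replicate m Atom) = [0..<m]" if "m \<le> n x" for x m
    using that
  proof (induction m)
    case (Suc m)
    have "replicate (Suc m) Atom = replicate m Atom @ [Atom]"
      by (simp add: replicate_append_same)
    with Suc show ?case by simp
  qed simp
  ultimately show ?thesis by simp
qed

text \<open>List access with an explicit default: \<open>!\<close> is unspecified beyond the end of
  the list, so no program can be shown to compute it for all arguments.\<close>

definition nth_or :: "'a \<Rightarrow> 'a list \<Rightarrow> nat \<Rightarrow> 'a" where
  "nth_or z xs i = (case drop i xs of [] \<Rightarrow> z | y # ys \<Rightarrow> y)"

lemma nth_or_nth [simp]: "i < length xs \<Longrightarrow> nth_or z xs i = xs ! i"
  unfolding nth_or_def by (subst Cons_nth_drop_Suc [symmetric]) auto

lemma polytime_nth_or [polytime_intros]: "polytime z \<Longrightarrow> polytime L \<Longrightarrow> polytime i \<Longrightarrow> polytime (\<lambda>x. nth_or (z x) (L x) (i x))"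
  unfolding nth_or_def by (intro polytime_intros)

text \<open>Binary increment, least significant digit first. The code of \<open>bits n\<close> is
  \<open>enc_binary n\<close>, so a unary number is converted by \<open>n\<close> increments,
  without any division.\<close>

fun incr :: "nat list \<Rightarrow> nat list" where
  "incr [] = [1]"
| "incr (b # bs) = (if b = 0 then 1 # bs else 0 # incr bs)"

fun bits :: "nat \<Rightarrow> nat list" where
  "bits n = (if n = 0 then [] else n mod 2 # bits (n div 2))"

declare bits.simps [simp del]

lemma enc_bits: "enc (bits n) = enc_binary n"
  by (induction n rule: bits.induct) (simp add: bits.simps enc_binary.simps)

lemma incr_bits: "incr (bits n) = bits (Suc n)"
proof (induction n rule: less_induct)
  case (less n)
  show ?case
  proof (cases "n = 0")
    case True
    then show ?thesis by (simp add: bits.simps)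
  next
    case False
    show ?thesis
    proof (cases "even n")
      case True
      then show ?thesis using False by (subst (1 2) bits.simps) (auto elim!: evenE)
    next
      case odd: False
      then obtain m where m: "n = 2 * m + 1" by (auto elim: oddE)
      then have "incr (bits n) = 0 # incr (bits m)" by (subst bits.simps) simp
      also have "\<dots> = 0 # bits (Suc m)" using less [of m] m by simp
      also have "\<dots> = bits (Suc n)" using m by (subst (2) bits.simps) simp
      finally show ?thesis .
    qed
  qed
qed

text \<open>The state is a carry flag together with the digits written so far in reverse; a carry
  that survives all digits becomes a new leading digit.\<close>

lemma incr_conv_foldl:
  "incr bs = rev (let r = foldl (\<lambda>r b. if fst r then (if b = 0 then (False, 1 # snd r) else (True, 0 # snd r))
      else (False, b # snd r)) (True, []) bs in if fst r then 1 # snd r else snd r)"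
proof -
  let ?s = "\<lambda>r b. if fst r then (if b = 0 then (False, 1 # snd r) else (True, 0 # snd r))
      else (False, b # snd r)"
  have 1: "foldl ?s (False, out) cs = (False, rev cs @ out)" for cs out
    by (induction cs arbitrary: out) auto
  have "rev out @ incr cs = rev (let r = foldl ?s (True, out) cs in if fst r then 1 # snd r else snd r)" for cs out
  proof (induction cs arbitrary: out)
    case (Cons b cs)
    then show ?case using Cons [of "0 # out"] by (simp add: 1)
  qed simp
  from this [of "[]" bs] show ?thesis by simp
qed

lemma polytime_incr [polytime_intros]:
  assumes "polytime L"
  shows "polytime (\<lambda>x. incr (L x))"
proof -
  let ?s = "\<lambda>r b. if fst r then (if b = 0 then (False, (1 :: nat) # snd r) else (True, 0 # snd r))
      else (False, b # snd r)"
  have "polytime (\<lambda>x. foldl ?s (True, []) (L x))"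
    by (rule polytime_foldl [where G = "\<lambda>n. n + 10"])
      (use assms in \<open>auto intro!: polytime_intros poly_bounded_intros simp: enc_bool_def enc_unary_def\<close>)
  then show ?thesis unfolding incr_conv_foldl Let_def by (intro polytime_intros)
qed

lemma enc_size_incr: "enc_size (incr bs) \<le> enc_size bs + 4"
proof (induction bs)
  case (Cons b bs)
  then show ?case using tree_size_ge1 [of "enc b"]
    by (auto simp: enc_unary_def simp del: tree_size_ge1)
qed (simp add: enc_unary_def)

lemma polytime_enc_binary [polytime_intros]:
  assumes "polytime n"
  shows "polytime (\<lambda>x. enc_binary (n x))"
proof -
  have "polytime (\<lambda>x. foldl (\<lambda>bs _. incr bs) [] (replicate (n x) Atom))"
    by (rule polytime_foldl [where G = "\<lambda>n. 4"])
      (use assms in \<open>auto intro!: polytime_intros polytime_units poly_bounded_intros enc_size_incr [simplified]\<close>)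
  moreover have "foldl (\<lambda>bs _. incr bs) [] (replicate m Atom) = bits m" for m
  proof (induction m)
    case (Suc m)
    have "replicate (Suc m) Atom = replicate m Atom @ [Atom]"
      by (simp add: replicate_append_same)
    with Suc show ?case by (simp add: incr_bits)
  qed (simp add: bits.simps)
  ultimately have "polytime (\<lambda>x. bits (n x))" by simp
  then show ?thesis by (rule polytime_recast) (simp add: enc_bits [simplified])
qed

subsection \<open>Gates\<close>

fun gate_tag :: "gate \<Rightarrow> nat" where
  "gate_tag Input = 0"
| "gate_tag (Not_Gate j) = 1"
| "gate_tag (And_Gate js) = 2"
| "gate_tag (Or_Gate js) = 3"

lemma polytime_gate_tag [polytime_intros]: "polytime g \<Longrightarrow> polytime (\<lambda>x. gate_tag (g x))"
proof (rule polytime_recast [of "\<lambda>x. hd_tree (enc (g x))"])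
  show "enc (gate_tag (g x)) = enc (hd_tree (enc (g x)))" for x by (cases "g x") auto
qed (intro polytime_intros polytime_enc_tree; assumption)

lemma polytime_preds [polytime_intros]: "polytime g \<Longrightarrow> polytime (\<lambda>x. preds (g x))"
proof (rule polytime_recast [of "\<lambda>x. if gate_tag (g x) = 1 then Pair (tl_tree (enc (g x))) Atom else tl_tree (enc (g x))"])
  show "enc (preds (g x)) = enc (if gate_tag (g x) = 1 then Pair (tl_tree (enc (g x))) Atom else tl_tree (enc (g x)))"
    for x by (cases "g x") (auto simp: comp_def)
qed (intro polytime_intros polytime_enc_tree; assumption)

text \<open>The inverse of \<open>enc_list\<close>: every tree, read along its right spine, is the
  code of exactly one list of trees.\<close>

fun kids :: "tree \<Rightarrow> tree list" where
  "kids Atom = []"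
| "kids (Pair a b) = a # kids b"

lemma enc_list_kids [simp]: "enc_list (kids t) = t"
  by (induction t) auto

lemma kids_enc_list [simp]: "kids (enc_list xs) = xs"
  by (induction xs) auto

lemma map_enc_tree [simp]: "map enc ts = (ts :: tree list)"
  by (induction ts) auto

lemma polytime_kids [polytime_intros]: "polytime f \<Longrightarrow> polytime (\<lambda>x. kids (f x))"
  by (rule polytime_recast [of f]) auto

text \<open>Total, with \<open>Or_Gate\<close> for all further tags and lengths in place of checked
  unary numbers; the trees on which this is not the inverse of \<open>enc_gate\<close> are screened
  by \<open>gate_ok\<close>.\<close>

definition mk_gate :: "nat \<Rightarrow> tree \<Rightarrow> gate" where
  "mk_gate n t =
    (if n = 0 then Input else if n = 1 then Not_Gate (length (kids t))
     else if n = 2 then And_Gate (map (\<lambda>u. length (kids u)) (kids t))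
     else Or_Gate (map (\<lambda>u. length (kids u)) (kids t)))"

lemma polytime_mk_gate [polytime_intros]:
  assumes "polytime n" "polytime t"
  shows "polytime (\<lambda>x. mk_gate (n x) (t x))"
proof (rule polytime_recast)
  let ?l = "\<lambda>u. length (kids u)"
  let ?e = "\<lambda>x. if n x = 0 then Pair Atom Atom else if n x = 1 then Pair (enc_unary 1) (enc (?l (t x)))
     else if n x = 2 then Pair (enc_unary 2) (enc (map ?l (kids (t x))))
     else Pair (enc_unary 3) (enc (map ?l (kids (t x))))"
  have 1: "polytime (\<lambda>x. enc (?l (t x)))"
    by (rule polytime_recast [of "\<lambda>x. ?l (t x)"]) (auto intro!: polytime_intros assms)
  have 2: "polytime (\<lambda>x. enc (map ?l (kids (t x))))"
    by (rule polytime_recast [of "\<lambda>x. map ?l (kids (t x))"]) (auto intro!: polytime_intros assms)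
  show "polytime ?e" by (intro polytime_intros assms 1 2)
  show "enc (mk_gate (n x) (t x)) = enc (?e x)" for x
    by (auto simp: mk_gate_def enc_unary_def comp_def)
qed

section \<open>Depth and weft by recursion\<close>

definition gate_at :: "circuit \<Rightarrow> nat \<Rightarrow> gate" where
  "gate_at C i = nth_or Input C i"

lemma gate_at [simp]: "i < length C \<Longrightarrow> gate_at C i = C ! i"
  by (simp add: gate_at_def)

fun depth_le :: "nat \<Rightarrow> circuit \<Rightarrow> nat \<Rightarrow> bool" where
  "depth_le 0 C i \<longleftrightarrow> preds (gate_at C i) = []"
| "depth_le (Suc e) C i \<longleftrightarrow> (\<forall>j\<in>set (preds (gate_at C i)). depth_le e C j)"

text \<open>Meaningful only when the fuel is at least the depth of the node.\<close>

fun weft_le :: "nat \<Rightarrow> nat \<Rightarrow> circuit \<Rightarrow> nat \<Rightarrow> bool" where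
  "weft_le 0 w C i \<longleftrightarrow> True"
| "weft_le (Suc e) w C i \<longleftrightarrow> (if large (gate_at C i)
     then w \<noteq> 0 \<and> (\<forall>j\<in>set (preds (gate_at C i)). weft_le e (w - 1) C j)
     else (\<forall>j\<in>set (preds (gate_at C i)). weft_le e w C j))"

lemma depth_le_Suc: "depth_le e C i \<Longrightarrow> depth_le (Suc e) C i"
proof (induction e arbitrary: i)
  case (Suc e) then show ?case using depth_le.simps(2) by blast
qed simp

lemma depth_le_mono: "depth_le e C i \<Longrightarrow> e \<le> e' \<Longrightarrow> depth_le e' C i"
  by (induction e' rule: nat_induct) (auto simp: le_Suc_eq depth_le_Suc simp del: depth_le.simps(2))

lemma circuitD:
  assumes "circuit C" "i < length C"
  shows "arity_ok (C ! i)" "j \<in> set (preds (C ! i)) \<Longrightarrow> j < i" "j \<in> set (preds (C ! i)) \<Longrightarrow> j < length C"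
  using assms unfolding circuit_def by (auto intro: less_trans)

lemma preds_Nil_iff: "arity_ok g \<Longrightarrow> preds g = [] \<longleftrightarrow> g = Input"
  by (cases g) auto

text \<open>\<open>input_output_path\<close> with a free end node, which is what an induction along
  the circuit needs.\<close>

definition path_to :: "circuit \<Rightarrow> nat \<Rightarrow> nat list \<Rightarrow> bool" where
  "path_to C i ps \<longleftrightarrow> ps \<noteq> [] \<and> set ps \<subseteq> {..<length C} \<and> C ! hd ps = Input \<and> last ps = i \<and>
     successively (\<lambda>j i. j \<in> set (preds (C ! i))) ps"

lemma path_to_Input: "i < length C \<Longrightarrow> C ! i = Input \<Longrightarrow> path_to C i [i]"
  unfolding path_to_def by simp

lemma path_to_snoc:
  "path_to C j ps \<Longrightarrow> i < length C \<Longrightarrow> j \<in> set (preds (C ! i)) \<Longrightarrow> path_to C i (ps @ [i])"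
  unfolding path_to_def by (auto simp: successively_append_iff)

lemma path_to_cases:
  assumes "path_to C i ps"
  obtains "ps = [i]" "C ! i = Input" | j qs where "ps = qs @ [i]" "path_to C j qs" "j \<in> set (preds (C ! i))"
proof -
  from assms have ne: "ps \<noteq> []" and l: "last ps = i" by (auto simp: path_to_def)
  define qs where "qs = butlast ps"
  have ps: "ps = qs @ [i]" using append_butlast_last_id [OF ne] l by (simp add: qs_def)
  show thesis
  proof (cases "qs = []")
    case True
    then show thesis using assms ps that(1) by (auto simp: path_to_def)
  next
    case False
    then have "path_to C (last qs) qs" "last qs \<in> set (preds (C ! i))"
      using assms unfolding ps path_to_def by (auto simp: successively_append_iff)
    then show thesis using that(2) ps by blast
  qed
qed

lemma path_to_no_preds: "path_to C i ps \<Longrightarrow> preds (C ! i) = [] \<Longrightarrow> ps = [i]"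
  by (erule path_to_cases) auto

text \<open>Gates have at least one in-neighbour, so walking backwards ends at an input. Without
  this a bound on all paths into a node could hold vacuously and say nothing about the
  recursion.\<close>

lemma path_to_exists:
  assumes "circuit C"
  shows "i < length C \<Longrightarrow> \<exists>ps. path_to C i ps"
proof (induction i rule: less_induct)
  case (less i)
  show ?case
  proof (cases "C ! i = Input")
    case True
    then show ?thesis using path_to_Input less.prems by blast
  next
    case False
    then have "preds (C ! i) \<noteq> []"
      using preds_Nil_iff circuitD(1) [OF assms less.prems] by blast
    then obtain j where "j \<in> set (preds (C ! i))" using last_in_set by blast
    then show ?thesis
      using less.IH [of j] path_to_snoc less.prems circuitD(2,3) [OF assms less.prems] by blast
  qed
qed

lemma depth_le_iff_paths:
  assumes C: "circuit C"
  shows "i < length C \<Longrightarrow> depth_le e C i \<longleftrightarrow> (\<forall>ps. path_to C i ps \<longrightarrow> length ps - 1 \<le> e)"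
proof (induction e arbitrary: i)
  case 0
  show ?case
  proof
    assume L: "depth_le 0 C i"
    then have "preds (C ! i) = []" using 0 by simp
    then show "\<forall>ps. path_to C i ps \<longrightarrow> length ps - 1 \<le> 0"
      using path_to_no_preds by fastforce
  next
    assume R: "\<forall>ps. path_to C i ps \<longrightarrow> length ps - 1 \<le> 0"
    show "depth_le 0 C i"
    proof (rule ccontr)
      assume "\<not> depth_le 0 C i"
      then obtain j where j: "j \<in> set (preds (C ! i))" using 0 last_in_set by auto
      then obtain ps where ps: "path_to C j ps" using path_to_exists [OF C] circuitD [OF C 0] by blast
      then have "length (ps @ [i]) - 1 \<le> 0" using R path_to_snoc 0 j by blast
      then show False using ps by (simp add: path_to_def)
    qed
  qed
next
  case (Suc e)
  show ?case
  proof
    assume L: "depth_le (Suc e) C i"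
    show "\<forall>ps. path_to C i ps \<longrightarrow> length ps - 1 \<le> Suc e"
    proof (intro allI impI)
      fix ps assume "path_to C i ps"
      then show "length ps - 1 \<le> Suc e"
      proof (cases rule: path_to_cases)
        case (2 j qs)
        then have "j < length C" "depth_le e C j" using L Suc.prems circuitD(3) [OF C Suc.prems] by simp_all
        then have "length qs - 1 \<le> e" using Suc.IH 2 by blast
        then show ?thesis using 2(1) by simp
      qed simp
    qed
  next
    assume R: "\<forall>ps. path_to C i ps \<longrightarrow> length ps - 1 \<le> Suc e"
    have "depth_le e C j" if j: "j \<in> set (preds (C ! i))" for j
    proof -
      have jl: "j < length C" using circuitD [OF C Suc.prems] j by blast
      have "length qs - 1 \<le> e" if "path_to C j qs" for qs
      proof -
        have "length (qs @ [i]) - 1 \<le> Suc e" using R path_to_snoc [OF that Suc.prems j] by blast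
        then show ?thesis by simp
      qed
      then show ?thesis using Suc.IH [OF jl] by blast
    qed
    then show "depth_le (Suc e) C i" using Suc.prems by simp
  qed
qed

text \<open>The depth hypothesis guarantees that the fuel lasts down to the inputs; otherwise
  \<open>weft_le\<close> could stop early and accept.\<close>

lemma weft_le_iff_paths:
  assumes C: "circuit C"
  shows "i < length C \<Longrightarrow> depth_le e C i \<Longrightarrow>
    weft_le e w C i \<longleftrightarrow> (\<forall>ps. path_to C i ps \<longrightarrow> length (filter (\<lambda>i. large (C ! i)) ps) \<le> w)"
proof (induction e arbitrary: i w)
  case 0
  then have "preds (C ! i) = []" by simp
  then have "length (filter (\<lambda>i. large (C ! i)) ps) \<le> w" if "path_to C i ps" for ps
    using path_to_no_preds [OF that] by (simp add: large_def)
  then show ?case by simp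
next
  case (Suc e)
  let ?n = "\<lambda>ps. length (filter (\<lambda>i. large (C ! i)) ps)"
  have IH: "weft_le e w C j \<longleftrightarrow> (\<forall>ps. path_to C j ps \<longrightarrow> ?n ps \<le> w)" if "j \<in> set (preds (C ! i))" for j w
    using Suc.IH [of j w] Suc.prems that circuitD(3) [OF C Suc.prems(1)] by simp
  show ?case
  proof (cases "C ! i = Input")
    case True
    then have "preds (C ! i) = []" by simp
    then have "length (filter (\<lambda>i. large (C ! i)) ps) \<le> w" if "path_to C i ps" for ps
      using path_to_no_preds [OF that] by (simp add: large_def)
    then show ?thesis using Suc.prems True by (simp add: large_def)
  next
    case False
    define b where "b = (if large (C ! i) then 1 else 0 :: nat)"
    have snoc: "?n (ps @ [i]) = ?n ps + b" for ps by (simp add: b_def)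
    have "(\<forall>ps. path_to C i ps \<longrightarrow> ?n ps \<le> w) \<longleftrightarrow>
        (\<forall>j\<in>set (preds (C ! i)). \<forall>qs. path_to C j qs \<longrightarrow> ?n qs + b \<le> w)" (is "?L \<longleftrightarrow> ?R")
    proof
      assume L: ?L
      show ?R
      proof (intro ballI allI impI)
        fix j qs assume "j \<in> set (preds (C ! i))" "path_to C j qs"
        then show "?n qs + b \<le> w" using L path_to_snoc [of C j qs i] Suc.prems(1) snoc by metis
      qed
    next
      assume R: ?R
      show ?L
      proof (intro allI impI)
        fix ps assume "path_to C i ps"
        then show "?n ps \<le> w"
        proof (cases rule: path_to_cases)
          case (2 j qs)
          then show ?thesis using R snoc [of qs] by simp
        qed (use False in auto)
      qed
    qed
    also have "\<dots> \<longleftrightarrow> weft_le (Suc e) w C i"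
    proof (cases "large (C ! i)")
      case True
      \<comment> \<open>Some path actually passes through the large gate, hence the path condition
        excludes \<open>w = 0\<close>, as the recursion does explicitly.\<close>
      obtain j where j: "j \<in> set (preds (C ! i))" using True by (cases "preds (C ! i)") (auto simp: large_def)
      obtain qs where "path_to C j qs" using path_to_exists [OF C] circuitD(3) [OF C Suc.prems(1) j] by blast
      then have "w \<noteq> 0" if ?R using that j True b_def by (metis add_eq_0_iff_both_eq_0 le_zero_eq one_neq_zero)
      moreover have "?n qs + 1 \<le> w \<longleftrightarrow> ?n qs \<le> w - 1" if "w \<noteq> 0" for qs using that by auto
      ultimately show ?thesis using True Suc.prems IH by (auto simp: b_def)
    next
      case False
      then show ?thesis using Suc.prems IH by (simp add: b_def)
    qed
    finally show ?thesis by simp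
  qed
qed

section \<open>Bad sets of choices\<close>

text \<open>
  A choice \<open>(0, j, a)\<close> says that the \<open>j\<close>-th true input, counted from \<open>0\<close> in increasing order, is \<open>a\<close>.
  A choice \<open>(1, L, w)\<close> or \<open>(2, L, w)\<close> says that the large gate \<open>L\<close> is true or false, respectively, with
  its in-neighbour \<open>w\<close> as a witness if a single in-neighbour can force this value.
\<close>

type_synonym choice = "nat \<times> nat \<times> nat"

fun top_gates :: "nat \<Rightarrow> circuit \<Rightarrow> nat \<Rightarrow> nat list" where
  "top_gates 0 C i = []"
| "top_gates (Suc e) C i = (if large (gate_at C i) then [i]
     else concat (map (\<lambda>j. top_gates e C j) (preds (gate_at C i))))"

text \<open>Filtering all positions removes the repetitions in \<open>top_gates\<close>, so the
  length counts gates. Here and below, bounded quantifiers over lists and projections keep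
  definitions in the form that \<open>polytime_intros\<close> decomposes.\<close>

definition guessed :: "nat \<Rightarrow> circuit \<Rightarrow> nat list" where
  "guessed d C = filter (\<lambda>i. \<exists>j\<in>set (top_gates d C (length C - 1)). j = i) [0..<length C]"

text \<open>The index \<open>j\<close> names the gap between the true inputs of ranks
  \<open>j - 1\<close> and \<open>j\<close>. The gaps \<open>0\<close> and \<open>k\<close> are open
  on one side, so at most two choices are needed; for \<open>k = 0\<close> the empty list certifies
  that every input is false.\<close>

definition certifies_input :: "nat \<Rightarrow> choice list \<Rightarrow> bool \<Rightarrow> nat \<Rightarrow> bool" where
  "certifies_input k t b i \<longleftrightarrow> (if b then \<exists>u\<in>set t. fst u = 0 \<and> snd (snd u) = i
     else \<exists>j\<in>set [0..<Suc k].
       (j = 0 \<or> (\<exists>u\<in>set t. fst u = 0 \<and> Suc (fst (snd u)) = j \<and> snd (snd u) < i)) \<and>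
       (j = k \<or> (\<exists>u\<in>set t. fst u = 0 \<and> fst (snd u) = j \<and> i < snd (snd u))))"

text \<open>
  A sound approximation, monotone in \<open>t\<close>, of ``the choices in \<open>t\<close> force the value \<open>b\<close> on node \<open>i\<close>'';
  \<open>e\<close> bounds the recursion depth.
\<close>

fun certifies :: "nat \<Rightarrow> nat \<Rightarrow> choice list \<Rightarrow> circuit \<Rightarrow> bool \<Rightarrow> nat \<Rightarrow> bool" where
  "certifies 0 k t C b i \<longleftrightarrow> gate_tag (gate_at C i) = 0 \<and> certifies_input k t b i"
| "certifies (Suc e) k t C b i \<longleftrightarrow>
    (if gate_tag (gate_at C i) = 0 then certifies_input k t b i
     else if large (gate_at C i) then \<exists>u\<in>set t. fst u = (if b then 1 else 2) \<and> fst (snd u) = i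
     else if gate_tag (gate_at C i) = 1 then \<forall>j\<in>set (preds (gate_at C i)). certifies e k t C (\<not> b) j
     else if gate_tag (gate_at C i) = 2 \<longleftrightarrow> b then \<forall>j\<in>set (preds (gate_at C i)). certifies e k t C b j
     else \<exists>j\<in>set (preds (gate_at C i)). certifies e k t C b j)"

text \<open>Ranks must enumerate inputs in strictly increasing order, and a gate admits a single
  guess with a single witness. Conflict-free sets therefore contain at most one choice per rank and
  per gate.\<close>

definition conflict :: "choice \<Rightarrow> choice \<Rightarrow> bool" where
  "conflict u v \<longleftrightarrow>
     (if fst u = 0 then fst v = 0 \<and> (fst (snd u) < fst (snd v) \<and> \<not> snd (snd u) < snd (snd v) \<or>
          fst (snd u) = fst (snd v) \<and> \<not> snd (snd u) = snd (snd v))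
      else \<not> fst v = 0 \<and> fst (snd u) = fst (snd v) \<and> \<not> u = v)"

text \<open>The condition comparing tag and guess holds for And guessed true and Or guessed false,
  values that need all in-neighbours to agree, so any one certified to the contrary refutes the
  guess. In the two other cases the guess stands or falls with its witness.\<close>

definition refuted :: "nat \<Rightarrow> nat \<Rightarrow> circuit \<Rightarrow> choice list \<Rightarrow> choice \<Rightarrow> bool" where
  "refuted d k C t u \<longleftrightarrow> \<not> fst u = 0 \<and>
     (if gate_tag (gate_at C (fst (snd u))) = 2 \<longleftrightarrow> fst u = 1
      then \<exists>w\<in>set (preds (gate_at C (fst (snd u)))). certifies d k t C (\<not> fst u = 1) w
      else certifies d k t C (\<not> fst u = 1) (snd (snd u)))"

definition bad :: "nat \<Rightarrow> nat \<Rightarrow> circuit \<Rightarrow> choice list \<Rightarrow> bool" where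
  "bad d k C t \<longleftrightarrow> (\<exists>u\<in>set t. \<exists>v\<in>set t. conflict u v) \<or> certifies d k t C False (length C - 1) \<or>
     (\<exists>u\<in>set t. refuted d k C t u)"

definition input_choices :: "nat \<Rightarrow> circuit \<Rightarrow> choice list" where
  "input_choices k C = concat (map (\<lambda>j. map (\<lambda>a. (0, j, a))
     (filter (\<lambda>i. gate_tag (gate_at C i) = 0) [0..<length C])) [0..<k])"

definition gate_choices :: "nat \<Rightarrow> circuit \<Rightarrow> choice list" where
  "gate_choices d C = concat (map (\<lambda>L. concat (map (\<lambda>w. [(1, L, w), (2, L, w)])
     (preds (gate_at C L)))) (guessed d C))"

definition choices :: "nat \<Rightarrow> nat \<Rightarrow> circuit \<Rightarrow> choice list" where
  "choices d k C = input_choices k C @ gate_choices d C"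

section \<open>Basic properties of choices and guessed gates\<close>

lemma gate_tag_eq_0 [simp]: "gate_tag g = 0 \<longleftrightarrow> g = Input"
  by (cases g) auto

lemma set_input_choices:
  "set (input_choices k C) = {(0, j, a) | j a. j < k \<and> a < length C \<and> C ! a = Input}"
  by (auto simp: input_choices_def)

lemma guessed_less: "L \<in> set (guessed d C) \<Longrightarrow> L < length C"
  by (auto simp: guessed_def)

lemma set_gate_choices:
  "set (gate_choices d C) =
    {(b, L, w) | b L w. (b = 1 \<or> b = 2) \<and> L \<in> set (guessed d C) \<and> w \<in> set (preds (C ! L))}"
  by (auto simp: gate_choices_def guessed_less)

lemma distinct_guessed: "distinct (guessed d C)"
  by (simp add: guessed_def)

lemma arity_ok_distinct: "arity_ok g \<Longrightarrow> distinct (preds g)"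
  by (cases g) auto

text \<open>Facilities are positions in the list of choices; distinctness makes the number of closed
  facilities the number of selected choices.\<close>

lemma distinct_choices:
  assumes "circuit C"
  shows "distinct (choices d k C)"
proof -
  have "distinct (concat (map (\<lambda>j. map (\<lambda>a. (0 :: nat, j, a)) xs) js))"
    if "distinct js" "distinct xs" for js xs :: "nat list"
    using that by (induction js) (auto simp: distinct_map inj_on_def)
  then have 1: "distinct (input_choices k C)"
    unfolding input_choices_def by simp
  have *: "distinct (concat (map (\<lambda>w. [(1 :: nat, L, w), (2, L, w)]) ws))"
    if "distinct ws" for L :: nat and ws :: "nat list"
    using that by (induction ws) auto
  have "distinct (concat (map (\<lambda>L. concat (map (\<lambda>w. [(1 :: nat, L, w), (2, L, w)]) (f L))) Ls))"
    if "distinct Ls" "\<And>L. L \<in> set Ls \<Longrightarrow> distinct (f L)" for Ls :: "nat list" and f :: "nat \<Rightarrow> nat list"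
    using that by (induction Ls) (auto simp: * [simplified])
  then have "distinct (gate_choices d C)"
    unfolding gate_choices_def
    using assms by (auto simp: distinct_guessed guessed_less arity_ok_distinct circuitD(1))
  then show ?thesis
    using 1 by (auto simp: choices_def set_input_choices set_gate_choices)
qed

text \<open>The search branches only at small gates, which have at most two in-neighbours, so it is
  a binary tree of depth at most \<open>e\<close>.\<close>

lemma length_top_gates: "length (top_gates e C i) \<le> 2 ^ e"
proof (induction e arbitrary: i)
  case (Suc e)
  show ?case
  proof (cases "large (gate_at C i)")
    case False
    then have "length (preds (gate_at C i)) \<le> 2" by (simp add: large_def)
    moreover have "length (concat (map (\<lambda>j. top_gates e C j) js)) \<le> length js * 2 ^ e" for js
      using Suc.IH by (induction js) (auto simp: add_mono)
    ultimately have "length (concat (map (\<lambda>j. top_gates e C j) (preds (gate_at C i)))) \<le> 2 * 2 ^ e"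
      by (meson le_trans mult_le_mono1)
    then show ?thesis
      using False by simp
  qed simp
qed simp

lemma length_guessed: "length (guessed d C) \<le> 2 ^ d"
proof -
  have "length (guessed d C) = card (set (guessed d C))"
    by (simp add: distinct_card distinct_guessed)
  also have "\<dots> \<le> card (set (top_gates d C (length C - 1)))"
    by (rule card_mono) (auto simp: guessed_def)
  also have "\<dots> \<le> 2 ^ d"
    using length_top_gates card_length le_trans by blast
  finally show ?thesis .
qed

lemma top_gates_less:
  assumes "circuit C"
  shows "i < length C \<Longrightarrow> L \<in> set (top_gates e C i) \<Longrightarrow> L < length C"
  by (induction e arbitrary: i) (auto split: if_splits dest: circuitD(3) [OF assms])

lemma set_guessed:
  assumes "circuit C"
  shows "set (guessed d C) = set (top_gates d C (length C - 1))"
  using top_gates_less [OF assms, of "length C - 1"] assms by (auto simp: guessed_def circuit_def)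

text \<open>Small gates pass the weft allowance 1 on unchanged, and the first large gate spends it.
  This is where weft 1 enters: nothing large remains below the in-neighbours of
  \<open>L\<close>.\<close>

lemma top_gates_below:
  assumes "circuit C"
  shows "i < length C \<Longrightarrow> L \<in> set (top_gates e C i) \<Longrightarrow> depth_le e C i \<Longrightarrow> weft_le e 1 C i \<Longrightarrow>
    large (C ! L) \<and> (\<exists>e'<e. \<forall>w\<in>set (preds (C ! L)). depth_le e' C w \<and> weft_le e' 0 C w)"
proof (induction e arbitrary: i)
  case (Suc e)
  show ?case
  proof (cases "large (C ! i)")
    case True
    then have "L = i" "\<forall>w\<in>set (preds (C ! i)). depth_le e C w" "\<forall>w\<in>set (preds (C ! i)). weft_le e 0 C w"
      using Suc.prems by simp_all
    then show ?thesis using True by blast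
  next
    case False
    then obtain j where j: "j \<in> set (preds (C ! i))" "L \<in> set (top_gates e C j)"
      using Suc.prems(1,2) by auto
    then have "j < length C" "depth_le e C j" "weft_le e 1 C j"
      using Suc.prems(1,3,4) False circuitD(3) [OF assms, of i] by simp_all
    from Suc.IH [OF this(1) j(2) this(2,3)] show ?thesis using less_SucI by blast
  qed
qed simp

section \<open>Certificates\<close>

lemma valuationD:
  assumes "valuation C v" "i < length C"
  shows "v i = gate_value (C ! i) i v"
  using assms by (simp add: valuation_def)

lemma gate_tag_cases:
  assumes "circuit C" "i < length C" "C ! i \<noteq> Input"
  obtains j where "C ! i = Not_Gate j"
  | "gate_tag (C ! i) = 2" "\<And>v. gate_value (C ! i) i v \<longleftrightarrow> (\<forall>j\<in>set (preds (C ! i)). v j)"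
  | "gate_tag (C ! i) = 3" "\<And>v. gate_value (C ! i) i v \<longleftrightarrow> (\<exists>j\<in>set (preds (C ! i)). v j)"
  using assms(3) by (cases "C ! i") auto

text \<open>Values are fixed in topological order; gates refer to smaller positions only, so a later
  value never disturbs an earlier one.\<close>

lemma valuation_exists:
  assumes "circuit C"
  obtains v where "valuation C v" "\<And>i. i < length C \<Longrightarrow> C ! i = Input \<Longrightarrow> v i = A i"
proof -
  have "\<exists>v. \<forall>i<n. v i = (if C ! i = Input then A i else gate_value (C ! i) i v)" if "n \<le> length C" for n
    using that
  proof (induction n)
    case (Suc n)
    then obtain v where v: "\<forall>i<n. v i = (if C ! i = Input then A i else gate_value (C ! i) i v)" by auto
    let ?v = "v(n := if C ! n = Input then A n else gate_value (C ! n) n v)"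
    have cong: "gate_value (C ! i) i ?v = gate_value (C ! i) i v" if "i \<le> n" "C ! i \<noteq> Input" for i
    proof -
      have "\<forall>j\<in>set (preds (C ! i)). ?v j = v j"
        using circuitD(2) [OF assms, of i] that Suc.prems by fastforce
      then show ?thesis using that(2) by (cases "C ! i") auto
    qed
    have "\<forall>i<Suc n. ?v i = (if C ! i = Input then A i else gate_value (C ! i) i ?v)"
      using v cong by (auto simp: less_Suc_eq simp del: fun_upd_apply) (auto simp: fun_upd_apply)
    then show ?case by blast
  qed simp
  then obtain v where v: "\<forall>i<length C. v i = (if C ! i = Input then A i else gate_value (C ! i) i v)"
    by blast
  show thesis
  proof
    show "valuation C v" unfolding valuation_def using v by auto
    show "v i = A i" if "i < length C" "C ! i = Input" for i using v that by simp
  qed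
qed

text \<open>Below \<open>i\<close> lies a binary tree of small gates with at most
  \<open>2 ^ e\<close> leaves; an input leaf costs two choices at most and a large leaf one.
  \<open>M\<close> allows two uses: nodes with nothing large below, where \<open>big\<close> is
  vacuous, and nodes above the guessed gates, once the guesses are known to be true. The quantifier
  over \<open>t\<close> leaves room for the guess under test.\<close>

lemma certificate_exists:
  assumes C: "circuit C" and v: "valuation C v"
    and inp: "\<And>i. i \<in> M \<Longrightarrow> C ! i = Input \<Longrightarrow>
      \<exists>s\<subseteq>T. finite s \<and> card s \<le> 2 \<and> (\<forall>t. s \<subseteq> set t \<longrightarrow> certifies_input k t (v i) i)"
    and big: "\<And>i. i \<in> M \<Longrightarrow> large (C ! i) \<Longrightarrow> \<exists>w. (if v i then 1 else 2, i, w) \<in> T"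
    and closed: "\<And>i j. i \<in> M \<Longrightarrow> \<not> large (C ! i) \<Longrightarrow> j \<in> set (preds (C ! i)) \<Longrightarrow> j \<in> M"
    and M: "M \<subseteq> {..<length C}"
  shows "i \<in> M \<Longrightarrow> depth_le e C i \<Longrightarrow>
    \<exists>s\<subseteq>T. finite s \<and> card s \<le> 2 ^ Suc e \<and> (\<forall>t. s \<subseteq> set t \<longrightarrow> certifies e k t C (v i) i)"
proof (induction e arbitrary: i)
  case 0
  then have "i < length C" "preds (C ! i) = []" using M by auto
  then have "C ! i = Input" using preds_Nil_iff circuitD(1) [OF C] by blast
  then show ?case using inp [OF 0(1)] \<open>i < length C\<close> by simp
next
  case (Suc e)
  have i: "i < length C" using Suc.prems M by auto
  have dep: "depth_le e C j" if "j \<in> set (preds (C ! i))" for j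
    using Suc.prems i that by simp
  let ?P = "\<lambda>s j. s \<subseteq> T \<and> finite s \<and> card s \<le> 2 ^ Suc e \<and> (\<forall>t. s \<subseteq> set t \<longrightarrow> certifies e k t C (v j) j)"
  consider "C ! i = Input" | "large (C ! i)" | "C ! i \<noteq> Input" "\<not> large (C ! i)" by blast
  then show ?case
  proof cases
    case 1
    then obtain s where "s \<subseteq> T" "finite s" "card s \<le> 2" "\<forall>t. s \<subseteq> set t \<longrightarrow> certifies_input k t (v i) i"
      using inp [OF Suc.prems(1)] by blast
    moreover have "(2 :: nat) \<le> 2 ^ Suc (Suc e)" by simp
    ultimately have "s \<subseteq> T \<and> finite s \<and> card s \<le> 2 ^ Suc (Suc e) \<and>
        (\<forall>t. s \<subseteq> set t \<longrightarrow> certifies (Suc e) k t C (v i) i)"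
      using 1 i by (auto intro: le_trans)
    then show ?thesis by blast
  next
    case 2
    then obtain w where w: "(if v i then 1 else 2, i, w) \<in> T" using big [OF Suc.prems(1)] by blast
    have "C ! i \<noteq> Input" using 2 by (auto simp: large_def)
    then show ?thesis using w 2 i
      by (intro exI [of _ "{(if v i then 1 else 2, i, w)}"]) (auto intro!: bexI [of _ "(if v i then 1 else 2, i, w)"] split: if_splits)
  next
    case 3
    have ex: "\<exists>s. ?P s j" if "j \<in> set (preds (C ! i))" for j
      using Suc.IH [OF closed [OF Suc.prems(1) 3(2) that] dep [OF that]] .
    \<comment> \<open>\<open>one\<close> serves gate values forced by a single in-neighbour;
      \<open>all\<close> serves those that need every in-neighbour, of which a small gate has at
      most two, so the bound doubles.\<close>
    have one: "\<exists>s\<subseteq>T. finite s \<and> card s \<le> 2 ^ Suc (Suc e) \<and> (\<forall>t. s \<subseteq> set t \<longrightarrow> certifies e k t C (v j) j)"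
      if "j \<in> set (preds (C ! i))" for j
    proof -
      have "(2 :: nat) ^ Suc e \<le> 2 ^ Suc (Suc e)" by simp
      then show ?thesis using ex [OF that] le_trans by blast
    qed
    have all: "\<exists>s\<subseteq>T. finite s \<and> card s \<le> 2 ^ Suc (Suc e) \<and>
        (\<forall>t. s \<subseteq> set t \<longrightarrow> (\<forall>j\<in>set (preds (C ! i)). certifies e k t C (v j) j))"
    proof -
      obtain f where f: "\<And>j. j \<in> set (preds (C ! i)) \<Longrightarrow> ?P (f j) j" using ex by metis
      let ?s = "\<Union>j\<in>set (preds (C ! i)). f j"
      have "card ?s \<le> (\<Sum>j\<in>set (preds (C ! i)). card (f j))" by (rule card_UN_le) simp
      also have "\<dots> \<le> (\<Sum>j\<in>set (preds (C ! i)). 2 ^ Suc e)" by (rule sum_mono) (use f in blast)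
      also have "\<dots> = card (set (preds (C ! i))) * 2 ^ Suc e" by simp
      also have "\<dots> \<le> 2 * 2 ^ Suc e"
        using 3(2) card_length [of "preds (C ! i)"] by (intro mult_right_mono) (auto simp: large_def)
      finally have "card ?s \<le> 2 ^ Suc (Suc e)" by simp
      then show ?thesis using f by (intro exI [of _ ?s]) blast
    qed
    from C i 3(1) show ?thesis
    proof (cases rule: gate_tag_cases)
      case (1 j)
      then have "v i = (\<not> v j)" using valuationD [OF v i] by simp
      then show ?thesis using one [of j] 1 i by (simp add: large_def)
    next
      case 2
      have vi: "v i \<longleftrightarrow> (\<forall>j\<in>set (preds (C ! i)). v j)" using valuationD [OF v i] 2 by simp
      show ?thesis
      proof (cases "v i")
        case True
        then show ?thesis using all vi 2(1) 3 i by simp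
      next
        case False
        then obtain j where "j \<in> set (preds (C ! i))" "\<not> v j" using vi by blast
        then show ?thesis using one [of j] False 2(1) 3 i by simp blast
      qed
    next
      case or: 3
      have vi: "v i \<longleftrightarrow> (\<exists>j\<in>set (preds (C ! i)). v j)" using valuationD [OF v i] or by simp
      show ?thesis
      proof (cases "v i")
        case False
        then show ?thesis using all vi or(1) 3 i by simp
      next
        case True
        then obtain j where "j \<in> set (preds (C ! i))" "v j" using vi by blast
        then show ?thesis using one [of j] True or(1) 3 i by simp blast
      qed
    qed
  qed
qed

text \<open>If the members of \<open>t\<close> tell the truth about \<open>v\<close>, then so does
  everything derived from them; the hypotheses \<open>inp\<close> and \<open>big\<close> express
  this truthfulness.\<close>

lemma certifies_sound:
  assumes C: "circuit C" and v: "valuation C v"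
    and inp: "\<And>i b. i < length C \<Longrightarrow> C ! i = Input \<Longrightarrow> certifies_input k t b i \<Longrightarrow> v i = b"
    and big: "\<And>b L w. (b, L, w) \<in> set t \<Longrightarrow> b \<noteq> 0 \<Longrightarrow> v L \<longleftrightarrow> b = 1"
  shows "i < length C \<Longrightarrow> certifies e k t C b i \<Longrightarrow> v i = b"
proof (induction e arbitrary: i b)
  case 0
  then show ?case using inp [of i b] by simp
next
  case (Suc e)
  have IH: "v j = b" if "j \<in> set (preds (C ! i))" "certifies e k t C b j" for j b
    using Suc.IH that circuitD(3) [OF C Suc.prems(1)] by blast
  show ?case
  proof (cases "C ! i = Input \<or> large (C ! i)")
    case True
    then show ?thesis
    proof
      assume "C ! i = Input"
      then show ?thesis using inp [of i b] Suc.prems by simp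
    next
      assume *: "large (C ! i)"
      then have "C ! i \<noteq> Input" by (auto simp: large_def)
      then obtain w where "(if b then 1 else 2, i, w) \<in> set t" using * Suc.prems by fastforce
      then show ?thesis using big by (cases b) force+
    qed
  next
    case False
    with C Suc.prems(1) have "C ! i \<noteq> Input" "\<not> large (C ! i)" by auto
    from C Suc.prems(1) this(1) show ?thesis
    proof (cases rule: gate_tag_cases)
      case (1 j)
      then have "certifies e k t C (\<not> b) j" using Suc.prems False by simp
      then have "v j = (\<not> b)" using IH 1 by simp
      then show ?thesis using valuationD [OF v Suc.prems(1)] 1 by simp
    next
      case 2
      have "v i \<longleftrightarrow> (\<forall>j\<in>set (preds (C ! i)). v j)" using valuationD [OF v Suc.prems(1)] 2 by simp
      moreover have "if b then \<forall>j\<in>set (preds (C ! i)). certifies e k t C b j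
          else \<exists>j\<in>set (preds (C ! i)). certifies e k t C b j"
        using Suc.prems 2(1) False by (simp split: if_splits)
      ultimately show ?thesis using IH by (cases b) (simp, metis)+
    next
      case 3
      have "v i \<longleftrightarrow> (\<exists>j\<in>set (preds (C ! i)). v j)" using valuationD [OF v Suc.prems(1)] 3 by simp
      moreover have "if b then \<exists>j\<in>set (preds (C ! i)). certifies e k t C b j
          else \<forall>j\<in>set (preds (C ! i)). certifies e k t C b j"
        using Suc.prems 3(1) False by (simp split: if_splits)
      ultimately show ?thesis using IH by (cases b) (simp, metis)+
    qed
  qed
qed

section \<open>Weighted satisfiability as a choice problem\<close>

lemma large_preds_not_Nil: "large g \<Longrightarrow> preds g \<noteq> []"
  by (auto simp: large_def)

text \<open>Select the true statements about a satisfying valuation: the ranks of its true inputs,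
  and for each guessed gate its value with a suitable witness. By soundness no set of true
  statements is bad, whatever its size.\<close>

lemma sat_imp_choices:
  assumes C: "circuit C" and dep: "depth_le d C (length C - 1)" and weft: "weft_le d 1 C (length C - 1)"
    and sat: "has_weighted_sat C k"
  shows "\<exists>X\<subseteq>set (choices d k C). k + length (guessed d C) \<le> card X \<and> (\<forall>t. set t \<subseteq> X \<longrightarrow> \<not> bad d k C t)"
proof -
  obtain v where v: "valuation C v" "v (length C - 1)"
    and card: "card {i. i < length C \<and> C ! i = Input \<and> v i} = k"
    using sat unfolding has_weighted_sat_def by blast
  define K where "K = {i. i < length C \<and> C ! i = Input \<and> v i}"
  define as where "as = sorted_list_of_set K"
  have "finite K" by (simp add: K_def)
  then have set_as: "set as = K" and len_as: "length as = k" and "sorted_wrt (<) as"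
    using card by (simp_all add: as_def K_def)
  then have as_mono: "as ! i < as ! j" if "i < j" "j < k" for i j
    using that sorted_wrt_nth_less by blast
  then have as_less: "i < j" if "as ! i < as ! j" "i < k" for i j
    using that by (metis linorder_neqE_nat order_less_asym)
  have out: "length C - 1 < length C" using C by (simp add: circuit_def)
  let ?G = "set (guessed d C)"
  have large: "large (C ! L)" if "L \<in> ?G" for L
    using top_gates_below [OF C out _ dep weft] that set_guessed [OF C] by blast
  \<comment> \<open>The premise describes a false And or a true Or, whose value is caused by some
    in-neighbour of the same value. In the other cases any in-neighbour will do, and a large gate
    has one.\<close>
  have "\<exists>w\<in>set (preds (C ! L)). (gate_tag (C ! L) = 2) \<noteq> v L \<longrightarrow> v w = v L" if L: "L \<in> ?G" for L
  proof -
    obtain w where ne: "w \<in> set (preds (C ! L))"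
      using large_preds_not_Nil [OF large [OF L]] last_in_set by blast
    have less: "L < length C" using guessed_less [OF L] .
    have "C ! L \<noteq> Input" "\<And>j. C ! L \<noteq> Not_Gate j" using large [OF L] by (auto simp: large_def)
    with C less show ?thesis
    proof (cases rule: gate_tag_cases)
      case 2
      then show ?thesis using valuationD [OF v(1) less] ne by (cases "v L") auto
    next
      case 3
      then show ?thesis using valuationD [OF v(1) less] ne by (cases "v L") auto
    qed auto
  qed
  then obtain wit where wit: "\<And>L. L \<in> ?G \<Longrightarrow> wit L \<in> set (preds (C ! L))"
    "\<And>L. L \<in> ?G \<Longrightarrow> (gate_tag (C ! L) = 2) \<noteq> v L \<Longrightarrow> v (wit L) = v L"
    by metis
  define X1 where "X1 = (\<lambda>j. (0 :: nat, j, as ! j)) ` {..<k}"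
  define X2 where "X2 = (\<lambda>L. (if v L then 1 else 2 :: nat, L, wit L)) ` ?G"
  have "card X1 = k" unfolding X1_def by (subst card_image) (auto simp: inj_on_def)
  moreover have "card X2 = length (guessed d C)"
    unfolding X2_def by (subst card_image) (auto simp: inj_on_def distinct_card distinct_guessed)
  moreover have "X1 \<inter> X2 = {}" by (auto simp: X1_def X2_def split: if_splits)
  ultimately have card_X: "card (X1 \<union> X2) = k + length (guessed d C)"
    by (simp add: card_Un_disjoint X1_def X2_def)
  have as_K: "as ! j \<in> K" if "j < k" for j using set_as len_as that nth_mem by blast
  have sub: "X1 \<union> X2 \<subseteq> set (choices d k C)"
    using as_K wit(1) unfolding choices_def set_append set_input_choices set_gate_choices X1_def X2_def K_def
    by (auto split: if_splits)
  have "\<not> bad d k C t" if t: "set t \<subseteq> X1 \<union> X2" for t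
  proof -
    have inp: "v i = b" if i: "i < length C" "C ! i = Input" and c: "certifies_input k t b i" for i b
    proof (cases b)
      case True
      then obtain u where "u \<in> set t" "fst u = 0" "snd (snd u) = i"
        using c by (auto simp: certifies_input_def)
      then obtain j where "j < k" "i = as ! j" using t by (auto simp: X1_def X2_def split: if_splits)
      then show ?thesis using as_K True by (auto simp: K_def)
    next
      case False
      then obtain j where j: "j \<le> k"
        "j = 0 \<or> (\<exists>u\<in>set t. fst u = 0 \<and> Suc (fst (snd u)) = j \<and> snd (snd u) < i)"
        "j = k \<or> (\<exists>u\<in>set t. fst u = 0 \<and> fst (snd u) = j \<and> i < snd (snd u))"
        using c unfolding certifies_input_def by (metis atLeastLessThan_iff less_Suc_eq_le set_upt)
      have lo: "j = 0 \<or> j - 1 < k \<and> as ! (j - 1) < i"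
      proof (cases "j = 0")
        case False
        then obtain u where "u \<in> set t" "fst u = 0" "Suc (fst (snd u)) = j" "snd (snd u) < i"
          using j(2) by blast
        then show ?thesis using t by (auto simp: X1_def X2_def split: if_splits)
      qed simp
      have hi: "j = k \<or> i < as ! j"
      proof (cases "j = k")
        case False
        then obtain u where "u \<in> set t" "fst u = 0" "fst (snd u) = j" "i < snd (snd u)"
          using j(3) by blast
        then show ?thesis using t by (auto simp: X1_def X2_def split: if_splits)
      qed simp
      \<comment> \<open>A true input would have a rank strictly above \<open>j - 1\<close> and
        strictly below \<open>j\<close>.\<close>
      have "i \<notin> K"
      proof
        assume "i \<in> K"
        then obtain m where m: "m < k" "i = as ! m"
          using set_as len_as by (metis in_set_conv_nth)
        have "j = 0 \<or> j - 1 < m" using lo as_less m by blast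
        moreover have "j = k \<or> m < j" using hi as_less m by blast
        ultimately show False using m by linarith
      qed
      then show ?thesis using False i by (simp add: K_def)
    qed
    have big: "v L \<longleftrightarrow> b = 1" if "(b, L, w) \<in> set t" "b \<noteq> 0" for b L w
    proof -
      have "(b, L, w) \<in> X1 \<union> X2" using t that(1) by blast
      then show ?thesis
      proof
        assume "(b, L, w) \<in> X1"
        then show ?thesis using that(2) by (auto simp: X1_def)
      next
        assume "(b, L, w) \<in> X2"
        then have "b = (if v L then 1 else 2)" by (auto simp: X2_def)
        then show ?thesis by simp
      qed
    qed
    have sound: "v i = b" if "certifies d k t C b i" "i < length C" for b i
      by (rule certifies_sound [OF C v(1) inp big that(2,1)])
    have "\<not> conflict x y" if "x \<in> set t" "y \<in> set t" for x y
    proof -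
      have "x \<in> X1 \<union> X2" "y \<in> X1 \<union> X2" using that t by blast+
      then show ?thesis
        unfolding X1_def X2_def conflict_def by (auto split: if_splits dest: as_mono)
    qed
    moreover have "\<not> certifies d k t C False (length C - 1)"
      using sound [OF _ out] v(2) by blast
    moreover have "\<not> refuted d k C t u" if "u \<in> set t" for u
    proof
      assume r: "refuted d k C t u"
      then have "fst u \<noteq> 0" by (simp add: refuted_def)
      moreover have "u \<in> X1 \<union> X2" using t that by blast
      ultimately have "u \<in> X2" by (auto simp: X1_def)
      then obtain L where L: "L \<in> ?G" "u = (if v L then 1 else 2, L, wit L)"
        by (auto simp: X2_def)
      have less: "L < length C" using guessed_less [OF L(1)] .
      have "C ! L \<noteq> Input" "\<And>j. C ! L \<noteq> Not_Gate j" using large [OF L(1)] by (auto simp: large_def)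
      have r': "if gate_tag (C ! L) = 2 \<longleftrightarrow> v L then \<exists>w\<in>set (preds (C ! L)). certifies d k t C (\<not> v L) w
          else certifies d k t C (\<not> v L) (wit L)"
        using r less unfolding refuted_def L(2) by (auto split: if_splits)
      have lessw: "w < length C" if "w \<in> set (preds (C ! L))" for w
        using circuitD(3) [OF C less that] .
      show False
      \<comment> \<open>First case: all in-neighbours share the value of the gate, so by soundness
        none is certified to the contrary. Second case: the witness was picked with the value of the
        gate.\<close>
      proof (cases "gate_tag (C ! L) = 2 \<longleftrightarrow> v L")
        case True
        then obtain w where w: "w \<in> set (preds (C ! L))" "v w = (\<not> v L)"
          using r' sound lessw by (metis (full_types))
        from C less \<open>C ! L \<noteq> Input\<close> show False
        proof (cases rule: gate_tag_cases)
          case 2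
          then show False using valuationD [OF v(1) less] w True by auto
        next
          case 3
          then show False using valuationD [OF v(1) less] w True by auto
        qed (use \<open>\<And>j. C ! L \<noteq> Not_Gate j\<close> in auto)
      next
        case False
        then show False using r' sound [of "\<not> v L" "wit L"] lessw wit [OF L(1)] by auto
      qed
    qed
    ultimately show ?thesis unfolding bad_def by blast
  qed
  then show ?thesis using sub card_X by (intro exI [of _ "X1 \<union> X2"]) auto
qed

text \<open>Counting fills every slot with one choice, and the ranks then define an assignment of
  weight \<open>k\<close>. Guesses are shown to be true before the output is examined, because
  certifying the output relies on them. The length bound is one certificate,
  \<open>2 ^ Suc d\<close> choices, plus the guess that it refutes.\<close>

lemma choices_imp_sat:
  assumes C: "circuit C" and dep: "depth_le d C (length C - 1)" and weft: "weft_le d 1 C (length C - 1)"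
    and X: "X \<subseteq> set (choices d k C)" and card: "k + length (guessed d C) \<le> card X"
    and good: "\<And>t. set t \<subseteq> X \<Longrightarrow> length t \<le> Suc (2 ^ Suc d) \<Longrightarrow> \<not> bad d k C t"
  shows "has_weighted_sat C k"
proof -
  have out: "length C - 1 < length C" using C by (simp add: circuit_def)
  have finX: "finite X" using X finite_subset by blast
  let ?G = "set (guessed d C)"
  have nconf: "\<not> conflict x y" if "x \<in> X" "y \<in> X" for x y
    using good [of "[x, y]"] that by (auto simp: bad_def)
  have X_cases: "(\<exists>j a. u = (0, j, a) \<and> j < k \<and> a < length C \<and> C ! a = Input) \<or>
      (\<exists>b L w. u = (b, L, w) \<and> (b = 1 \<or> b = 2) \<and> L \<in> ?G \<and> w \<in> set (preds (C ! L)))" if "u \<in> X" for u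
    using X that unfolding choices_def set_append set_input_choices set_gate_choices by blast
  \<comment> \<open>The slot of a choice: a rank or a guessed gate. The Boolean separates ranks from
    gate positions, as both are numbers.\<close>
  define block where "block = (\<lambda>u :: choice. (fst u = 0, fst (snd u)))"
  have inj: "inj_on block X"
  proof (rule inj_onI)
    fix x y assume xy: "x \<in> X" "y \<in> X" "block x = block y"
    obtain b i c where x: "x = (b, i, c)" by (cases x) auto
    obtain b' i' c' where y: "y = (b', i', c')" by (cases y) auto
    have "(b = 0) = (b' = 0)" "i = i'" using xy(3) by (simp_all add: block_def x y)
    moreover have "\<not> conflict x y" using xy nconf by blast
    ultimately show "x = y"
      by (cases "b = 0") (simp_all add: conflict_def x y)
  qed
  have sub: "block ` X \<subseteq> {True} \<times> {..<k} \<union> {False} \<times> ?G"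
  proof (rule image_subsetI)
    fix u assume "u \<in> X"
    from X_cases [OF this] show "block u \<in> {True} \<times> {..<k} \<union> {False} \<times> ?G"
      by (elim disjE exE conjE) (simp_all add: block_def)
  qed
  have cardB: "card ({True} \<times> {..<k} \<union> {False} \<times> ?G) = k + length (guessed d C)"
    by (subst card_Un_disjoint) (auto simp: card_cartesian_product distinct_card distinct_guessed)
  \<comment> \<open>Pigeonhole: \<open>X\<close> embeds into the slots and has at least as many
    elements as there are slots.\<close>
  have surj: "block ` X = {True} \<times> {..<k} \<union> {False} \<times> ?G"
    by (rule card_seteq) (use sub cardB card card_image [OF inj] in auto)
  have "\<exists>a. (0, j, a) \<in> X" if "j < k" for j
  proof -
    have "(True, j) \<in> block ` X" using surj that by blast
    then obtain u where "u \<in> X" "fst u = 0" "fst (snd u) = j" by (auto simp: block_def)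
    then have "(0, j, snd (snd u)) \<in> X" by (metis prod.collapse)
    then show ?thesis by blast
  qed
  then obtain as where as: "\<And>j. j < k \<Longrightarrow> (0, j, as j) \<in> X" by metis
  have as_inp: "as j < length C \<and> C ! as j = Input" if "j < k" for j
    using X_cases [OF as [OF that]] by auto
  have as_mono: "as i < as j" if "i < j" "j < k" for i j
  proof -
    have "\<not> conflict (0, i, as i) (0, j, as j)" using that by (intro nconf as) auto
    then show ?thesis using that by (simp add: conflict_def)
  qed
  obtain v where v: "valuation C v"
    "\<And>i. i < length C \<Longrightarrow> C ! i = Input \<Longrightarrow> v i = (i \<in> as ` {..<k})"
    by (rule valuation_exists [OF C, of "\<lambda>i. i \<in> as ` {..<k}"]) (rule that)
  have "inj_on as {..<k}"
    by (rule linorder_inj_onI) (use as_mono in force)+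
  moreover have "{i. i < length C \<and> C ! i = Input \<and> v i} = as ` {..<k}"
    using v(2) as_inp by auto
  ultimately have weight: "card {i. i < length C \<and> C ! i = Input \<and> v i} = k"
    by (simp add: card_image)
  have inp: "\<exists>s\<subseteq>X. finite s \<and> card s \<le> 2 \<and> (\<forall>t. s \<subseteq> set t \<longrightarrow> certifies_input k t (v i) i)"
    if i: "i < length C" "C ! i = Input" for i
  proof (cases "v i")
    case True
    then obtain j where j: "j < k" "i = as j" using v(2) [OF i] by blast
    have "certifies_input k t True i" if "(0, j, as j) \<in> set t" for t
      unfolding certifies_input_def using that j(2) by (auto intro!: bexI [of _ "(0, j, as j)"])
    then show ?thesis using True as [OF j(1)]
      by (intro exI [of _ "{(0, j, as j)}"]) simp
  next
    case False
    \<comment> \<open>The gap containing \<open>i\<close>: the rank of the first true input above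
      \<open>i\<close>, or \<open>k\<close> if there is none. By minimality, and since
      \<open>i\<close> is false, the true input of rank \<open>j - 1\<close> lies below
      \<open>i\<close>.\<close>
    define j where "j = (LEAST j. j = k \<or> i < as j)"
    have j: "j = k \<or> i < as j" unfolding j_def by (rule LeastI [of _ k]) simp
    have jk: "j \<le> k" unfolding j_def by (rule Least_le) simp
    have lo: "as (j - 1) < i" if "j \<noteq> 0"
    proof -
      have "\<not> (j - 1 = k \<or> i < as (j - 1))"
        unfolding j_def by (rule not_less_Least) (use that in \<open>simp add: j_def\<close>)
      moreover have "as (j - 1) \<noteq> i"
      proof
        assume "as (j - 1) = i"
        moreover have "j - 1 < k" using jk that by linarith
        ultimately have "i \<in> as ` {..<k}" by blast
        then show False using v(2) [OF i] False by blast
      qed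
      ultimately show ?thesis by linarith
    qed
    define S1 where "S1 = (if j = 0 then {} else {(0 :: nat, j - 1, as (j - 1))})"
    define S2 where "S2 = (if j = k then {} else {(0 :: nat, j, as j)})"
    have S1: "S1 \<subseteq> X" "finite S1" "card S1 \<le> 1"
      using as [of "j - 1"] jk by (cases "j = 0"; simp add: S1_def)+
    have S2: "S2 \<subseteq> X" "finite S2" "card S2 \<le> 1"
      using as [of j] jk by (cases "j = k"; simp add: S2_def)+
    have "certifies_input k t False i" if t: "S1 \<union> S2 \<subseteq> set t" for t
    proof -
      have "j = 0 \<or> (\<exists>u\<in>set t. fst u = 0 \<and> Suc (fst (snd u)) = j \<and> snd (snd u) < i)"
      proof (cases "j = 0")
        case False
        then have "(0, j - 1, as (j - 1)) \<in> set t" using t by (simp add: S1_def)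
        then show ?thesis by (intro disjI2 bexI [of _ "(0, j - 1, as (j - 1))"]) (use lo False in simp_all)
      qed simp
      moreover have "j = k \<or> (\<exists>u\<in>set t. fst u = 0 \<and> fst (snd u) = j \<and> i < snd (snd u))"
      proof (cases "j = k")
        case False
        then have "(0, j, as j) \<in> set t" using t by (simp add: S2_def)
        then show ?thesis by (intro disjI2 bexI [of _ "(0, j, as j)"]) (use j False in simp_all)
      qed simp
      moreover have "j \<in> set [0..<Suc k]" using jk by auto
      ultimately show ?thesis unfolding certifies_input_def if_False by blast
    qed
    moreover have "card (S1 \<union> S2) \<le> 2"
      using card_Un_le [of S1 S2] S1(3) S2(3) by linarith
    moreover have "S1 \<union> S2 \<subseteq> X" "finite (S1 \<union> S2)" using S1 S2 by simp_all
    moreover have "v i = False" using False by simp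
    ultimately show ?thesis by (intro exI [of _ "S1 \<union> S2"]) simp
  qed
  \<comment> \<open>Nodes of weft 0, with any sufficient fuel \<open>e\<close>: the set contains no
    large gate and is closed under in-neighbours, so certificates here use input choices only and
    presuppose no guess.\<close>
  define M0 where "M0 = {i. i < length C \<and> (\<exists>e. depth_le e C i \<and> weft_le e 0 C i)}"
  have M0: "\<not> large (C ! i)" "j \<in> set (preds (C ! i)) \<Longrightarrow> j \<in> M0" if iM: "i \<in> M0" for i j
  proof -
    obtain e where i: "i < length C" and e: "depth_le e C i" "weft_le e 0 C i"
      using iM by (auto simp: M0_def)
    show "\<not> large (C ! i)" using e i by (cases e) (auto simp: large_def)
    assume j: "j \<in> set (preds (C ! i))"
    show "j \<in> M0"
    proof (cases e)
      case 0
      then show ?thesis using e i j by simp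
    next
      case (Suc e')
      then have "depth_le e' C j" "weft_le e' 0 C j"
        using e i j by (simp_all split: if_splits)
      then show ?thesis using circuitD(3) [OF C i j] by (auto simp: M0_def)
    qed
  qed
  have cert0: "\<exists>s\<subseteq>X. finite s \<and> card s \<le> 2 ^ Suc d \<and> (\<forall>t. s \<subseteq> set t \<longrightarrow> certifies d k t C (v i) i)"
    if "i \<in> M0" "depth_le d C i" for i
  proof (rule certificate_exists [OF C v(1), of M0])
    show "\<exists>s\<subseteq>X. finite s \<and> card s \<le> 2 \<and> (\<forall>t. s \<subseteq> set t \<longrightarrow> certifies_input k t (v i) i)"
      if "i \<in> M0" "C ! i = Input" for i
      by (rule inp) (use that in \<open>simp_all add: M0_def\<close>)
    show "\<exists>w. (if v i then 1 else 2, i, w) \<in> X" if "i \<in> M0" "large (C ! i)" for i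
      using M0(1) [OF that(1)] that(2) by simp
    show "j \<in> M0" if "i \<in> M0" "j \<in> set (preds (C ! i))" for i j
      using M0(2) [OF that] .
    show "M0 \<subseteq> {..<length C}" by (auto simp: M0_def)
  qed (rule that)+
  have below: "large (C ! L) \<and> (\<forall>w\<in>set (preds (C ! L)). w \<in> M0 \<and> depth_le d C w)" if L: "L \<in> ?G" for L
  proof -
    have "L \<in> set (top_gates d C (length C - 1))" using L set_guessed [OF C] by blast
    from top_gates_below [OF C out this dep weft] obtain e' where
      "large (C ! L)" "e' < d" "\<forall>w\<in>set (preds (C ! L)). depth_le e' C w \<and> weft_le e' 0 C w" by blast
    then show ?thesis
      using depth_le_mono [of e' C _ d] circuitD(3) [OF C guessed_less [OF L]] by (auto simp: M0_def)
  qed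
  have truth: "v L \<longleftrightarrow> b = 1" if u: "(b, L, w) \<in> X" "b \<noteq> 0" for b L w
  proof (rule ccontr)
    assume wrong: "\<not> (v L \<longleftrightarrow> b = 1)"
    have L: "L \<in> ?G" and w: "w \<in> set (preds (C ! L))" using X_cases [OF u(1)] u(2) by auto
    have less: "L < length C" using guessed_less [OF L] .
    have "C ! L \<noteq> Input" "\<And>j. C ! L \<noteq> Not_Gate j" using below [OF L] by (auto simp: large_def)
    \<comment> \<open>A wrong guess leaves an in-neighbour whose value exposes it. Where the guess
      rests on its witness, the actual value of the gate forces all in-neighbours to the opposite of
      the guess, so the witness itself can be taken.\<close>
    have "\<exists>w'\<in>set (preds (C ! L)). v w' = (\<not> b = 1) \<and> (\<not> (gate_tag (C ! L) = 2 \<longleftrightarrow> b = 1) \<longrightarrow> w' = w)"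
    proof -
      from C less \<open>C ! L \<noteq> Input\<close> show ?thesis
      proof (cases rule: gate_tag_cases)
        case 2
        then show ?thesis using valuationD [OF v(1) less] wrong w by (cases "b = 1") auto
      next
        case 3
        then show ?thesis using valuationD [OF v(1) less] wrong w by (cases "b = 1") auto
      qed (use \<open>\<And>j. C ! L \<noteq> Not_Gate j\<close> in auto)
    qed
    then obtain w' where w': "w' \<in> set (preds (C ! L))" "v w' = (\<not> b = 1)"
      "\<not> (gate_tag (C ! L) = 2 \<longleftrightarrow> b = 1) \<Longrightarrow> w' = w" by blast
    then obtain s where s: "s \<subseteq> X" "finite s" "card s \<le> 2 ^ Suc d"
      "\<And>t. s \<subseteq> set t \<Longrightarrow> certifies d k t C (\<not> b = 1) w'"
      using cert0 [of w'] below [OF L] by auto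
    obtain t where t: "set t = s" "distinct t" using finite_distinct_list [OF s(2)] by blast
    have "refuted d k C ((b, L, w) # t) (b, L, w)"
      using w' s(4) [of "(b, L, w) # t"] t u(2) less unfolding refuted_def by auto
    then have "bad d k C ((b, L, w) # t)" unfolding bad_def by auto
    moreover have "length t \<le> 2 ^ Suc d" using s(3) t distinct_card [of t] by simp
    ultimately show False using good [of "(b, L, w) # t"] t(1) s(1) u(1) by auto
  qed
  \<comment> \<open>The region from the output down to the first large gates. A large member is its
    own top gate and hence guessed, so by \<open>truth\<close> the selected guess gives its actual
    value.\<close>
  define M1 where "M1 = {i. i < length C \<and> (\<exists>e. depth_le e C i \<and> weft_le e 1 C i \<and> set (top_gates e C i) \<subseteq> ?G)}"
  have "\<exists>s\<subseteq>X. finite s \<and> card s \<le> 2 ^ Suc d \<and>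
      (\<forall>t. s \<subseteq> set t \<longrightarrow> certifies d k t C (v (length C - 1)) (length C - 1))"
  proof (rule certificate_exists [OF C v(1), of M1])
    show "\<exists>s\<subseteq>X. finite s \<and> card s \<le> 2 \<and> (\<forall>t. s \<subseteq> set t \<longrightarrow> certifies_input k t (v i) i)"
      if "i \<in> M1" "C ! i = Input" for i
      by (rule inp) (use that in \<open>simp_all add: M1_def\<close>)
    show "\<exists>w. (if v i then 1 else 2, i, w) \<in> X" if iM: "i \<in> M1" and l: "large (C ! i)" for i
    proof -
      obtain e where i: "i < length C" and e: "depth_le e C i" "set (top_gates e C i) \<subseteq> ?G"
        using iM by (auto simp: M1_def)
      have "i \<in> ?G" using e i l by (cases e) (auto simp: large_def)
      then have "(False, i) \<in> block ` X" using surj by blast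
      then obtain b w where u: "(b, i, w) \<in> X" "b \<noteq> 0" unfolding block_def by auto
      then have "b = 1 \<or> b = 2" using X_cases [OF u(1)] by auto
      then have "b = (if v i then 1 else 2)" using truth [OF u] by auto
      then show ?thesis using u by blast
    qed
    show "j \<in> M1" if iM: "i \<in> M1" and l: "\<not> large (C ! i)" and j: "j \<in> set (preds (C ! i))" for i j
    proof -
      obtain e where i: "i < length C" and e: "depth_le e C i" "weft_le e 1 C i" "set (top_gates e C i) \<subseteq> ?G"
        using iM by (auto simp: M1_def)
      show ?thesis
      proof (cases e)
        case 0
        then show ?thesis using e i j by simp
      next
        case (Suc e')
        then have "depth_le e' C j" "weft_le e' 1 C j" "set (top_gates e' C j) \<subseteq> ?G"
          using e i j l by auto
        then show ?thesis using circuitD(3) [OF C i j] by (auto simp: M1_def)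
      qed
    qed
    show "length C - 1 \<in> M1" using dep weft out set_guessed [OF C] by (auto simp: M1_def)
    show "M1 \<subseteq> {..<length C}" by (auto simp: M1_def)
  qed (rule dep)
  then obtain s where s: "s \<subseteq> X" "finite s" "card s \<le> 2 ^ Suc d"
    "\<And>t. s \<subseteq> set t \<Longrightarrow> certifies d k t C (v (length C - 1)) (length C - 1)" by blast
  obtain t where t: "set t = s" "distinct t" using finite_distinct_list [OF s(2)] by blast
  have "length t \<le> Suc (2 ^ Suc d)" using s(3) t distinct_card [of t] by simp
  then have "\<not> bad d k C t" using good [of t] t s(1) by simp
  then have "v (length C - 1)" using s(4) [of t] t unfolding bad_def by (cases "v (length C - 1)") auto
  then show ?thesis unfolding has_weighted_sat_def using v(1) weight by blast
qed

section \<open>Median instances from forbidden sets\<close>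

definition near :: "choice list \<Rightarrow> choice list list \<Rightarrow> nat \<Rightarrow> nat \<Rightarrow> bool" where
  "near U Ts x y \<longleftrightarrow> x < length U \<and> length U \<le> y \<and>
     (\<exists>u\<in>set (nth_or [] Ts (y - length U)). u = nth_or (0, 0, 0) U x)"

definition dst :: "choice list \<Rightarrow> choice list list \<Rightarrow> nat \<Rightarrow> nat \<Rightarrow> rat" where
  "dst U Ts x y = (if x = y then 0 else if near U Ts x y \<or> near U Ts y x then 1 else 2)"

text \<open>
  Facilities are the positions in \<open>U\<close>, clients those in \<open>Ts\<close>. With budget \<open>length Ts\<close> no client
  may have all the facilities in its list closed.
\<close>

definition median_instance :: "choice list \<Rightarrow> choice list list \<Rightarrow> tree" where
  "median_instance U Ts = enc_median [0..<length U] [length U..<length U + length Ts] (dst U Ts)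
     (of_nat (length Ts))"

text \<open>Distances off the diagonal are 1 or 2, and 2 does not exceed 1 + 1, so the triangle
  inequality holds for any symmetric pattern of near pairs.\<close>

lemma dst_metric: "Metric_space M (\<lambda>x y. real_of_rat (dst U Ts x y))"
proof
  show "0 \<le> real_of_rat (dst U Ts x y)" for x y by (simp add: dst_def)
  show "real_of_rat (dst U Ts x y) = real_of_rat (dst U Ts y x)" for x y by (auto simp: dst_def)
  show "real_of_rat (dst U Ts x y) = 0 \<longleftrightarrow> x = y" for x y by (simp add: dst_def)
  show "real_of_rat (dst U Ts x z) \<le> real_of_rat (dst U Ts x y) + real_of_rat (dst U Ts y z)" for x y z
    by (simp add: dst_def)
qed

lemma co_medianI:
  assumes "distinct Fs" "distinct Cs"
    "Metric_space (set Fs \<union> set Cs) (\<lambda>x y. real_of_rat (d x y))"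
    "co_median_solution (set Fs) (set Cs) l S a"
    "median_cost (set Cs) (\<lambda>x y. real_of_rat (d x y)) a \<le> real_of_rat B"
  shows "(enc_median Fs Cs d B, l) \<in> co_median"
  unfolding co_median_def using assms by blast

text \<open>Clients and facilities are disjoint, so every client costs at least 1 and a single
  client at distance 2 already breaks the budget. The closed facilities are the selected choices. An
  empty tuple fits both sides: it is contained in every selection, and its client is near no
  facility.\<close>

lemma median_instance_iff:
  assumes U: "distinct U" and Ts: "\<And>t. t \<in> set Ts \<Longrightarrow> set t \<subseteq> set U"
  shows "(median_instance U Ts, l) \<in> co_median \<longleftrightarrow>
    (\<exists>X\<subseteq>set U. l \<le> card X \<and> (\<forall>t\<in>set Ts. \<not> set t \<subseteq> X))" (is "?L \<longleftrightarrow> ?R")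
proof
  let ?N = "length U" and ?m = "length Ts"
  have inj: "inj_on ((!) U) {..<?N}" using U by (simp add: inj_on_nth)
  have client: "dst U Ts c f = (if U ! f \<in> set (Ts ! (c - ?N)) then 1 else 2)"
    if "f < ?N" "c \<in> {?N..<?N + ?m}" for c f
    using that by (auto simp: dst_def near_def)
  {
    assume ?L
    then obtain Fs Cs d B S a where e: "median_instance U Ts = enc_median Fs Cs d B"
      and sol: "co_median_solution (set Fs) (set Cs) l S a"
      and cost: "median_cost (set Cs) (\<lambda>x y. real_of_rat (d x y)) a \<le> real_of_rat B"
      unfolding co_median_def by blast
    have Fs: "set Fs = {..<?N}" and Cs: "set Cs = {?N..<?N + ?m}" and B: "B = of_nat ?m"
      and d: "\<And>x y. x \<in> set Fs \<union> set Cs \<Longrightarrow> y \<in> set Fs \<union> set Cs \<Longrightarrow> d x y = dst U Ts x y"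
      using e unfolding median_instance_def enc_median_inject by auto
    have S: "S \<subseteq> {..<?N}" "card S + l \<le> ?N" "\<And>c. c \<in> {?N..<?N + ?m} \<Longrightarrow> a c \<in> S"
      using sol unfolding co_median_solution_def Fs Cs by simp_all
    have d': "d c (a c) = (if U ! a c \<in> set (Ts ! (c - ?N)) then 1 else 2)" if "c \<in> {?N..<?N + ?m}" for c
      using that client [of "a c" c] d [of c "a c"] S(1) S(3) [OF that] by (auto simp: Fs Cs)
    have served: "U ! a c \<in> set (Ts ! (c - ?N))" if c: "c \<in> {?N..<?N + ?m}" for c
    proof (rule ccontr)
      assume n: "\<not> ?thesis"
      have "real ?m < (\<Sum>c\<in>{?N..<?N + ?m}. real_of_rat (d c (a c)))"
      proof -
        have "(\<Sum>c\<in>{?N..<?N + ?m}. 1 :: real) < (\<Sum>c\<in>{?N..<?N + ?m}. real_of_rat (d c (a c)))"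
          by (rule sum_strict_mono_ex1) (use c n d' in auto)
        then show ?thesis by simp
      qed
      then show False using cost unfolding median_cost_def Cs B by simp
    qed
    let ?X = "(!) U ` ({..<?N} - S)"
    have "card ?X = ?N - card S"
      using S(1) by (subst card_image) (auto intro: inj_on_subset [OF inj] simp: card_Diff_subset finite_subset)
    then have "l \<le> card ?X" using S(2) by simp
    moreover have "\<not> set t \<subseteq> ?X" if t: "t \<in> set Ts" for t
    proof -
      obtain j where j: "j < ?m" "t = Ts ! j" using t by (auto simp: in_set_conv_nth)
      then have c: "?N + j \<in> {?N..<?N + ?m}" by simp
      have "U ! a (?N + j) \<in> set t" using served [OF c] j by simp
      moreover have "U ! a (?N + j) \<notin> ?X"
      proof
        assume "U ! a (?N + j) \<in> ?X"
        then obtain i where "i < ?N" "i \<notin> S" "U ! i = U ! a (?N + j)" by auto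
        then show False using S(1) S(3) [OF c] inj by (auto dest: inj_onD)
      qed
      ultimately show ?thesis by blast
    qed
    ultimately show ?R by (intro exI [of _ ?X]) auto
  }
  {
    assume ?R
    then obtain X where X: "X \<subseteq> set U" "l \<le> card X" "\<And>t. t \<in> set Ts \<Longrightarrow> \<not> set t \<subseteq> X" by blast
    define S where "S = {i. i < ?N \<and> U ! i \<notin> X}"
    let ?T = "{i. i < ?N \<and> U ! i \<in> X}"
    have "(!) U ` ?T = X"
    proof
      show "X \<subseteq> (!) U ` ?T"
      proof
        fix u assume u: "u \<in> X"
        then obtain i where "i < ?N" "U ! i = u" using X(1) by (metis in_set_conv_nth subsetD)
        then show "u \<in> (!) U ` ?T" using u by blast
      qed
    qed blast
    then have "card X = card ?T"
      using card_image [OF inj_on_subset [OF inj], of ?T] by auto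
    moreover have "card S + card ?T = card (S \<union> ?T)"
      by (subst card_Un_disjoint) (auto simp: S_def)
    moreover have "S \<union> ?T = {..<?N}" by (auto simp: S_def)
    ultimately have cardS: "card S + l \<le> ?N" using X(2) by simp
    have "\<exists>i. i \<in> S \<and> U ! i \<in> set (Ts ! (c - ?N))" if c: "c \<in> {?N..<?N + ?m}" for c
    proof -
      have t: "Ts ! (c - ?N) \<in> set Ts" using c by auto
      obtain u where u: "u \<in> set (Ts ! (c - ?N))" "u \<notin> X" using X(3) [OF t] by blast
      then obtain i where "i < ?N" "u = U ! i" using Ts [OF t] by (metis in_set_conv_nth subsetD)
      then show ?thesis using u by (auto simp: S_def)
    qed
    then obtain a where a: "\<And>c. c \<in> {?N..<?N + ?m} \<Longrightarrow> a c \<in> S \<and> U ! a c \<in> set (Ts ! (c - ?N))" by metis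
    have "dst U Ts c (a c) = 1" if "c \<in> {?N..<?N + ?m}" for c
      using client [OF _ that, of "a c"] a [OF that] by (simp add: S_def)
    then have c1: "median_cost (set [?N..<?N + ?m]) (\<lambda>x y. real_of_rat (dst U Ts x y)) a \<le> real_of_rat (of_nat ?m)"
      unfolding median_cost_def by simp
    have c2: "co_median_solution (set [0..<?N]) (set [?N..<?N + ?m]) l S a"
      unfolding co_median_solution_def using a cardS by (auto simp: S_def)
    show ?L
      unfolding median_instance_def
      by (rule co_medianI [OF distinct_upt distinct_upt dst_metric c2 c1])
  }
qed

text \<open>For fixed \<open>n\<close> there are polynomially many such lists, and the recursion on
  \<open>n\<close> is a composition of constantly many polynomial-time steps.\<close>

fun tuples :: "nat \<Rightarrow> 'a list \<Rightarrow> 'a list list" where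
  "tuples 0 us = [[]]"
| "tuples (Suc n) us = tuples n us @ concat (map (\<lambda>u. map (\<lambda>t. u # t) (tuples n us)) us)"

lemma set_tuples: "set (tuples n us) = {t. set t \<subseteq> set us \<and> length t \<le> n}"
proof (induction n)
  case (Suc n)
  have "t \<in> set (tuples (Suc n) us) \<longleftrightarrow> set t \<subseteq> set us \<and> length t \<le> Suc n" for t
    using Suc by (cases t) auto
  then show ?case by blast
qed auto

section \<open>The reduction\<close>

definition unary :: "tree \<Rightarrow> bool" where
  "unary t \<longleftrightarrow> (\<forall>u\<in>set (kids t). u = Atom)"

definition parse_gate :: "tree \<Rightarrow> gate" where
  "parse_gate t = mk_gate (length (kids (hd_tree t))) (tl_tree t)"

text \<open>Characterizes the codes of gates. \<open>Atom\<close> is excluded explicitly because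
  \<open>hd_tree\<close> and \<open>tl_tree\<close> would make it look like the code of an
  input.\<close>

definition gate_ok :: "tree \<Rightarrow> bool" where
  "gate_ok t \<longleftrightarrow> t \<noteq> Atom \<and> unary (hd_tree t) \<and> length (kids (hd_tree t)) \<le> 3 \<and>
     (length (kids (hd_tree t)) = 0 \<longrightarrow> tl_tree t = Atom) \<and>
     (length (kids (hd_tree t)) = 1 \<longrightarrow> unary (tl_tree t)) \<and>
     (2 \<le> length (kids (hd_tree t)) \<longrightarrow> (\<forall>u\<in>set (kids (tl_tree t)). unary u))"

lemma kids_enc_unary [simp]: "kids (enc_unary n) = replicate n Atom"
  by (simp add: enc_unary_def)

lemma unary_enc_unary [simp]: "unary (enc_unary n)"
  by (simp add: unary_def)

lemma enc_unary_length: "unary t \<Longrightarrow> enc_unary (length (kids t)) = t"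
proof -
  assume "unary t"
  then have "replicate (length (kids t)) Atom = kids t"
    by (intro replicate_eqI [symmetric]) (auto simp: unary_def)
  then show ?thesis by (simp add: enc_unary_def)
qed

lemma gate_ok_enc_gate: "gate_ok (enc_gate g)"
  by (cases g) (auto simp: gate_ok_def)

lemma parse_gate_enc_gate: "parse_gate (enc_gate g) = g"
  by (cases g) (auto simp: parse_gate_def mk_gate_def comp_def)

lemma enc_gate_parse_gate:
  assumes "gate_ok t"
  shows "enc_gate (parse_gate t) = t"
proof -
  from assms obtain a b where t: "t = Pair a b" by (cases t) (auto simp: gate_ok_def)
  define n where "n = length (kids a)"
  have a: "a = enc_unary n" using assms enc_unary_length by (simp add: gate_ok_def t n_def)
  have "n \<le> 3" using assms by (simp add: gate_ok_def t n_def)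
  then consider "n = 0" | "n = 1" | "n = 2" | "n = 3" by linarith
  then show ?thesis
  proof cases
    case 1
    then show ?thesis using assms by (simp add: parse_gate_def mk_gate_def gate_ok_def t a)
  next
    case 2
    then show ?thesis using assms enc_unary_length [of b]
      by (simp add: parse_gate_def mk_gate_def gate_ok_def t a)
  next
    case 3
    then have "\<forall>u\<in>set (kids b). enc_unary (length (kids u)) = u"
      using assms enc_unary_length by (simp add: gate_ok_def t a)
    then show ?thesis using 3
      by (simp add: parse_gate_def mk_gate_def t a comp_def cong: map_cong)
  next
    case 4
    then have "\<forall>u\<in>set (kids b). enc_unary (length (kids u)) = u"
      using assms enc_unary_length by (simp add: gate_ok_def t a)
    then show ?thesis using 4
      by (simp add: parse_gate_def mk_gate_def t a comp_def cong: map_cong)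
  qed
qed

definition parse_circuit :: "tree \<Rightarrow> circuit" where
  "parse_circuit x = map (\<lambda>t. parse_gate t) (kids x)"

definition valid_input :: "nat \<Rightarrow> tree \<Rightarrow> bool" where
  "valid_input d x \<longleftrightarrow> (\<forall>t\<in>set (kids x). gate_ok t) \<and> circuit (parse_circuit x) \<and>
     depth_le d (parse_circuit x) (length (parse_circuit x) - 1) \<and>
     weft_le d 1 (parse_circuit x) (length (parse_circuit x) - 1)"

lemma parse_circuit_enc_circuit: "parse_circuit (enc_circuit C) = C"
  by (simp add: parse_circuit_def enc_circuit_def parse_gate_enc_gate comp_def)

lemma enc_circuit_parse_circuit: "\<forall>t\<in>set (kids x). gate_ok t \<Longrightarrow> enc_circuit (parse_circuit x) = x"
  by (simp add: parse_circuit_def enc_circuit_def enc_gate_parse_gate comp_def cong: map_cong)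

lemma input_output_path_iff: "input_output_path C ps \<longleftrightarrow> path_to C (length C - 1) ps"
  by (auto simp: input_output_path_def path_to_def)

text \<open>Membership splits into a syntactic test, decidable in polynomial time for fixed
  \<open>d\<close>, and satisfiability. Once the depth test has succeeded, fuel \<open>d\<close>
  suffices for the weft test.\<close>

lemma weighted_circuit_sat_iff:
  "(x, k) \<in> weighted_circuit_sat 1 d \<longleftrightarrow> valid_input d x \<and> has_weighted_sat (parse_circuit x) k"
proof -
  have *: "weft_at_most 1 C \<and> depth_at_most d C \<longleftrightarrow>
      depth_le d C (length C - 1) \<and> weft_le d 1 C (length C - 1)" if C: "circuit C" for C
  proof -
    have "length C - 1 < length C" using C by (simp add: circuit_def)
    then show ?thesis
      using depth_le_iff_paths [OF C] weft_le_iff_paths [OF C]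
      unfolding weft_at_most_def depth_at_most_def input_output_path_iff by blast
  qed
  show ?thesis
  proof
    assume "(x, k) \<in> weighted_circuit_sat 1 d"
    then obtain C where C: "x = enc_circuit C" "circuit C" "weft_at_most 1 C \<and> depth_at_most d C"
      "has_weighted_sat C k"
      unfolding weighted_circuit_sat_def by blast
    have "\<forall>t\<in>set (kids x). gate_ok t" by (auto simp: C(1) enc_circuit_def gate_ok_enc_gate)
    then show "valid_input d x \<and> has_weighted_sat (parse_circuit x) k"
      using C(2-4) * [OF C(2)] by (simp add: valid_input_def C(1) parse_circuit_enc_circuit)
  next
    assume R: "valid_input d x \<and> has_weighted_sat (parse_circuit x) k"
    then have "x = enc_circuit (parse_circuit x)"
      by (simp add: valid_input_def enc_circuit_parse_circuit)
    then show "(x, k) \<in> weighted_circuit_sat 1 d"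
      using R * [of "parse_circuit x"] unfolding weighted_circuit_sat_def valid_input_def by blast
  qed
qed

text \<open>
  The output and the in-neighbours of guessed gates depend on at most \<open>2 ^ d\<close> inputs and guessed
  gates. Two choices certify the value of an input, one that of a guessed gate, and one more choice
  is the guess to be refuted.
\<close>

definition bad_tuples :: "nat \<Rightarrow> nat \<Rightarrow> circuit \<Rightarrow> choice list list" where
  "bad_tuples d k C = filter (\<lambda>t. bad d k C t) (tuples (Suc (2 ^ Suc d)) (choices d k C))"

text \<open>Invalid inputs go to a fixed no-instance: with no facility at all, none can be
  closed.\<close>

definition reduction :: "nat \<Rightarrow> tree \<times> nat \<Rightarrow> tree \<times> nat" where
  "reduction d z = (if valid_input d (fst z)
     then (median_instance (choices d (snd z) (parse_circuit (fst z))) (bad_tuples d (snd z) (parse_circuit (fst z))),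
       snd z + length (guessed d (parse_circuit (fst z))))
     else (median_instance [] [], 1))"

lemma reduction_correct:
  "(x, k) \<in> weighted_circuit_sat 1 d \<longleftrightarrow> reduction d (x, k) \<in> co_median"
proof (cases "valid_input d x")
  case False
  have "(median_instance [] [], 1) \<notin> co_median"
    by (subst median_instance_iff) auto
  then show ?thesis using False unfolding weighted_circuit_sat_iff reduction_def by simp
next
  case True
  define C where "C = parse_circuit x"
  have C: "circuit C" "depth_le d C (length C - 1)" "weft_le d 1 C (length C - 1)"
    using True by (simp_all add: valid_input_def C_def)
  have bad_sub: "set t \<subseteq> set (choices d k C)" if "t \<in> set (bad_tuples d k C)" for t
    using that by (auto simp: bad_tuples_def set_tuples)
  have "reduction d (x, k) \<in> co_median \<longleftrightarrow> (\<exists>X\<subseteq>set (choices d k C).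
      k + length (guessed d C) \<le> card X \<and> (\<forall>t\<in>set (bad_tuples d k C). \<not> set t \<subseteq> X))"
    using True median_instance_iff [OF distinct_choices [OF C(1)] bad_sub]
    by (simp add: reduction_def C_def)
  also have "\<dots> \<longleftrightarrow> has_weighted_sat C k"
  proof
    assume "\<exists>X\<subseteq>set (choices d k C).
      k + length (guessed d C) \<le> card X \<and> (\<forall>t\<in>set (bad_tuples d k C). \<not> set t \<subseteq> X)"
    then obtain X where X: "X \<subseteq> set (choices d k C)" "k + length (guessed d C) \<le> card X"
      "\<And>t. t \<in> set (bad_tuples d k C) \<Longrightarrow> \<not> set t \<subseteq> X" by blast
    have "\<not> bad d k C t" if "set t \<subseteq> X" "length t \<le> Suc (2 ^ Suc d)" for t
      using X(1) X(3) [of t] that unfolding bad_tuples_def set_filter set_tuples by blast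
    then show "has_weighted_sat C k" using choices_imp_sat [OF C X(1,2)] by blast
  next
    assume "has_weighted_sat C k"
    then obtain X where X: "X \<subseteq> set (choices d k C)" "k + length (guessed d C) \<le> card X"
      "\<And>t. set t \<subseteq> X \<Longrightarrow> \<not> bad d k C t"
      using sat_imp_choices [OF C] by blast
    then show "\<exists>X\<subseteq>set (choices d k C).
      k + length (guessed d C) \<le> card X \<and> (\<forall>t\<in>set (bad_tuples d k C). \<not> set t \<subseteq> X)"
      by (intro exI [of _ X]) (auto simp: bad_tuples_def)
  qed
  finally show ?thesis using True unfolding weighted_circuit_sat_iff C_def by simp
qed

text \<open>There are at most \<open>2 ^ d\<close> guessed gates, and \<open>1 \<le> 2 ^ d\<close>
  covers the no-instance.\<close>

lemma reduction_parameter: "snd (reduction d (x, k)) \<le> k + 2 ^ d"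
  using length_guessed one_le_power [of "2 :: nat" d] by (simp add: reduction_def add_increasing)

section \<open>The reduction runs in polynomial time\<close>

lemma polytime_comp3:
  assumes "polytime (\<lambda>z. h (fst z) (fst (snd z)) (snd (snd z)))" "polytime a" "polytime b" "polytime c"
  shows "polytime (\<lambda>x. h (a x) (b x) (c x))"
  using polytime_comp [OF polytime_pair [OF assms(2) polytime_pair [OF assms(3,4)]] assms(1)] by simp

lemma polytime_comp5:
  assumes "polytime (\<lambda>z. h (fst z) (fst (snd z)) (fst (snd (snd z))) (fst (snd (snd (snd z)))) (snd (snd (snd (snd z)))))"
    "polytime a" "polytime b" "polytime c" "polytime d" "polytime e"
  shows "polytime (\<lambda>x. h (a x) (b x) (c x) (d x) (e x))"
  using polytime_comp [OF polytime_pair [OF assms(2) polytime_pair [OF assms(3) polytime_pair [OF assms(4) polytime_pair [OF assms(5,6)]]]] assms(1)]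
  by simp

section \<open>Circuit functions and bad tuples\<close>

lemma polytime_gate_at [polytime_intros]: "polytime C \<Longrightarrow> polytime i \<Longrightarrow> polytime (\<lambda>x. gate_at (C x) (i x))"
  unfolding gate_at_def by (intro polytime_intros)

lemma polytime_large [polytime_intros]: "polytime g \<Longrightarrow> polytime (\<lambda>x. large (g x))"
  unfolding large_def by (intro polytime_intros)

text \<open>The fuel is a constant rather than part of the input, so unfolding it nests a fixed
  number of polynomial-time quantifiers. The degree grows with \<open>e\<close>, which is harmless
  as \<open>d\<close> is fixed. The other recursions on fuel are treated alike.\<close>

lemma polytime_depth_le [polytime_intros]:
  assumes "polytime C" "polytime i"
  shows "polytime (\<lambda>x. depth_le e (C x) (i x))"
proof -
  have "polytime (\<lambda>z. depth_le e (fst z) (snd z))"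
  proof (induction e)
    case (Suc e)
    show ?case unfolding depth_le.simps by (intro polytime_intros polytime_comp2 [OF Suc])
  qed (unfold depth_le.simps, intro polytime_intros)
  then show ?thesis by (rule polytime_comp2) (rule assms)+
qed

lemma polytime_weft_le [polytime_intros]:
  assumes "polytime C" "polytime i"
  shows "polytime (\<lambda>x. weft_le e w (C x) (i x))"
proof -
  have "polytime (\<lambda>z. weft_le e w (fst z) (snd z))"
  proof (induction e arbitrary: w)
    case (Suc e)
    show ?case unfolding weft_le.simps by (intro polytime_intros polytime_comp2 [OF Suc])
  qed (unfold weft_le.simps, intro polytime_intros)
  then show ?thesis by (rule polytime_comp2) (rule assms)+
qed

lemma polytime_top_gates [polytime_intros]:
  assumes "polytime C" "polytime i"
  shows "polytime (\<lambda>x. top_gates e (C x) (i x))"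
proof -
  have "polytime (\<lambda>z. top_gates e (fst z) (snd z))"
  proof (induction e)
    case (Suc e)
    show ?case unfolding top_gates.simps by (intro polytime_intros polytime_comp2 [OF Suc])
  qed (unfold top_gates.simps, intro polytime_intros)
  then show ?thesis by (rule polytime_comp2) (rule assms)+
qed

lemma polytime_guessed [polytime_intros]: "polytime C \<Longrightarrow> polytime (\<lambda>x. guessed d (C x))"
proof (erule polytime_comp)
  show "polytime (\<lambda>C. guessed d C)" unfolding guessed_def by (intro polytime_intros)
qed

lemma polytime_certifies_input [polytime_intros]:
  assumes "polytime k" "polytime t" "polytime b" "polytime i"
  shows "polytime (\<lambda>x. certifies_input (k x) (t x) (b x) (i x))"
proof -
  have "polytime (\<lambda>z. certifies_input (fst z) (fst (snd z)) (fst (snd (snd z))) (snd (snd (snd z))))"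
    unfolding certifies_input_def by (intro polytime_intros)
  from polytime_comp [OF polytime_pair [OF assms(1) polytime_pair [OF assms(2) polytime_pair [OF assms(3,4)]]] this]
  show ?thesis by simp
qed

lemma polytime_certifies [polytime_intros]:
  assumes "polytime k" "polytime t" "polytime C" "polytime b" "polytime i"
  shows "polytime (\<lambda>x. certifies e (k x) (t x) (C x) (b x) (i x))"
proof -
  have "polytime (\<lambda>z. certifies e (fst z) (fst (snd z)) (fst (snd (snd z))) (fst (snd (snd (snd z)))) (snd (snd (snd (snd z)))))"
  proof (induction e)
    case (Suc e)
    show ?case unfolding certifies.simps by (intro polytime_intros polytime_comp5 [OF Suc])
  qed (unfold certifies.simps, intro polytime_intros)
  then show ?thesis by (rule polytime_comp5) (rule assms)+
qed

lemma polytime_conflict [polytime_intros]: "polytime u \<Longrightarrow> polytime v \<Longrightarrow> polytime (\<lambda>x. conflict (u x) (v x))"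
  unfolding conflict_def by (intro polytime_intros)

lemma polytime_refuted [polytime_intros]:
  assumes "polytime k" "polytime C" "polytime t" "polytime u"
  shows "polytime (\<lambda>x. refuted d (k x) (C x) (t x) (u x))"
proof -
  have "polytime (\<lambda>z. refuted d (fst z) (fst (snd z)) (fst (snd (snd z))) (snd (snd (snd z))))"
    unfolding refuted_def by (intro polytime_intros)
  from polytime_comp [OF polytime_pair [OF assms(1) polytime_pair [OF assms(2) polytime_pair [OF assms(3,4)]]] this]
  show ?thesis by simp
qed

lemma polytime_bad [polytime_intros]:
  assumes "polytime k" "polytime C" "polytime t"
  shows "polytime (\<lambda>x. bad d (k x) (C x) (t x))"
proof -
  have "polytime (\<lambda>z. bad d (fst z) (fst (snd z)) (snd (snd z)))"
    unfolding bad_def by (intro polytime_intros)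
  then show ?thesis by (rule polytime_comp3) (rule assms)+
qed

lemma polytime_choices [polytime_intros]:
  assumes "polytime k" "polytime C"
  shows "polytime (\<lambda>x. choices d (k x) (C x))"
proof -
  have "polytime (\<lambda>z. choices d (fst z) (snd z))"
    unfolding choices_def input_choices_def gate_choices_def by (intro polytime_intros)
  then show ?thesis by (rule polytime_comp2) (rule assms)+
qed

lemma polytime_tuples [polytime_intros]:
  assumes "polytime us"
  shows "polytime (\<lambda>x. tuples n (us x))"
proof -
  have "polytime (\<lambda>us. tuples n us)"
  proof (induction n)
    case (Suc n)
    show ?case unfolding tuples.simps by (intro polytime_intros polytime_comp [OF _ Suc])
  qed (unfold tuples.simps, intro polytime_intros)
  then show ?thesis by (rule polytime_comp [OF assms])
qed

lemma polytime_bad_tuples [polytime_intros]: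
  assumes "polytime k" "polytime C"
  shows "polytime (\<lambda>x. bad_tuples d (k x) (C x))"
proof -
  have "polytime (\<lambda>z. bad_tuples d (fst z) (snd z))"
    unfolding bad_tuples_def by (intro polytime_intros)
  then show ?thesis by (rule polytime_comp2) (rule assms)+
qed

section \<open>Writing down the median instance\<close>

lemma polytime_near [polytime_intros]:
  assumes "polytime U" "polytime Ts" "polytime a" "polytime b"
  shows "polytime (\<lambda>x. near (U x) (Ts x) (a x) (b x))"
proof -
  have "polytime (\<lambda>z. near (fst z) (fst (snd z)) (fst (snd (snd z))) (snd (snd (snd z))))"
    unfolding near_def by (intro polytime_intros)
  from polytime_comp [OF polytime_pair [OF assms(1) polytime_pair [OF assms(2) polytime_pair [OF assms(3,4)]]] this]
  show ?thesis by simp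
qed

lemma enc_rat_of_nat: "enc_rat (of_nat n) = Pair (Pair Atom (enc_binary n)) (Pair Atom (enc_binary 1))"
proof -
  have "quotient_of (of_nat n) = (int n, 1)"
    using quotient_of_int [of "int n"] by (simp add: Rat.of_int_def)
  then show ?thesis by (simp add: enc_rat_def enc_int_def enc_unary_def)
qed

text \<open>Only three distances occur, so the program selects among three constant codes instead of
  doing rational arithmetic.\<close>

lemma polytime_enc_rat_dst:
  assumes "polytime U" "polytime Ts" "polytime a" "polytime b"
  shows "polytime (\<lambda>x. enc_rat (dst (U x) (Ts x) (a x) (b x)))"
proof -
  have "polytime (\<lambda>x. if a x = b x then enc_rat 0
      else if near (U x) (Ts x) (a x) (b x) \<or> near (U x) (Ts x) (b x) (a x) then enc_rat 1 else enc_rat 2)"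
    by (intro polytime_intros assms)
  then show ?thesis by (rule polytime_recast) (simp add: dst_def)
qed

lemma upt_split: "[0..<m] @ [m..<m + n] = [0..<m + n]"
  by (metis le0 le_add1 upt_add_eq_append add_0 upt_add_eq_append)

lemma polytime_upt_from [polytime_intros]: "polytime m \<Longrightarrow> polytime n \<Longrightarrow> polytime (\<lambda>x. [m x..<n x])"
proof (rule polytime_recast [of "\<lambda>x. drop (m x) [0..<n x]"])
qed (intro polytime_intros; assumption | simp add: drop_upt)+

lemma polytime_median_instance [polytime_intros]:
  assumes "polytime U" "polytime Ts"
  shows "polytime (\<lambda>x. median_instance (U x) (Ts x))"
proof -
  let ?U = "\<lambda>z :: choice list \<times> choice list list. fst z" and ?Ts = "\<lambda>z :: choice list \<times> choice list list. snd z"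
  let ?P = "\<lambda>z. [0..<length (?U z) + length (?Ts z)]"
  have 1: "polytime (\<lambda>z. enc [0..<length (?U z)])" "polytime (\<lambda>z. enc [length (?U z)..<length (?U z) + length (?Ts z)])"
    by (intro polytime_enc_tree polytime_intros)+
  have 2: "polytime (\<lambda>z. enc (map (\<lambda>x. map (\<lambda>y. enc_rat (dst (?U z) (?Ts z) x y)) (?P z)) (?P z)))"
    by (intro polytime_enc_tree polytime_intros polytime_enc_rat_dst)
  have 3: "polytime (\<lambda>z. Pair (Pair Atom (enc_binary (length (?Ts z)))) (Pair Atom (enc_binary 1)))"
    by (intro polytime_intros)
  have "polytime (\<lambda>z. [enc [0..<length (?U z)], enc [length (?U z)..<length (?U z) + length (?Ts z)],
      enc (map (\<lambda>x. map (\<lambda>y. enc_rat (dst (?U z) (?Ts z) x y)) (?P z)) (?P z)),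
      Pair (Pair Atom (enc_binary (length (?Ts z)))) (Pair Atom (enc_binary 1))])"
    by (intro polytime_intros 1 2 3)
  then have "polytime (\<lambda>z. median_instance (?U z) (?Ts z))"
    by (rule polytime_recast) (simp add: median_instance_def enc_median_def enc_rat_of_nat upt_split comp_def
        del: upt_Suc map_append)
  then show ?thesis by (rule polytime_comp2) (rule assms)+
qed

section \<open>Recognizing valid inputs\<close>

lemma polytime_unary [polytime_intros]: "polytime t \<Longrightarrow> polytime (\<lambda>x. unary (t x))"
proof (erule polytime_comp)
  show "polytime (\<lambda>t. unary t)" unfolding unary_def by (intro polytime_intros)
qed

lemma polytime_gate_ok [polytime_intros]: "polytime t \<Longrightarrow> polytime (\<lambda>x. gate_ok (t x))"
proof (erule polytime_comp)
  show "polytime (\<lambda>t. gate_ok t)" unfolding gate_ok_def by (intro polytime_intros)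
qed

lemma polytime_parse_circuit [polytime_intros]: "polytime t \<Longrightarrow> polytime (\<lambda>x. parse_circuit (t x))"
proof (erule polytime_comp)
  show "polytime (\<lambda>t. parse_circuit t)" unfolding parse_circuit_def parse_gate_def by (intro polytime_intros)
qed

lemma distinct_iff_nth_or:
  "distinct xs \<longleftrightarrow> (\<forall>i\<in>set [0..<length xs]. \<forall>j\<in>set [0..<i]. \<not> nth_or 0 xs i = nth_or (0 :: nat) xs j)"
proof
  assume "distinct xs"
  then show "\<forall>i\<in>set [0..<length xs]. \<forall>j\<in>set [0..<i]. \<not> nth_or 0 xs i = nth_or 0 xs j"
    by (simp add: nth_eq_iff_index_eq)
next
  assume R: "\<forall>i\<in>set [0..<length xs]. \<forall>j\<in>set [0..<i]. \<not> nth_or 0 xs i = nth_or 0 xs j"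
  have less: "xs ! i \<noteq> xs ! j" if "i < length xs" "j < i" for i j
    using R that nth_or_nth [of i xs 0] nth_or_nth [of j xs 0] by simp
  show "distinct xs"
    unfolding distinct_conv_nth
  proof (intro allI impI)
    fix i j assume "i < length xs" "j < length xs" "i \<noteq> j"
    then show "xs ! i \<noteq> xs ! j" using less [of i j] less [of j i] by (cases "i < j") simp_all
  qed
qed

lemma polytime_arity_ok [polytime_intros]: "polytime g \<Longrightarrow> polytime (\<lambda>x. arity_ok (g x))"
proof (erule polytime_comp)
  have "polytime (\<lambda>g. 2 \<le> gate_tag g \<longrightarrow> 2 \<le> length (preds g) \<and> distinct (preds g))"
    unfolding distinct_iff_nth_or by (intro polytime_intros)
  moreover have "arity_ok g \<longleftrightarrow> (2 \<le> gate_tag g \<longrightarrow> 2 \<le> length (preds g) \<and> distinct (preds g))" for g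
    by (cases g) auto
  ultimately show "polytime (\<lambda>g. arity_ok g)" by simp
qed

lemma circuit_iff_gate_at:
  "circuit C \<longleftrightarrow> \<not> C = [] \<and>
    (\<forall>i\<in>set [0..<length C]. arity_ok (gate_at C i) \<and> (\<forall>j\<in>set (preds (gate_at C i)). j < i))"
  by (auto simp: circuit_def)

lemma polytime_circuit [polytime_intros]: "polytime C \<Longrightarrow> polytime (\<lambda>x. circuit (C x))"
proof (erule polytime_comp)
  show "polytime (\<lambda>C. circuit C)" unfolding circuit_iff_gate_at by (intro polytime_intros)
qed

lemma polytime_reduction: "polytime (\<lambda>z. reduction d z)"
  unfolding reduction_def valid_input_def by (intro polytime_intros)

section \<open>Composition of reductions\<close>

lemma polytime_mult: "polytime m \<Longrightarrow> polytime n \<Longrightarrow> polytime (\<lambda>x. m x * (n x :: nat))"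
proof -
  assume m: "polytime m" and n: "polytime n"
  have "polytime (\<lambda>x. length (concat (map (\<lambda>_. replicate (n x) Atom) (replicate (m x) Atom))))"
    by (intro polytime_intros polytime_units m polytime_comp [OF _ n])
  then show ?thesis by (rule polytime_recast) (simp add: length_concat comp_def sum_list_replicate map_replicate)
qed

lemma polytime_power: "polytime m \<Longrightarrow> polytime (\<lambda>x. m x ^ c :: nat)"
  by (induction c) (auto intro: polytime_const polytime_mult)

text \<open>The functions in a parameterized reduction are merely computable, with no time bound.
  They are postprocessed by a polynomial-time program that also receives \<open>k\<close>.\<close>

lemma computable_PT:
  assumes f: "computable f" and h: "polytime (\<lambda>z. h (fst z) (snd z))"
  shows "computable (\<lambda>k. h (f k) k :: nat)"
proof -
  obtain p where p: "\<And>n. \<exists>t. computes_in p (enc_unary n) t (enc_unary (f n))"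
    using f unfolding computable_def by blast
  obtain p' N K where p': "\<And>x t y. computes_in p x t y \<Longrightarrow> runs p' N x (t + K) y"
    by (rule computes_in_runs [of p]) (rule that)
  obtain q M c where q: "\<And>a L. M \<le> L \<Longrightarrow> runs q L (enc a) ((enc_size a + 2) ^ c) (enc (h (fst a) (snd a)))"
    by (rule polytime_E [OF h]) (rule that)
  let ?N = "max (Suc N) M"
  have "\<exists>t. computes_in (Seq (pair_cmd p' (Assign 0 (Var 0)) ?N) q) (enc_unary k) t (enc_unary (h (f k) k))" for k
  proof -
    obtain t where t: "computes_in p (enc_unary k) t (enc_unary (f k))" using p by blast
    have 1: "runs p' ?N (enc_unary k) (t + K) (enc_unary (f k))"
      by (rule runs_mono [OF p' [OF t]]) auto
    have 2: "runs (Assign 0 (Var 0)) ?N (enc_unary k) (1 + tree_size (enc_unary k)) (enc_unary k)"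
      by (rule runs_mono [OF runs_expr]) auto
    have "runs q (?N + 2) (Pair (enc_unary (f k)) (enc_unary k)) ((enc_size (f k, k) + 2) ^ c) (enc_unary (h (f k) k))"
      using q [of "?N + 2" "(f k, k)"] by simp
    from runs_seq [OF runs_pair [OF 1 2] this] show ?thesis
      by (blast dest: runs_computes_in)
  qed
  then show ?thesis unfolding computable_def by blast
qed

lemma tree_size_enc_unary: "tree_size (enc_unary n) = 2 * n + 1"
  by (induction n) (auto simp: enc_unary_def)

text \<open>The intermediate instance is no larger than input plus running time, so a polynomial in
  its size still splits into a function of \<open>k\<close> times a polynomial in
  \<open>tree_size x\<close>. The parameter grows by a constant.\<close>

lemma fpt_reducible_PT:
  assumes A: "A \<le>\<^sub>f\<^sub>p\<^sub>t B" and r: "polytime r"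
    and correct: "\<And>x k. (x, k) \<in> B \<longleftrightarrow> r (x, k) \<in> D"
    and param: "\<And>x k. snd (r (x, k)) \<le> k + b"
  shows "A \<le>\<^sub>f\<^sub>p\<^sub>t D"
proof -
  obtain p f g c where f: "computable f" and g: "computable g"
    and p: "\<And>x k. \<exists>x' k' t. computes_in p (Pair x (enc_unary k)) t (Pair x' (enc_unary k')) \<and>
        t \<le> f k * tree_size x ^ c \<and> k' \<le> g k \<and> ((x, k) \<in> A \<longleftrightarrow> (x', k') \<in> B)"
    using A unfolding fpt_reducible_def by blast
  obtain p' N K where p': "\<And>x t y. computes_in p x t y \<Longrightarrow> runs p' N x (t + K) y"
    by (rule computes_in_runs [of p]) (rule that)
  obtain q M e where q: "\<And>a L. M \<le> L \<Longrightarrow> runs q L (enc a) ((enc_size a + 2) ^ e) (enc (r a))"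
    by (rule polytime_E [OF r]) (rule that)
  \<comment> \<open>The base collects \<open>f k\<close>, the size \<open>2 * k + 1\<close> of the
    unary parameter, the cleaning cost \<open>K\<close> and constants; times a power of
    \<open>tree_size x\<close> it bounds both the first phase and the intermediate size. Of the
    exponent, \<open>e\<close> pays for \<open>q\<close>, and the extra 2 makes room for adding the
    two phases.\<close>
  let ?F = "\<lambda>k. (f k + (k + k) + (K + 5)) ^ (e + 2)"
  have F: "computable ?F"
    by (rule computable_PT [OF f, of "\<lambda>a k. (a + (k + k) + (K + 5)) ^ (e + 2)"]) (intro polytime_power polytime_intros)
  have G: "computable (\<lambda>k. g k + b)"
    by (rule computable_PT [OF g, of "\<lambda>a k. a + b"]) (intro polytime_intros)
  have "\<exists>y l t. computes_in (Seq p' q) (Pair x (enc_unary k)) t (Pair y (enc_unary l)) \<and>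
      t \<le> ?F k * tree_size x ^ (Suc c * (e + 2)) \<and> l \<le> g k + b \<and> ((x, k) \<in> A \<longleftrightarrow> (y, l) \<in> D)" for x k
  proof -
    obtain x' k' t where t: "computes_in p (Pair x (enc_unary k)) t (Pair x' (enc_unary k'))"
      "t \<le> f k * tree_size x ^ c" "k' \<le> g k" "(x, k) \<in> A \<longleftrightarrow> (x', k') \<in> B"
      using p by blast
    obtain y l where yl: "r (x', k') = (y, l)" by fastforce
    let ?n = "max N M" and ?s = "tree_size x" and ?y = "f k + (k + k) + (K + 5)"
    have 1: "runs p' ?n (Pair x (enc_unary k)) (t + K) (Pair x' (enc_unary k'))"
      by (rule runs_mono [OF p' [OF t(1)]]) auto
    have 2: "runs q ?n (Pair x' (enc_unary k')) ((enc_size (x', k') + 2) ^ e) (Pair y (enc_unary l))"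
      using q [of ?n "(x', k')"] yl by simp
    from runs_computes_in [OF runs_seq [OF 1 2]] obtain u where
      u: "u \<le> t + K + (enc_size (x', k') + 2) ^ e"
        "computes_in (Seq p' q) (Pair x (enc_unary k)) u (Pair y (enc_unary l))" by blast
    let ?z = "?y * ?s ^ Suc c"
    have s1: "1 \<le> ?s ^ c" by simp
    \<comment> \<open>The input size is itself a summand of the bound while \<open>c\<close> may be
      0, hence the exponent \<open>Suc c\<close>.\<close>
    have ss: "?s \<le> ?s ^ Suc c" using mult_le_mono2 [OF s1, of ?s] by simp
    have sc: "?s ^ c \<le> ?s ^ Suc c" by (rule power_increasing) simp_all
    have s2: "1 \<le> ?s ^ Suc c" by simp
    have "f k * ?s ^ c \<le> f k * ?s ^ Suc c" using sc by (rule mult_le_mono2)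
    moreover have "K \<le> K * ?s ^ Suc c" "k + k \<le> (k + k) * ?s ^ Suc c"
      using mult_le_mono2 [OF s2] by (metis mult.right_neutral)+
    moreover have "?z = f k * ?s ^ Suc c + (k + k) * ?s ^ Suc c + (K * ?s ^ Suc c + 5 * ?s ^ Suc c)"
      by (simp only: add_mult_distrib)
    moreover have "enc_size (x', k') \<le> 1 + ?s + (2 * k + 1) + (t + K)"
      using runs_size [OF 1] by (simp add: tree_size_enc_unary)
    ultimately have "t + K \<le> ?z" "enc_size (x', k') + 2 \<le> ?z" "2 \<le> ?z"
      using t(2) ss s2 by linarith+
    have "(enc_size (x', k') + 2) ^ e \<le> ?z ^ e"
      using \<open>enc_size (x', k') + 2 \<le> ?z\<close> by (rule power_mono) simp
    also have "\<dots> \<le> ?z ^ Suc e" by (rule power_increasing) (use \<open>2 \<le> ?z\<close> in linarith)+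
    finally have "u \<le> ?z + ?z ^ Suc e" using u(1) \<open>t + K \<le> ?z\<close> by linarith
    also have "?z ^ 1 \<le> ?z ^ Suc e" by (rule power_increasing) (use \<open>2 \<le> ?z\<close> in linarith)+
    then have "?z + ?z ^ Suc e \<le> 2 * ?z ^ Suc e" by simp
    also have "\<dots> \<le> ?z * ?z ^ Suc e" using \<open>2 \<le> ?z\<close> by (rule mult_le_mono1)
    also have "\<dots> = ?F k * ?s ^ (Suc c * (e + 2))"
      by (simp only: power_mult_distrib power_mult flip: power_Suc) simp
    finally have "u \<le> ?F k * ?s ^ (Suc c * (e + 2))" .
    moreover have "l \<le> g k + b" using param [of x' k'] yl t(3) by simp
    moreover have "(x, k) \<in> A \<longleftrightarrow> (y, l) \<in> D" using t(4) correct [of x' k'] yl by simp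
    ultimately show ?thesis using u(2) by blast
  qed
  then show ?thesis unfolding fpt_reducible_def using F G by blast
qed

theorem theorem3:
  shows "W_hard 1 co_median"
  unfolding W_hard_def
proof
  fix A assume "A \<in> W_class 1"
  then obtain d where "A \<le>\<^sub>f\<^sub>p\<^sub>t weighted_circuit_sat 1 d"
    unfolding W_class_def by blast
  then show "A \<le>\<^sub>f\<^sub>p\<^sub>t co_median"
    by (rule fpt_reducible_PT [OF _ polytime_reduction reduction_correct reduction_parameter])
qed

end
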